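(* Let $n\ge 2$, let $\Omega\subset\mathbb{C}^n$ be a bounded $\mathbb{C}$-convex domain and let $S\subset\mathbb{C}^n$ be a complex affine hyperplane such that $\Omega\cap S\neq\varnothing$. Then $(\Omega\setminus S,k_{\Omega\setminus S})$ is not Gromov hyperbolic.
   Context: A domain is a non-empty connected open set. A domain $\Omega\subset\mathbb{C}^n$ is $\mathbb{C}$-convex if every non-empty intersection of $\Omega$ with a complex affine line is a simply connected domain (in that line). Let $\mathbb{D}=\{\lambda\in\mathbb{C}:|\lambda|<1\}$. For a domain $G\subset\mathbb{C}^n$ the Kobayashi pseudometric is $\kappa_G(z;X)=\inf\{|\lambda|:\text{there is a holomorphic } f:\mathbb{D}\to G \text{ with } f(0)=z,\ \lambda f'(0)=X\}$ for $z\in G$, $X\in\mathbb{C}^n$. The Kobayashi pseudodistance is $k_G(p,q)=\inf_\alpha\int_0^1\kappa_G(\alpha(t);\alpha'(t))\,dt$, the infimum over all piecewise $\mathcal{C}^1$ curves $\alpha:[0,1]\to G$ with $\alpha(0)=p$, $\alpha(1)=q$. It is a distance if $G$ is bounded. In a metric space $(X,d)$ a curve $\alpha:[a,b]\to X$ is a geodesic if $d(\alpha(s),\alpha(t))=|s-t|$ for all $s,t\in[a,b]$. A geodesic triangle is a choice of three points together with geodesic segments joining them pairwise; it is $M$-thin if every point on any side is within distance $M$ of the union of the other two sides. A geodesic metric space is Gromov hyperbolic if there is $M>0$ such that every geodesic triangle is $M$-thin. "Not Gromov hyperbolic" means that for every $M>0$ there is a geodesic triangle that is not $M$-thin. *)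

theory Defs
  imports "HOL-Complex_Analysis.Complex_Analysis"
begin

definition complex_affine_line :: "(complex ^ 'n) set \<Rightarrow> bool" where
  "complex_affine_line L \<longleftrightarrow> (\<exists>p v. v \<noteq> 0 \<and> L = range (\<lambda>c::complex. p + c *s v))"

definition complex_affine_hyperplane :: "(complex ^ 'n) set \<Rightarrow> bool" where
  "complex_affine_hyperplane S \<longleftrightarrow> (\<exists>a b. a \<noteq> 0 \<and> S = {z. (\<Sum>i\<in>UNIV. a $ i * z $ i) = b})"

definition c_convex :: "(complex ^ 'n) set \<Rightarrow> bool" where
  "c_convex \<Omega> \<longleftrightarrow>
     (\<forall>L. complex_affine_line L \<and> \<Omega> \<inter> L \<noteq> {} \<longrightarrow>
        openin (top_of_set L) (\<Omega> \<inter> L) \<and> connected (\<Omega> \<inter> L) \<and> simply_connected (\<Omega> \<inter> L))"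

definition kobayashi_metric :: "(complex ^ 'n) set \<Rightarrow> complex ^ 'n \<Rightarrow> complex ^ 'n \<Rightarrow> real" where
  "kobayashi_metric G z X =
     Inf {cmod c | c. \<exists>f. (\<forall>i. (\<lambda>\<zeta>. f \<zeta> $ i) holomorphic_on ball 0 1) \<and> f ` ball 0 1 \<subseteq> G \<and>
            f 0 = z \<and> c *s (\<chi> i. deriv (\<lambda>\<zeta>. f \<zeta> $ i) 0) = X}"

text \<open>Unlike \<^const>\<open>piecewise_C1_differentiable_on\<close>, the derivative is required to extend
  continuously to the endpoints of every piece, so it is bounded on the whole interval
  and the curve has finite length.\<close>

definition piecewise_C1_curve :: "(real \<Rightarrow> 'a::real_normed_vector) \<Rightarrow> bool" where
  "piecewise_C1_curve \<alpha> \<longleftrightarrow>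
     (\<exists>m t. t 0 = 0 \<and> t m = 1 \<and>
        (\<forall>i<m. t i < t (Suc i) \<and>
           (\<exists>D. continuous_on {t i..t (Suc i)} D \<and>
              (\<forall>s\<in>{t i..t (Suc i)}.
                 (\<alpha> has_vector_derivative D s) (at s within {t i..t (Suc i)})))))"

text \<open>The integrand is non-negative, so its integral is taken in \<^typ>\<open>ennreal\<close>; this avoids the
  convention that the real-valued integral of a non-integrable function is zero. The curve need
  not be differentiable at the finitely many break points, which do not affect the integral. If
  \<open>G\<close> is open and connected and \<open>p\<close>, \<open>q\<close> lie in \<open>G\<close>, the infimum is finite.\<close>

definition kobayashi_dist :: "(complex ^ 'n) set \<Rightarrow> complex ^ 'n \<Rightarrow> complex ^ 'n \<Rightarrow> real" where
  "kobayashi_dist G p q =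
     enn2real (INF \<alpha> \<in> {\<alpha>. piecewise_C1_curve \<alpha> \<and> \<alpha> ` {0..1} \<subseteq> G \<and> \<alpha> 0 = p \<and> \<alpha> 1 = q}.
       \<integral>\<^sup>+t\<in>{0..1}. ennreal (kobayashi_metric G (\<alpha> t) (vector_derivative \<alpha> (at t))) \<partial>lborel)"

definition geodesic :: "'a set \<Rightarrow> ('a \<Rightarrow> 'a \<Rightarrow> real) \<Rightarrow> real \<Rightarrow> real \<Rightarrow> (real \<Rightarrow> 'a) \<Rightarrow> bool" where
  "geodesic X d a b \<alpha> \<longleftrightarrow>
     a \<le> b \<and> \<alpha> ` {a..b} \<subseteq> X \<and> (\<forall>s\<in>{a..b}. \<forall>t\<in>{a..b}. d (\<alpha> s) (\<alpha> t) = \<bar>s - t\<bar>)"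

definition geodesic_segment ::
    "'a set \<Rightarrow> ('a \<Rightarrow> 'a \<Rightarrow> real) \<Rightarrow> 'a \<Rightarrow> 'a \<Rightarrow> 'a set \<Rightarrow> bool" where
  "geodesic_segment X d x y A \<longleftrightarrow>
     (\<exists>a b \<alpha>. geodesic X d a b \<alpha> \<and> \<alpha> a = x \<and> \<alpha> b = y \<and> A = \<alpha> ` {a..b})"

definition geodesic_triangle ::
    "'a set \<Rightarrow> ('a \<Rightarrow> 'a \<Rightarrow> real) \<Rightarrow> 'a set \<Rightarrow> 'a set \<Rightarrow> 'a set \<Rightarrow> bool" where
  "geodesic_triangle X d A B C \<longleftrightarrow>
     (\<exists>x y z. geodesic_segment X d x y A \<and> geodesic_segment X d y z B \<and> geodesic_segment X d z x C)"

definition thin_triangle ::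
    "('a \<Rightarrow> 'a \<Rightarrow> real) \<Rightarrow> real \<Rightarrow> 'a set \<Rightarrow> 'a set \<Rightarrow> 'a set \<Rightarrow> bool" where
  "thin_triangle d M A B C \<longleftrightarrow>
     (\<forall>p\<in>A. \<exists>q\<in>B \<union> C. d p q \<le> M) \<and>
     (\<forall>p\<in>B. \<exists>q\<in>C \<union> A. d p q \<le> M) \<and>
     (\<forall>p\<in>C. \<exists>q\<in>A \<union> B. d p q \<le> M)"

text \<open>That \<open>(X, d)\<close> is a geodesic metric space is deliberately not part of the definition: the
  negation asserts that there are geodesic triangles that are not \<open>M\<close>-thin, for every \<open>M > 0\<close>.\<close>

definition gromov_hyperbolic :: "'a set \<Rightarrow> ('a \<Rightarrow> 'a \<Rightarrow> real) \<Rightarrow> bool" where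
  "gromov_hyperbolic X d \<longleftrightarrow>
     (\<exists>M>0. \<forall>A B C. geodesic_triangle X d A B C \<longrightarrow> thin_triangle d M A B C)"

end

theory Submission imports Defs begin

text \<open>
Write \<open>S\<close> as the zero set of an affine function \<open>f\<close> and put \<open>G = \<Omega> - S\<close>. Near \<open>S\<close> the domain \<open>G\<close>
is a cusp: \<open>f\<close> maps it into a punctured disc, whose puncture is infinitely far away. Measure the
depth of a point in the cusp by \<open>ln (ln (R / \<bar>f\<bar>)) / 2\<close>, up to sign the distance to a reference
circle in a punctured disc of radius \<open>R\<close>. Take a point \<open>p\<close> of \<open>\<Omega> \<inter> S\<close>, a second point \<open>q\<close> of \<open>\<Omega> \<inter>
S\<close> such that the segment from \<open>p\<close> to \<open>q\<close> stays in \<open>\<Omega>\<close>, and a direction \<open>e\<close> transversal to \<open>S\<close>. A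
neighbourhood of the segment contains discs of some radius \<open>\<epsilon>\<close> in the directions of the segment
and of \<open>e\<close>. If \<open>H\<close> is large compared with \<open>\<bar>q - p\<bar> / \<epsilon>\<close>, then descending by \<open>H\<close> in the cusp costs
at most \<open>H\<close>, \<^emph>\<open>even if one moves from above \<open>p\<close> to above \<open>q\<close> on the way\<close>: the metric behaves like
the maximum of a vertical and a horizontal metric (\<open>dist_cusp_le\<close>).

Hence, if \<open>x\<close>, \<open>w\<close>, \<open>y\<close> lie above \<open>p\<close> at depths \<open>A\<close>, \<open>A + H\<close>, \<open>A + 2 H\<close> and \<open>z\<close> lies above \<open>q\<close> at
depth \<open>A + H\<close>, both \<open>w\<close> and \<open>z\<close> are within \<open>H\<close> of \<open>x\<close> and of \<open>y\<close>, whereas \<open>x\<close> and \<open>y\<close> are at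
distance at least \<open>2 H - 1\<close> by the Schwarz lemma for \<open>f\<close>. So \<open>w\<close> and \<open>z\<close> are both almost midpoints
of \<open>x\<close> and \<open>y\<close>. In a space with \<open>M\<close>-thin triangles two such points are at distance at most \<open>4 M +
2\<close> (\<open>almost_midpoints_close\<close>). But the distance between \<open>w\<close> and \<open>z\<close> can be made arbitrarily large:
let \<open>q\<close> tend to a boundary point of \<open>\<Omega>\<close> (\<open>horizontal_separation\<close>).

Two ingredients remain. First, through every point outside a \<open>\<complex>\<close>-convex domain there passes a
complex hyperplane that avoids the domain (\<open>c_convex_imp_linearly_convex\<close>). With the same depth
function, now for this hyperplane, a boundary point is infinitely far away, which gives the
separation of \<open>w\<close> and \<open>z\<close> and shows that closed balls of the Kobayashi distance of \<open>G\<close> are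
compact. Second, the triangles must exist: since the distance is defined by lengths of curves,
compactness of balls yields geodesics between points at positive distance (\<open>ex_geodesic\<close>).
\<close>

section \<open>Complex linear functionals\<close>

text \<open>The complex bilinear pairing, in which hyperplanes are level sets; it differs from the Hermitian
inner product by the absence of conjugation.\<close>

definition cdot :: "complex ^ 'n \<Rightarrow> complex ^ 'n \<Rightarrow> complex" where
  "cdot a z = (\<Sum>i\<in>UNIV. a $ i * z $ i)"

lemma cdot_add: "cdot a (z + w) = cdot a z + cdot a w"
  by (simp add: cdot_def distrib_left sum.distrib)

lemma cdot_diff: "cdot a (z - w) = cdot a z - cdot a w"
  by (simp add: cdot_def right_diff_distrib sum_subtractf)

lemma cdot_scale: "cdot a (c *s z) = c * cdot a z"
  by (simp add: cdot_def sum_distrib_left algebra_simps)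

lemma cdot_comb: "cdot (c *s a + d *s b) z = c * cdot a z + d * cdot b z"
  by (simp add: cdot_def sum_distrib_left distrib_right sum.distrib algebra_simps)

lemma cdot_axis_left: "cdot (axis i 1) z = z $ i"
  by (simp add: cdot_def axis_def if_distrib if_distribR cong: if_cong)

lemma cdot_axis_right: "cdot a (axis i 1) = a $ i"
  by (simp add: cdot_def axis_def if_distrib if_distribR cong: if_cong)

lemma continuous_on_cdot [continuous_intros]:
  "continuous_on A f \<Longrightarrow> continuous_on A (\<lambda>x. cdot a (f x))"
  unfolding cdot_def by (intro continuous_intros)

lemma continuous_cdot [continuous_intros]:
  "continuous F f \<Longrightarrow> continuous F (\<lambda>x. cdot a (f x))"
  unfolding cdot_def by (intro continuous_intros)

lemma continuous_on_scale [continuous_intros]: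
  fixes f :: "'a::topological_space \<Rightarrow> complex ^ 'n"
  assumes "continuous_on A c" "continuous_on A f"
  shows "continuous_on A (\<lambda>x. c x *s f x)"
  unfolding vector_scalar_mult_def using assms by (intro continuous_intros)

lemma norm_scale: "norm (c *s (z :: complex ^ 'n)) = cmod c * norm z"
  by (simp add: norm_vec_def norm_mult L2_set_right_distrib)

section \<open>Logarithms along complex lines\<close>

lemma hermitian_square_nonzero:
  fixes x y :: complex
  assumes "x \<noteq> 0 \<or> y \<noteq> 0" shows "x * cnj x + y * cnj y \<noteq> 0"
proof -
  have "x * cnj x + y * cnj y = of_real ((cmod x)^2 + (cmod y)^2)"
    by (simp only: of_real_add of_real_power complex_norm_square[symmetric])
  moreover have "(cmod x)^2 + (cmod y)^2 \<noteq> 0"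
    using assms by (simp add: sum_power2_eq_zero_iff)
  ultimately show ?thesis by (metis of_real_eq_0_iff)
qed

text \<open>Two logarithms of the same number differ by a multiple of \<open>2 \<pi> \<i>\<close>, so that a continuous choice
cannot jump.\<close>

lemma exp_constant_imp_constant:
  fixes f :: "'a::topological_space \<Rightarrow> complex"
  assumes "connected S" "continuous_on S f" and e: "\<And>x. x \<in> S \<Longrightarrow> exp (f x) = c"
    and "x \<in> S" "y \<in> S"
  shows "f x = f y"
proof -
  have "f constant_on S"
  proof (rule continuous_discrete_range_constant[OF assms(1,2)])
    fix x assume x: "x \<in> S"
    have "2 * pi \<le> norm (f y - f x)" if y: "y \<in> S" "f y \<noteq> f x" for y
    proof -
      from e[OF x] e[OF y(1)] have "exp (f y) = exp (f x)" by simp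
      then obtain n :: int where n: "f y = f x + (of_int (2 * n) * pi) * \<i>"
        by (auto simp: exp_eq)
      with y have "n \<noteq> 0" by auto
      then have "1 \<le> \<bar>n\<bar>" by linarith
      then have "1 \<le> \<bar>real_of_int n\<bar>" by linarith
      then show ?thesis using n by (simp add: norm_mult)
    qed
    then show "\<exists>e>0. \<forall>y. y \<in> S \<and> f y \<noteq> f x \<longrightarrow> e \<le> norm (f y - f x)"
      by (intro exI[of _ "2 * pi"]) auto
  qed
  then show ?thesis using assms(4,5) unfolding constant_on_def by auto
qed

text \<open>The parameter \<open>0\<close> corresponds to \<open>w\<close> and \<open>1\<close> to \<open>z\<close>. For \<open>z = w\<close> in \<open>\<Omega>\<close> the slice is the whole
plane, which keeps it simply connected in this degenerate case.\<close>

definition slice :: "(complex ^ 'n) set \<Rightarrow> complex ^ 'n \<Rightarrow> complex ^ 'n \<Rightarrow> complex set" where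
  "slice \<Omega> z w = {\<tau>. w + \<tau> *s (z - w) \<in> \<Omega>}"

definition slices_simply_connected :: "(complex ^ 'n) set \<Rightarrow> bool" where
  "slices_simply_connected \<Omega> \<longleftrightarrow> (\<forall>z\<in>\<Omega>. \<forall>w\<in>\<Omega>. simply_connected (slice \<Omega> z w))"

lemma open_slice: assumes "open \<Omega>" shows "open (slice \<Omega> z w)"
proof -
  have "slice \<Omega> z w = (\<lambda>\<tau>. w + \<tau> *s (z - w)) -` \<Omega>" by (auto simp: slice_def)
  moreover have "continuous_on UNIV (\<lambda>\<tau>. w + \<tau> *s (z - w))" by (intro continuous_intros)
  ultimately show ?thesis using open_vimage[OF assms] by simp
qed

lemma c_convex_imp_slices_simply_connected:
  fixes \<Omega> :: "(complex ^ 'n) set"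
  assumes "c_convex \<Omega>" shows "slices_simply_connected \<Omega>"
  unfolding slices_simply_connected_def
proof (intro ballI)
  fix z w assume z: "z \<in> \<Omega>" and w: "w \<in> \<Omega>"
  show "simply_connected (slice \<Omega> z w)"
  proof (cases "z = w")
    case True
    then have "slice \<Omega> z w = UNIV" using w by (auto simp: slice_def)
    then show ?thesis by (simp add: convex_imp_simply_connected)
  next
    case False
    then obtain i where i: "(z - w) $ i \<noteq> 0"
      by (metis right_minus_eq vec_eq_iff zero_index)
    let ?L = "range (\<lambda>c. w + c *s (z - w))"
    have L: "complex_affine_line ?L" unfolding complex_affine_line_def using False
      by (intro exI[of _ w] exI[of _ "z - w"]) auto
    have "w \<in> \<Omega> \<inter> ?L" using w by (auto intro!: image_eqI[of _ _ 0])
    with L assms have sc: "simply_connected (\<Omega> \<inter> ?L)" unfolding c_convex_def by blast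
    have "homeomorphism (slice \<Omega> z w) (\<Omega> \<inter> ?L) (\<lambda>\<tau>. w + \<tau> *s (z - w))
            (\<lambda>x. (x $ i - w $ i) / (z - w) $ i)"
    proof -
      have inv: "((w + \<tau> *s (z - w)) $ i - w $ i) / (z - w) $ i = \<tau>" for \<tau>
        using i by (simp only: vector_add_component vector_smult_component add_diff_cancel_left' nonzero_mult_div_cancel_right not_False_eq_True)
      show ?thesis unfolding homeomorphism_def
      proof (intro conjI ballI)
        show "(\<lambda>\<tau>. w + \<tau> *s (z - w)) ` slice \<Omega> z w = \<Omega> \<inter> ?L" by (auto simp: slice_def)
        then show "(\<lambda>x. (x $ i - w $ i) / (z - w) $ i) ` (\<Omega> \<inter> ?L) = slice \<Omega> z w"
          using inv by (metis (no_types, lifting) image_cong image_ident image_image)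
        show "continuous_on (\<Omega> \<inter> ?L) (\<lambda>x. (x $ i - w $ i) / (z - w) $ i)"
          using i by (intro continuous_intros) auto
      qed (auto simp only: inv intro!: continuous_intros)
    qed
    then show ?thesis using sc homeomorphic_simply_connected_eq homeomorphic_def by blast
  qed
qed

text \<open>The functionals \<open>a\<close> and \<open>b\<close> span a pencil of hyperplanes in the linear space \<open>E\<close>; by assumption
its axis, where both vanish, avoids \<open>\<Omega>\<close>. The aim is a member of the pencil that avoids \<open>\<Omega>\<close>. The
members correspond to the points \<open>[y1 : y2]\<close> of the projective line, a member being the set of \<open>z\<close>
with \<open>(cdot a z, cdot b z)\<close> proportional to \<open>(y1, y2)\<close>. If all members met \<open>\<Omega>\<close>, the map \<open>(cdot a,
cdot b)\<close> would be a nowhere vanishing section, over \<open>\<Omega>\<close>, of the pulled back tautological line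
bundle; as the fibres of \<open>\<Omega>\<close> over the projective line carry no monodromy, averaging logarithms
would push it down to a nowhere vanishing section of the tautological bundle itself, which does
not exist.\<close>

locale pencil =
  fixes \<Omega> E :: "(complex ^ 'n) set" and a b :: "complex ^ 'n"
  assumes open_Omega: "open \<Omega>"
    and sc: "slices_simply_connected \<Omega>"
    and E_add: "\<And>z w. z \<in> E \<Longrightarrow> w \<in> E \<Longrightarrow> z + w \<in> E"
    and E_scale: "\<And>c z. z \<in> E \<Longrightarrow> c *s z \<in> E"
    and nz: "\<And>z. z \<in> \<Omega> \<Longrightarrow> z \<in> E \<Longrightarrow> cdot a z \<noteq> 0 \<or> cdot b z \<noteq> 0"
begin

definition "U = \<Omega> \<inter> E"

text \<open>Two points are parallel if they lie on the same member of the pencil.\<close>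

definition par :: "complex ^ 'n \<Rightarrow> complex ^ 'n \<Rightarrow> bool" where
  "par z w \<longleftrightarrow> cdot a z * cdot b w = cdot b z * cdot a w"

text \<open>The factor between the values of \<open>(cdot a, cdot b)\<close> at two parallel points. The formula by
orthogonal projection is continuous in both points, also off the set of parallel pairs.\<close>

definition ratio :: "complex ^ 'n \<Rightarrow> complex ^ 'n \<Rightarrow> complex" where
  "ratio z w = (cdot a z * cnj (cdot a w) + cdot b z * cnj (cdot b w)) /
     (cdot a w * cnj (cdot a w) + cdot b w * cnj (cdot b w))"

lemma U_nz: "w \<in> U \<Longrightarrow> cdot a w \<noteq> 0 \<or> cdot b w \<noteq> 0"
  using nz by (auto simp: U_def)

lemma par_ratio:
  assumes "w \<in> U" "par z w"
  shows "cdot a z = ratio z w * cdot a w" "cdot b z = ratio z w * cdot b w"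
proof -
  have n: "cdot a w * cnj (cdot a w) + cdot b w * cnj (cdot b w) \<noteq> 0"
    using hermitian_square_nonzero U_nz[OF assms(1)] by blast
  have p: "cdot a z * cdot b w = cdot b z * cdot a w" using assms(2) by (simp add: par_def)
  show "cdot a z = ratio z w * cdot a w"
  proof -
    have "cdot a z * (cdot a w * cnj (cdot a w) + cdot b w * cnj (cdot b w))
      = (cdot a z * cnj (cdot a w) + cdot b z * cnj (cdot b w)) * cdot a w"
      using p by algebra
    then show ?thesis unfolding ratio_def using n by (simp add: field_simps)
  qed
  show "cdot b z = ratio z w * cdot b w"
  proof -
    have "cdot b z * (cdot a w * cnj (cdot a w) + cdot b w * cnj (cdot b w))
      = (cdot a z * cnj (cdot a w) + cdot b z * cnj (cdot b w)) * cdot b w"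
      using p by algebra
    then show ?thesis unfolding ratio_def using n by (simp add: field_simps)
  qed
qed

lemma ratio_nz:
  assumes "z \<in> U" "w \<in> U" "par z w" shows "ratio z w \<noteq> 0"
  using par_ratio[OF assms(2,3)] U_nz[OF assms(1)] by auto

lemma ratio_refl: "w \<in> U \<Longrightarrow> ratio w w = 1"
  using hermitian_square_nonzero U_nz by (simp add: ratio_def)

lemma par_sym: "par z w \<Longrightarrow> par w z" unfolding par_def by (simp only: mult.commute)

lemma par_refl: "par z z" by (simp add: par_def mult.commute)

lemma par_trans:
  assumes "y \<in> U" "par x y" "par y z" shows "par x z"
proof -
  note 1 = par_ratio[OF assms(1,2)]
  show ?thesis using assms(3) unfolding par_def 1 by (simp only: mult.assoc)
qed

lemma ratio_mult:
  assumes "y \<in> U" "z \<in> U" "par x y" "par y z" shows "ratio x y * ratio y z = ratio x z"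
proof -
  have xz: "par x z" using par_trans assms by blast
  note 1 = par_ratio[OF assms(1,3)] and 2 = par_ratio[OF assms(2,4)] and 3 = par_ratio[OF assms(2) xz]
  have "(ratio x y * ratio y z) * cdot a z = ratio x z * cdot a z"
    "(ratio x y * ratio y z) * cdot b z = ratio x z * cdot b z"
    using 1 2 3 by (simp_all only: mult.assoc)
  then show ?thesis using U_nz[OF assms(2)] mult_right_cancel by blast
qed

lemma slice_in_U:
  assumes "z \<in> U" "w \<in> U" "\<tau> \<in> slice \<Omega> z w" shows "w + \<tau> *s (z - w) \<in> U"
proof -
  have "z + (- 1) *s w \<in> E" using assms E_add E_scale unfolding U_def by blast
  then have "z - w \<in> E" by simp
  then show ?thesis using assms E_add E_scale unfolding U_def slice_def by blast
qed

lemma slice_comb_nz: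
  assumes "z \<in> U" "w \<in> U" "par z w" "\<tau> \<in> slice \<Omega> z w"
  shows "1 + \<tau> * (ratio z w - 1) \<noteq> 0" and "par (w + \<tau> *s (z - w)) w"
proof -
  note r = par_ratio[OF assms(2,3)]
  have lin: "x + \<tau> * (r * x - x) = (1 + \<tau> * (r - 1)) * x" for x r :: complex
    by (simp add: algebra_simps)
  have a: "cdot a (w + \<tau> *s (z - w)) = (1 + \<tau> * (ratio z w - 1)) * cdot a w"
    unfolding cdot_add cdot_scale cdot_diff r(1) by (rule lin)
  have b: "cdot b (w + \<tau> *s (z - w)) = (1 + \<tau> * (ratio z w - 1)) * cdot b w"
    unfolding cdot_add cdot_scale cdot_diff r(2) by (rule lin)
  show "1 + \<tau> * (ratio z w - 1) \<noteq> 0"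
    using a b U_nz[OF slice_in_U[OF assms(1,2,4)]] by (metis mult_zero_left)
  show "par (w + \<tau> *s (z - w)) w" using a b unfolding par_def by (simp only: mult_ac)
qed

lemma slice_01: "z \<in> U \<Longrightarrow> w \<in> U \<Longrightarrow> 0 \<in> slice \<Omega> z w \<and> 1 \<in> slice \<Omega> z w"
  by (auto simp: slice_def U_def)

lemma slice_simply_connected:
  "z \<in> U \<Longrightarrow> w \<in> U \<Longrightarrow> simply_connected (slice \<Omega> z w)"
  using sc by (auto simp: slices_simply_connected_def U_def)

text \<open>On the complex line through \<open>w\<close> and \<open>z\<close> the pair \<open>(cdot a, cdot b)\<close> equals its value at \<open>w\<close> times
this affine function of the parameter; it has no zero on the slice.\<close>

definition is_log :: "complex ^ 'n \<Rightarrow> complex ^ 'n \<Rightarrow> (complex \<Rightarrow> complex) \<Rightarrow> bool" where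
  "is_log z w L \<longleftrightarrow> continuous_on (slice \<Omega> z w) L \<and>
     (\<forall>\<tau>\<in>slice \<Omega> z w. exp (L \<tau>) = 1 + \<tau> * (ratio z w - 1))"

text \<open>The logarithm of \<open>ratio z w\<close> that is obtained by continuation inside \<open>\<Omega>\<close> along the complex line
through \<open>w\<close> and \<open>z\<close>.\<close>

definition logdiff :: "complex ^ 'n \<Rightarrow> complex ^ 'n \<Rightarrow> complex" where
  "logdiff z w = (let L = SOME L. is_log z w L in L 1 - L 0)"

lemma ex_is_log:
  assumes "z \<in> U" "w \<in> U" "par z w" shows "\<exists>L. is_log z w L"
proof -
  have "\<forall>f::complex \<Rightarrow> complex. continuous_on (slice \<Omega> z w) f \<and> (\<forall>\<tau>\<in>slice \<Omega> z w. f \<tau> \<noteq> 0) \<longrightarrow>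
      (\<exists>g. continuous_on (slice \<Omega> z w) g \<and> (\<forall>\<tau>\<in>slice \<Omega> z w. f \<tau> = exp (g \<tau>)))"
    using simply_connected_eq_continuous_log[OF open_slice[OF open_Omega, of z w]]
      slice_simply_connected[OF assms(1,2)] by (metis (no_types, lifting))
  from this[rule_format, of "\<lambda>\<tau>. 1 + \<tau> * (ratio z w - 1)"] slice_comb_nz(1)[OF assms]
  obtain g where "continuous_on (slice \<Omega> z w) g" "\<And>\<tau>. \<tau> \<in> slice \<Omega> z w \<Longrightarrow> 1 + \<tau> * (ratio z w - 1) = exp (g \<tau>)"
    using continuous_on_add[OF continuous_on_const continuous_on_mult[OF continuous_on_id continuous_on_const]] by metis
  then show ?thesis unfolding is_log_def by (intro exI[of _ g]) simp
qed

lemma is_log_logdiff: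
  assumes "z \<in> U" "w \<in> U" "is_log z w L" shows "logdiff z w = L 1 - L 0"
proof -
  define L' where "L' = (SOME L. is_log z w L)"
  have L': "is_log z w L'" unfolding L'_def by (rule someI[of "is_log z w", OF assms(3)])
  have "connected (slice \<Omega> z w)"
    using slice_simply_connected[OF assms(1,2)] simply_connected_imp_connected by blast
  have "exp (L' \<tau> - L \<tau>) = 1" if "\<tau> \<in> slice \<Omega> z w" for \<tau>
    using L' assms(3) that unfolding is_log_def exp_diff by (metis exp_not_eq_zero divide_self)
  moreover have "continuous_on (slice \<Omega> z w) (\<lambda>\<tau>. L' \<tau> - L \<tau>)"
    using L' assms(3) unfolding is_log_def by (intro continuous_on_diff) auto
  ultimately have "L' 1 - L 1 = L' 0 - L 0"
    using exp_constant_imp_constant[OF \<open>connected _\<close>, of "\<lambda>\<tau>. L' \<tau> - L \<tau>" 1 1 0]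
      slice_01[OF assms(1,2)] by blast
  then show ?thesis unfolding logdiff_def Let_def L'_def[symmetric] by (simp add: algebra_simps)
qed

lemma exp_logdiff:
  assumes "z \<in> U" "w \<in> U" "par z w" shows "exp (logdiff z w) = ratio z w"
proof -
  obtain L where L: "is_log z w L" using ex_is_log[OF assms] ..
  then have "exp (L 1) = 1 + 1 * (ratio z w - 1)" "exp (L 0) = 1 + 0 * (ratio z w - 1)"
    using slice_01[OF assms(1,2)] unfolding is_log_def by blast+
  then show ?thesis using is_log_logdiff[OF assms(1,2) L] by (simp add: exp_diff)
qed

lemma logdiff_refl: assumes "z \<in> U" shows "logdiff z z = 0"
proof -
  have "is_log z z (\<lambda>_. 0)" using ratio_refl[OF assms] by (simp add: is_log_def)
  then show ?thesis using is_log_logdiff[OF assms assms] by fastforce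
qed

lemma continuous_on_ratio:
  "continuous_on (UNIV \<times> U) (\<lambda>p. ratio (fst p) (snd p))"
  unfolding ratio_def using hermitian_square_nonzero U_nz
  by (intro continuous_intros) auto

text \<open>A path from \<open>0\<close> to \<open>1\<close> in the slice of \<open>z0\<close> and \<open>w0\<close> has a compact image, so it lies in the slices
of all nearby pairs as well. Along this fixed path the two affine functions have a quotient close
to \<open>1\<close>, and the principal logarithm of the quotient measures the change of the continuation.\<close>

lemma logdiff_local:
  assumes z0: "z0 \<in> U" and w0: "w0 \<in> U" and p0: "par z0 w0"
  shows "\<exists>d>0. \<forall>z\<in>U. \<forall>w\<in>U. par z w \<and> dist (z, w) (z0, w0) < d \<longrightarrow>
      cmod (ratio z w / ratio z0 w0 - 1) < 1 \<and> logdiff z w = logdiff z0 w0 + Ln (ratio z w / ratio z0 w0)"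
proof -
  let ?T = "slice \<Omega> z0 w0"
  have "path_connected ?T"
    using slice_simply_connected[OF z0 w0] simply_connected_imp_path_connected by blast
  then obtain g where g: "path g" "path_image g \<subseteq> ?T" "pathstart g = 0" "pathfinish g = 1"
    using slice_01[OF z0 w0] unfolding path_connected_def by meson
  define C where "C = path_image g"
  have C: "compact C" "connected C" "C \<subseteq> ?T" "0 \<in> C" "1 \<in> C"
    using g pathstart_in_path_image[of g] pathfinish_in_path_image[of g]
    unfolding C_def by (auto simp: compact_path_image connected_path_image)
  have "compact ((\<lambda>\<tau>. w0 + \<tau> *s (z0 - w0)) ` C)"
    by (intro compact_continuous_image continuous_intros C)
  moreover have "(\<lambda>\<tau>. w0 + \<tau> *s (z0 - w0)) ` C \<subseteq> \<Omega>" using C(3) by (auto simp: slice_def)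
  ultimately obtain e where e: "e > 0" "(\<Union>x\<in>(\<lambda>\<tau>. w0 + \<tau> *s (z0 - w0)) ` C. ball x e) \<subseteq> \<Omega>"
    using compact_subset_open_imp_ball_epsilon_subset[OF _ open_Omega] by metis
  obtain B where B: "B > 0" "\<And>\<tau>. \<tau> \<in> C \<Longrightarrow> cmod \<tau> \<le> B"
    using compact_imp_bounded[OF C(1)] bounded_pos by metis
  define k0 where "k0 = (\<lambda>\<tau>. 1 + \<tau> * (ratio z0 w0 - 1))"
  have k0nz: "k0 \<tau> \<noteq> 0" if "\<tau> \<in> C" for \<tau>
    using slice_comb_nz(1)[OF z0 w0 p0] that C(3) unfolding k0_def by blast
  have "\<exists>m>0. \<forall>\<tau>\<in>C. m \<le> cmod (k0 \<tau>)"
  proof -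
    have "continuous_on C (\<lambda>\<tau>. cmod (k0 \<tau>))" unfolding k0_def by (intro continuous_intros)
    from continuous_attains_inf[OF C(1) _ this] C(4) obtain t where "t \<in> C" "\<forall>\<tau>\<in>C. cmod (k0 t) \<le> cmod (k0 \<tau>)"
      by blast
    then show ?thesis using k0nz by (intro exI[of _ "cmod (k0 t)"]) auto
  qed
  then obtain m where m: "m > 0" "\<And>\<tau>. \<tau> \<in> C \<Longrightarrow> m \<le> cmod (k0 \<tau>)" by blast
  from continuous_on_ratio[unfolded continuous_on_iff, rule_format, of "(z0, w0)" "m / B"] w0 m B
  obtain d1 where d1: "d1 > 0"
    "\<And>z w. w \<in> U \<Longrightarrow> dist (z, w) (z0, w0) < d1 \<Longrightarrow> dist (ratio z w) (ratio z0 w0) < m / B"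
    by auto
  \<comment> \<open>The second bound keeps the perturbed path in the \<open>e\<close>-neighbourhood of the original one; the
  first keeps the two affine functions within \<open>m\<close> of each other.\<close>
  define d where "d = min d1 (e / (1 + 2 * B))"
  have d: "d > 0" unfolding d_def using d1 e B by auto
  have main: "cmod (ratio z w / ratio z0 w0 - 1) < 1 \<and> logdiff z w = logdiff z0 w0 + Ln (ratio z w / ratio z0 w0)"
    if z: "z \<in> U" and w: "w \<in> U" and p: "par z w" and dd: "dist (z, w) (z0, w0) < d" for z w
  proof -
    have dz: "dist z z0 < d" and dw: "dist w w0 < d"
      using dist_fst_le[of "(z, w)" "(z0, w0)"] dist_snd_le[of "(z, w)" "(z0, w0)"] dd by auto
    have CT: "C \<subseteq> slice \<Omega> z w"
    proof
      fix \<tau> assume t: "\<tau> \<in> C"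
      have eq: "(w0 + \<tau> *s (z0 - w0)) - (w + \<tau> *s (z - w)) = (w0 - w) + \<tau> *s ((z0 - z) - (w0 - w))"
        by (simp add: vec_eq_iff algebra_simps)
      have "dist (w0 + \<tau> *s (z0 - w0)) (w + \<tau> *s (z - w)) \<le> norm (w0 - w) + cmod \<tau> * (norm (z0 - z) + norm (w0 - w))"
        unfolding dist_norm eq
        by (smt (verit) norm_scale norm_triangle_ineq norm_triangle_ineq4 mult_left_mono norm_ge_zero)
      also have "\<dots> \<le> norm (w0 - w) + B * (norm (z0 - z) + norm (w0 - w))"
        using B(2)[OF t] by (intro add_left_mono mult_right_mono) auto
      also have "\<dots> < d + B * (d + d)"
        using dz dw B(1) by (intro add_strict_mono mult_strict_left_mono) (auto simp: dist_norm norm_minus_commute)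
      also have "\<dots> = d * (1 + 2 * B)" by (simp add: algebra_simps)
      also have "\<dots> \<le> e" using B(1) e(1) unfolding d_def
        by (smt (verit) min.cobounded2 pos_le_divide_eq)
      finally have "w + \<tau> *s (z - w) \<in> ball (w0 + \<tau> *s (z0 - w0)) e" by simp
      then show "\<tau> \<in> slice \<Omega> z w" using e(2) t unfolding slice_def by blast
    qed
    define k where "k = (\<lambda>\<tau>. 1 + \<tau> * (ratio z w - 1))"
    have kk: "cmod (k \<tau> / k0 \<tau> - 1) < 1" if t: "\<tau> \<in> C" for \<tau>
    proof -
      have "k \<tau> / k0 \<tau> - 1 = \<tau> * (ratio z w - ratio z0 w0) / k0 \<tau>"
        using k0nz[OF t] unfolding k_def k0_def by (simp add: field_simps)
      moreover have "cmod (\<tau> * (ratio z w - ratio z0 w0)) < m"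
      proof -
        have "cmod (ratio z w - ratio z0 w0) < m / B"
          using d1(2)[OF w, of z] dd unfolding d_def by (simp add: dist_norm)
        moreover have "cmod \<tau> * cmod (ratio z w - ratio z0 w0) \<le> B * cmod (ratio z w - ratio z0 w0)"
          using B(2)[OF t] by (intro mult_right_mono) auto
        moreover have "B * cmod (ratio z w - ratio z0 w0) < m" if "cmod (ratio z w - ratio z0 w0) < m / B"
          using that B(1) by (simp add: field_simps)
        ultimately show ?thesis unfolding norm_mult by linarith
      qed
      ultimately have "cmod (k \<tau> / k0 \<tau> - 1) * cmod (k0 \<tau>) < 1 * cmod (k0 \<tau>)"
        using m(2)[OF t] k0nz[OF t] by (simp add: norm_divide)
      then show ?thesis by (rule mult_right_less_imp_less) simp
    qed
    have half: "Re (k \<tau> / k0 \<tau>) > 0" if "\<tau> \<in> C" for \<tau>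
      using kk[OF that] abs_Re_le_cmod[of "k \<tau> / k0 \<tau> - 1"] by simp
    obtain L where L: "is_log z w L" using ex_is_log[OF z w p] by blast
    obtain L0 where L0: "is_log z0 w0 L0" using ex_is_log[OF z0 w0 p0] by blast
    have "L 1 - L0 1 - Ln (k 1 / k0 1) = L 0 - L0 0 - Ln (k 0 / k0 0)"
    proof (rule exp_constant_imp_constant[of C "\<lambda>\<tau>. L \<tau> - L0 \<tau> - Ln (k \<tau> / k0 \<tau>)" 1])
      have c: "continuous_on C L" "continuous_on C L0"
        using L L0 CT C(3) unfolding is_log_def by (meson continuous_on_subset)+
      have "continuous_on C (\<lambda>\<tau>. Ln (k \<tau> / k0 \<tau>))"
      proof (rule continuous_on_Ln')
        show "continuous_on C (\<lambda>\<tau>. k \<tau> / k0 \<tau>)"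
          using k0nz unfolding k_def k0_def by (intro continuous_intros) auto
        show "\<And>\<tau>. \<tau> \<in> C \<Longrightarrow> k \<tau> / k0 \<tau> \<notin> \<real>\<^sub>\<le>\<^sub>0"
          using half complex_nonpos_Reals_iff by force
      qed
      with c show "continuous_on C (\<lambda>\<tau>. L \<tau> - L0 \<tau> - Ln (k \<tau> / k0 \<tau>))"
        by (intro continuous_on_diff)
    next
      fix \<tau> assume t: "\<tau> \<in> C"
      have 1: "exp (L \<tau>) = k \<tau>" "exp (L0 \<tau>) = k0 \<tau>" using L L0 t CT C(3) unfolding is_log_def k_def k0_def by auto
      have "k \<tau> / k0 \<tau> \<noteq> 0" using half[OF t] by (metis less_irrefl zero_complex.simps(1))
      then show "exp (L \<tau> - L0 \<tau> - Ln (k \<tau> / k0 \<tau>)) = 1"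
        using 1 by (simp add: exp_diff)
    qed (use C in auto)
    then have "L 1 - L 0 = L0 1 - L0 0 + Ln (ratio z w / ratio z0 w0)"
      by (simp add: k_def k0_def algebra_simps)
    then show ?thesis
      using is_log_logdiff[OF z w L] is_log_logdiff[OF z0 w0 L0] kk[OF C(5)] unfolding k_def k0_def by simp
  qed
  show ?thesis using d main by blast
qed

lemma continuous_on_logdiff:
  "continuous_on {p \<in> U \<times> U. par (fst p) (snd p)} (\<lambda>p. logdiff (fst p) (snd p))"
  unfolding continuous_on_eq_continuous_within
proof
  let ?P = "{p \<in> U \<times> U. par (fst p) (snd p)}"
  fix q assume q: "q \<in> ?P"
  define z0 w0 where "z0 = fst q" and "w0 = snd q"
  have zw: "z0 \<in> U" "w0 \<in> U" "par z0 w0" "q = (z0, w0)" using q by (auto simp: z0_def w0_def)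
  obtain d where d: "d > 0" "\<And>z w. z \<in> U \<Longrightarrow> w \<in> U \<Longrightarrow> par z w \<Longrightarrow> dist (z, w) (z0, w0) < d \<Longrightarrow>
      logdiff z w = logdiff z0 w0 + Ln (ratio z w / ratio z0 w0)"
    using logdiff_local[OF zw(1-3)] by blast
  have r0: "ratio z0 w0 \<noteq> 0" using ratio_nz zw by blast
  have c: "continuous (at q within ?P) (\<lambda>p. ratio (fst p) (snd p))"
  proof -
    have "?P \<subseteq> UNIV \<times> U" by auto
    from continuous_on_subset[OF continuous_on_ratio this] q show ?thesis
      unfolding continuous_on_eq_continuous_within by blast
  qed
  have "continuous (at q within ?P) (\<lambda>p. Ln (ratio (fst p) (snd p) / ratio z0 w0))"
    unfolding continuous_within
  proof (rule tendsto_Ln)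
    show "((\<lambda>p. ratio (fst p) (snd p) / ratio z0 w0) \<longlongrightarrow> ratio (fst q) (snd q) / ratio z0 w0) (at q within ?P)"
      using c r0 unfolding continuous_within by (intro tendsto_intros)
    show "ratio (fst q) (snd q) / ratio z0 w0 \<notin> \<real>\<^sub>\<le>\<^sub>0" using zw r0 by simp
  qed
  then have "continuous (at q within ?P) (\<lambda>p. logdiff z0 w0 + Ln (ratio (fst p) (snd p) / ratio z0 w0))"
    by (intro continuous_intros)
  then show "continuous (at q within ?P) (\<lambda>p. logdiff (fst p) (snd p))"
    by (rule continuous_transform_within[OF _ d(1) q]) (use d(2) zw in auto)
qed

text \<open>The complex lines through \<open>w0\<close> inside the fibre cover it, and each of them meets \<open>\<Omega>\<close> in a
connected set.\<close>

lemma fibre_connected: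
  assumes "w0 \<in> U" shows "connected {z \<in> U. par z w0}"
proof -
  let ?F = "{z \<in> U. par z w0}"
  let ?I = "\<lambda>z. (\<lambda>\<tau>. w0 + \<tau> *s (z - w0)) ` slice \<Omega> z w0"
  have "?F = (\<Union>z\<in>?F. ?I z)"
  proof (intro equalityI subsetI)
    fix z assume z: "z \<in> ?F"
    then have "z \<in> ?I z" using slice_01[of z w0] assms by (auto intro!: image_eqI[of _ _ 1])
    with z show "z \<in> (\<Union>z\<in>?F. ?I z)" by blast
  next
    fix x assume "x \<in> (\<Union>z\<in>?F. ?I z)"
    then show "x \<in> ?F" using slice_in_U slice_comb_nz(2) assms by auto
  qed
  moreover have "connected (\<Union>z\<in>?F. ?I z)"
  proof (rule connected_Union)
    show "connected s" if s: "s \<in> ?I ` ?F" for s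
    proof -
      obtain z where z: "z \<in> U" "s = ?I z" using s by auto
      show ?thesis unfolding z(2)
        by (intro connected_continuous_image continuous_intros
             simply_connected_imp_connected slice_simply_connected z assms)
    qed
    have "w0 \<in> ?I z" if "z \<in> ?F" for z
      using slice_01[of z w0] that assms by (auto intro!: image_eqI[of _ _ 0])
    then show "\<Inter> (?I ` ?F) \<noteq> {}" by blast
  qed
  ultimately show ?thesis by simp
qed

text \<open>The defect of additivity is a continuous function of three points of one fibre with values in \<open>2 \<pi>
\<i> \<int>\<close>. The threefold product of the fibre is connected, and the defect vanishes when the three
points coincide.\<close>

lemma logdiff_cocycle:
  assumes "x \<in> U" "y \<in> U" "z \<in> U" "par x y" "par y z"
  shows "logdiff x y + logdiff y z = logdiff x z"
proof -
  let ?F = "{u \<in> U. par u z}"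
  have F: "x \<in> ?F" "y \<in> ?F" "z \<in> ?F" using assms par_trans[OF assms(2,4,5)] par_refl[of z] by auto
  have FF: "par u v" if "u \<in> ?F" "v \<in> ?F" for u v
    using that par_trans[OF assms(3), of u v] par_sym[of v z] by simp
  define \<Theta> where "\<Theta> = (\<lambda>(u, v, w). logdiff u v + logdiff v w - logdiff u w)"
  have cd: "continuous_on (?F \<times> ?F \<times> ?F) (\<lambda>t. logdiff (f t) (g t))"
    if "continuous_on (?F \<times> ?F \<times> ?F) f" "continuous_on (?F \<times> ?F \<times> ?F) g"
      "\<And>t. t \<in> ?F \<times> ?F \<times> ?F \<Longrightarrow> f t \<in> ?F \<and> g t \<in> ?F" for f g
  proof -
    have "continuous_on (?F \<times> ?F \<times> ?F) (\<lambda>t. (f t, g t))" using that by (intro continuous_intros)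
    moreover have "(\<lambda>t. (f t, g t)) ` (?F \<times> ?F \<times> ?F) \<subseteq> {p \<in> U \<times> U. par (fst p) (snd p)}"
    proof
      fix q assume "q \<in> (\<lambda>t. (f t, g t)) ` (?F \<times> ?F \<times> ?F)"
      then obtain t where "t \<in> ?F \<times> ?F \<times> ?F" "q = (f t, g t)" by blast
      then show "q \<in> {p \<in> U \<times> U. par (fst p) (snd p)}" using that(3)[of t] FF[of "f t" "g t"] by auto
    qed
    ultimately have "continuous_on (?F \<times> ?F \<times> ?F) (\<lambda>t. logdiff (fst (f t, g t)) (snd (f t, g t)))"
      by (rule continuous_on_compose2[OF continuous_on_logdiff])
    then show ?thesis by simp
  qed
  have "\<Theta> (x, y, z) = \<Theta> (z, z, z)"
  proof (rule exp_constant_imp_constant[of "?F \<times> ?F \<times> ?F" \<Theta> 1])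
    show "connected (?F \<times> ?F \<times> ?F)"
      using fibre_connected[OF assms(3)] by (intro connected_Times)
    have "\<Theta> = (\<lambda>t. logdiff (fst t) (fst (snd t)) + logdiff (fst (snd t)) (snd (snd t)) - logdiff (fst t) (snd (snd t)))"
      by (auto simp: \<Theta>_def)
    moreover have "continuous_on (?F \<times> ?F \<times> ?F) \<dots>"
      by (intro continuous_on_add continuous_on_diff cd continuous_intros) auto
    ultimately show "continuous_on (?F \<times> ?F \<times> ?F) \<Theta>" by simp
    show "exp (\<Theta> t) = 1" if "t \<in> ?F \<times> ?F \<times> ?F" for t
    proof -
      obtain u v w where t: "t = (u, v, w)" "u \<in> ?F" "v \<in> ?F" "w \<in> ?F" using \<open>t \<in> _\<close> by auto
      have p: "par u v" "par v w" "par u w" using FF t by blast+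
      have U: "u \<in> U" "v \<in> U" "w \<in> U" using t by auto
      have "exp (\<Theta> t) = ratio u v * ratio v w / ratio u w"
        unfolding \<Theta>_def t prod.case exp_diff exp_add by (simp only: exp_logdiff U p)
      then show ?thesis using ratio_nz[OF U(1,3) p(3)] ratio_mult[OF U(2,3) p(1,2)] by simp
    qed
  qed (use F in auto)
  then show ?thesis by (simp add: \<Theta>_def logdiff_refl assms(3))
qed

end

section \<open>Hyperplanes avoiding a \<open>\<complex>\<close>-convex domain\<close>

text \<open>The contradictory situation in which all members of the pencil meet \<open>\<Omega>\<close>. The vectors \<open>e1\<close> and \<open>e2\<close>
are dual to \<open>a\<close> and \<open>b\<close>, and \<open>r k\<close> is the radius of a disc in \<open>\<Omega>\<close> around \<open>k\<close> in the direction in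
which \<open>(cdot a, cdot b)\<close> changes orthogonally to its value at \<open>k\<close>.\<close>

locale full_pencil = pencil \<Omega> E a b
  for \<Omega> E :: "(complex ^ 'n) set" and a b :: "complex ^ 'n" +
  fixes e1 e2 :: "complex ^ 'n" and r :: "complex ^ 'n \<Rightarrow> real"
  assumes full: "\<And>y1 y2. y1 \<noteq> 0 \<or> y2 \<noteq> 0 \<Longrightarrow> \<exists>z\<in>U. cdot a z * y2 = cdot b z * y1"
    and e1: "e1 \<in> E" "cdot a e1 = 1" "cdot b e1 = 0"
    and e2: "e2 \<in> E" "cdot a e2 = 0" "cdot b e2 = 1"
    and r_pos: "\<And>k. k \<in> U \<Longrightarrow> 0 < r k"
    and r_U: "\<And>k q. k \<in> U \<Longrightarrow> cmod q \<le> r k \<Longrightarrow>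
        k + q *s (cnj (cdot b k) *s e1 - cnj (cdot a k) *s e2) \<in> \<Omega>"
begin

text \<open>Each \<open>k\<close> in \<open>\<Omega> \<inter> E\<close> gives a local section \<open>sec k\<close> of the fibration over the projective line, in
homogeneous coordinates \<open>y\<close>, with \<open>(cdot a, cdot b)\<close> equal to \<open>scal k y\<close> times \<open>y\<close> on it. With \<open>m\<close>
the value of \<open>(cdot a, cdot b)\<close> at \<open>k\<close>, \<open>herm k y\<close> and \<open>wedge k y\<close> are the components of \<open>y\<close> along
\<open>m\<close> and orthogonal to it, up to the factor \<open>\<bar>m\<bar>\<close>. The bump function \<open>bump k\<close> has its support,
apart from the origin, inside the chart of \<open>k\<close>, and it is homogeneous, as a partition of unity on
the projective line requires.\<close>

definition herm where "herm k y = fst y * cnj (cdot a k) + snd y * cnj (cdot b k)"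
definition wedge where "wedge k y = fst y * cdot b k - snd y * cdot a k"
definition scal where
  "scal k y = (cdot a k * cnj (cdot a k) + cdot b k * cnj (cdot b k)) / herm k y"
definition sec where
  "sec k y = k + (wedge k y / herm k y) *s (cnj (cdot b k) *s e1 - cnj (cdot a k) *s e2)"
definition chart where "chart k = {y. herm k y \<noteq> 0 \<and> sec k y \<in> \<Omega>}"
definition bump where "bump k y = max 0 (r k * cmod (herm k y) - cmod (wedge k y))"

lemma sec_E: "k \<in> U \<Longrightarrow> sec k y \<in> E"
proof -
  assume "k \<in> U"
  then have "k + (wedge k y / herm k y) *s (cnj (cdot b k) *s e1 + (- cnj (cdot a k)) *s e2) \<in> E"
    using e1 e2 E_add E_scale unfolding U_def by blast
  then show ?thesis unfolding sec_def by simp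
qed

lemma sec_in_U: "k \<in> U \<Longrightarrow> y \<in> chart k \<Longrightarrow> sec k y \<in> U"
  using sec_E by (auto simp: chart_def U_def)

lemma cdot_sec:
  assumes "herm k y \<noteq> 0"
  shows "cdot a (sec k y) = scal k y * fst y" "cdot b (sec k y) = scal k y * snd y"
proof -
  have 1: "cdot a (sec k y) = cdot a k + wedge k y / herm k y * cnj (cdot b k)"
    "cdot b (sec k y) = cdot b k - wedge k y / herm k y * cnj (cdot a k)"
    using e1 e2 by (simp_all add: sec_def cdot_add cdot_diff cdot_scale)
  have "cdot a k * herm k y + wedge k y * cnj (cdot b k)
      = (cdot a k * cnj (cdot a k) + cdot b k * cnj (cdot b k)) * fst y"
    "cdot b k * herm k y - wedge k y * cnj (cdot a k)
      = (cdot a k * cnj (cdot a k) + cdot b k * cnj (cdot b k)) * snd y"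
    unfolding herm_def wedge_def by algebra+
  then show "cdot a (sec k y) = scal k y * fst y" "cdot b (sec k y) = scal k y * snd y"
    unfolding 1 scal_def using assms by (simp_all add: field_simps)
qed

lemma scal_nz: "k \<in> U \<Longrightarrow> y \<in> chart k \<Longrightarrow> scal k y \<noteq> 0"
  using hermitian_square_nonzero U_nz by (auto simp: scal_def chart_def)

lemma par_sec:
  assumes "y \<in> chart k" "y \<in> chart l" shows "par (sec k y) (sec l y)"
  using cdot_sec assms by (simp add: par_def chart_def)

lemma ratio_sec:
  assumes "k \<in> U" "l \<in> U" "y \<in> chart k" "y \<in> chart l"
  shows "ratio (sec k y) (sec l y) = scal k y / scal l y"
proof -
  note p = par_ratio[OF sec_in_U[OF assms(2,4)] par_sec[OF assms(3,4)]]
  have s: "scal l y \<noteq> 0" using scal_nz assms by blast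
  have h: "herm k y \<noteq> 0" "herm l y \<noteq> 0" using assms by (auto simp: chart_def)
  have "fst y \<noteq> 0 \<or> snd y \<noteq> 0" using h by (auto simp: herm_def)
  moreover have "scal k y * fst y = ratio (sec k y) (sec l y) * scal l y * fst y"
    "scal k y * snd y = ratio (sec k y) (sec l y) * scal l y * snd y"
    using p cdot_sec[OF h(1)] cdot_sec[OF h(2)] by (simp_all add: mult.assoc)
  ultimately have "scal k y = ratio (sec k y) (sec l y) * scal l y"
    using mult_right_cancel by blast
  then show ?thesis using s by (simp add: field_simps)
qed

text \<open>If \<open>herm k y\<close> vanished, so would \<open>wedge k y\<close>, and then \<open>y\<close> itself; hence the quotient of the two
is defined and at most \<open>r k\<close> in modulus.\<close>

lemma support_in_chart:
  assumes "k \<in> U" "y \<noteq> 0" "cmod (wedge k y) \<le> r k * cmod (herm k y)" shows "y \<in> chart k"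
proof -
  have h: "herm k y \<noteq> 0"
  proof
    assume h0: "herm k y = 0"
    then have w0: "wedge k y = 0" using assms(3) by simp
    let ?m = "cdot a k * cnj (cdot a k) + cdot b k * cnj (cdot b k)"
    have "?m * fst y = cdot a k * herm k y + wedge k y * cnj (cdot b k)"
      "?m * snd y = cdot b k * herm k y - wedge k y * cnj (cdot a k)"
      unfolding herm_def wedge_def by algebra+
    then have "fst y = 0" "snd y = 0" using h0 w0 hermitian_square_nonzero U_nz[OF assms(1)] by auto
    then show False using assms(2) by (simp add: prod_eq_iff)
  qed
  then have "cmod (wedge k y / herm k y) \<le> r k"
    using assms(3) by (simp add: norm_divide field_simps)
  from r_U[OF assms(1) this] h show ?thesis unfolding chart_def sec_def by blast
qed

lemma bump_pos_imp_chart: "k \<in> U \<Longrightarrow> bump k y > 0 \<Longrightarrow> y \<in> chart k"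
  by (rule support_in_chart) (auto simp: bump_def herm_def wedge_def)

lemma bump_nonneg: "bump k y \<ge> 0" by (simp add: bump_def)

lemma continuous_on_herm: "continuous_on A (herm k)"
  unfolding herm_def by (intro continuous_intros)

lemma continuous_on_wedge: "continuous_on A (wedge k)"
  unfolding wedge_def by (intro continuous_intros)

lemma continuous_on_bump: "continuous_on A (bump k)"
  unfolding bump_def by (intro continuous_intros continuous_on_herm continuous_on_wedge)

lemma continuous_on_sec: "(\<And>y. y \<in> A \<Longrightarrow> herm k y \<noteq> 0) \<Longrightarrow> continuous_on A (sec k)"
  unfolding sec_def by (intro continuous_intros continuous_on_herm continuous_on_wedge) auto

lemma continuous_on_scal: "(\<And>y. y \<in> A \<Longrightarrow> herm k y \<noteq> 0) \<Longrightarrow> continuous_on A (scal k)"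
  unfolding scal_def by (intro continuous_intros continuous_on_herm) auto

lemma open_chart: "open (chart k)"
proof -
  have o: "open {y. herm k y \<noteq> 0}"
    by (intro open_Collect_neq continuous_on_herm continuous_intros)
  have "open (sec k -` \<Omega> \<inter> {y. herm k y \<noteq> 0})"
    by (rule continuous_on_open_vimage[OF o, THEN iffD1, rule_format]) (auto intro: continuous_on_sec open_Omega)
  moreover have "chart k = sec k -` \<Omega> \<inter> {y. herm k y \<noteq> 0}" by (auto simp: chart_def)
  ultimately show ?thesis by simp
qed

text \<open>Where \<open>sec k\<close> leaves \<open>\<Omega>\<close> the bump function already vanishes on an open set; together with the
chart of \<open>k\<close> this set covers the chart of \<open>i\<close>.\<close>

lemma continuous_on_bump_logdiff:
  assumes k: "k \<in> U" and i: "i \<in> U"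
  shows "continuous_on (chart i) (\<lambda>y. of_real (bump k y) * logdiff (sec k y) (sec i y))"
proof -
  let ?f = "\<lambda>y. of_real (bump k y) * logdiff (sec k y) (sec i y)"
  let ?B = "{y. r k * cmod (herm k y) < cmod (wedge k y)}"
  have "continuous_on (chart i \<inter> chart k) (\<lambda>y. logdiff (fst (sec k y, sec i y)) (snd (sec k y, sec i y)))"
  proof (rule continuous_on_compose2[OF continuous_on_logdiff])
    show "continuous_on (chart i \<inter> chart k) (\<lambda>y. (sec k y, sec i y))"
      by (intro continuous_on_Pair continuous_on_sec) (auto simp: chart_def)
    show "(\<lambda>y. (sec k y, sec i y)) ` (chart i \<inter> chart k) \<subseteq> {p \<in> U \<times> U. par (fst p) (snd p)}"
      using sec_in_U k i par_sec by auto
  qed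
  then have 1: "continuous_on (chart i \<inter> chart k) ?f"
    by (intro continuous_intros continuous_on_bump) simp
  have "continuous_on ?B (\<lambda>_. 0 :: complex)" by simp
  then have 2: "continuous_on ?B ?f"
    by (rule continuous_on_cong[THEN iffD1, rotated -1]) (auto simp: bump_def)
  have "open ?B" by (intro open_Collect_less continuous_intros continuous_on_herm continuous_on_wedge)
  then have "continuous_on ((chart i \<inter> chart k) \<union> ?B) ?f"
    by (intro continuous_on_open_Un 1 2 open_Int open_chart)
  moreover have "chart i \<subseteq> (chart i \<inter> chart k) \<union> ?B"
  proof
    fix y assume y: "y \<in> chart i"
    then have "y \<noteq> 0" by (auto simp: chart_def herm_def)
    with y support_in_chart[OF k] show "y \<in> (chart i \<inter> chart k) \<union> ?B" by fastforce
  qed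
  ultimately show ?thesis by (rule continuous_on_subset)
qed

text \<open>The average, over the partition of unity, of the factors \<open>scal k y\<close>, taken in logarithmic form
with the logarithms referred to the section \<open>sec i\<close>. A plain average of the factors could vanish;
an exponential cannot.\<close>

definition glue where
  "glue N i y = scal i y *
     exp ((\<Sum>k\<in>N. of_real (bump k y) * logdiff (sec k y) (sec i y)) / of_real (\<Sum>k\<in>N. bump k y))"

text \<open>By the cocycle identity a change of the reference section changes every logarithm by the same
amount, which is compensated by the factor in front.\<close>

lemma glue_independent:
  assumes N: "finite N" "N \<subseteq> U" and pos: "(\<Sum>k\<in>N. bump k y) > 0"
    and i: "i \<in> U" "y \<in> chart i" and j: "j \<in> U" "y \<in> chart j"
  shows "glue N i y = glue N j y"
proof -
  let ?s = "\<Sum>k\<in>N. bump k y" and ?D = "logdiff (sec j y) (sec i y)"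
  have "of_real (bump k y) * logdiff (sec k y) (sec i y) =
      of_real (bump k y) * logdiff (sec k y) (sec j y) + of_real (bump k y) * ?D" if k: "k \<in> N" for k
  proof (cases "bump k y = 0")
    case False
    then have "bump k y > 0" using bump_nonneg[of k y] by simp
    then have d: "y \<in> chart k" using bump_pos_imp_chart k N by blast
    have "logdiff (sec k y) (sec j y) + ?D = logdiff (sec k y) (sec i y)"
      using k N i j d by (intro logdiff_cocycle sec_in_U par_sec) auto
    then show ?thesis by (metis distrib_left)
  qed simp
  then have "(\<Sum>k\<in>N. of_real (bump k y) * logdiff (sec k y) (sec i y)) =
      (\<Sum>k\<in>N. of_real (bump k y) * logdiff (sec k y) (sec j y)) + of_real ?s * ?D"
    by (simp add: sum.distrib sum_distrib_right)
  then have "glue N i y = scal i y * exp ((\<Sum>k\<in>N. of_real (bump k y) * logdiff (sec k y) (sec j y)) / of_real ?s + ?D)"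
  proof -
    have "complex_of_real ?s \<noteq> 0" using pos by (simp only: of_real_eq_0_iff)
    then have "(x + of_real ?s * ?D) / of_real ?s = x / of_real ?s + ?D" for x
      by (simp only: add_divide_distrib nonzero_mult_div_cancel_left not_False_eq_True)
    then show ?thesis using \<open>_ = _ + of_real ?s * ?D\<close> unfolding glue_def by (simp only:)
  qed
  also have "\<dots> = glue N j y * (scal i y / scal j y * exp ?D)"
    using scal_nz[OF j] by (simp add: glue_def exp_add field_simps)
  also have "exp ?D = scal j y / scal i y"
    using exp_logdiff[OF sec_in_U[OF j] sec_in_U[OF i] par_sec[OF j(2) i(2)]] ratio_sec[OF j(1) i(1) j(2) i(2)]
    by simp
  finally show ?thesis using scal_nz[OF i] scal_nz[OF j] by simp
qed

lemma continuous_on_glue: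
  assumes N: "finite N" "N \<subseteq> U" and i: "i \<in> U" and A: "A \<subseteq> chart i" "\<And>y. y \<in> A \<Longrightarrow> (\<Sum>k\<in>N. bump k y) > 0"
  shows "continuous_on A (glue N i)"
proof -
  have "continuous_on A (\<lambda>y. \<Sum>k\<in>N. of_real (bump k y) * logdiff (sec k y) (sec i y))"
    using N i by (intro continuous_on_sum continuous_on_subset[OF continuous_on_bump_logdiff A(1)]) auto
  moreover have "continuous_on A (\<lambda>y. complex_of_real (\<Sum>k\<in>N. bump k y))"
    by (intro continuous_intros continuous_on_bump)
  moreover have "continuous_on A (scal i)" using A(1) by (intro continuous_on_scal) (auto simp: chart_def)
  ultimately show ?thesis unfolding glue_def using A(2)
    by (intro continuous_on_mult continuous_on_exp continuous_on_divide)
       (auto simp: less_le simp del: of_real_sum)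
qed

lemma scale_invariance:
  assumes "c \<noteq> 0"
  shows "herm k (c * s, c * t) = c * herm k (s, t)" "wedge k (c * s, c * t) = c * wedge k (s, t)"
    "sec k (c * s, c * t) = sec k (s, t)" "scal k (c * s, c * t) = scal k (s, t) / c"
    "bump k (c * s, c * t) = cmod c * bump k (s, t)"
proof -
  show h: "herm k (c * s, c * t) = c * herm k (s, t)" for s t by (simp add: herm_def algebra_simps)
  show w: "wedge k (c * s, c * t) = c * wedge k (s, t)" for s t by (simp add: wedge_def algebra_simps)
  show s: "sec k (c * s, c * t) = sec k (s, t)" for s t using assms by (simp add: sec_def h w)
  show "scal k (c * s, c * t) = scal k (s, t) / c" by (simp add: scal_def h)

  show "bump k (c * s, c * t) = cmod c * bump k (s, t)"
    by (simp add: bump_def h w norm_mult max_mult_distrib_left algebra_simps)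
qed

text \<open>The glued function \<open>h\<close> is continuous, without zeros, and homogeneous of degree \<open>-1\<close>: multiplied
with \<open>y\<close> it would be a section of the tautological bundle. On the disc of all \<open>(\<zeta>, 1 - \<bar>\<zeta>\<bar>)\<close>,
whose boundary circle is mapped to a single point of the projective line, it has a continuous
logarithm, whereas on the circle it equals a constant divided by \<open>\<zeta>\<close>.\<close>

lemma no_full_pencil: False
proof -
  define Y where "Y = (\<lambda>\<zeta>. (\<zeta>, complex_of_real (1 - cmod \<zeta>))) ` cball 0 1"
  have Y0: "y \<noteq> 0" if "y \<in> Y" for y using that by (auto simp: Y_def zero_prod_def)
  have "compact Y" unfolding Y_def by (intro compact_continuous_image continuous_intros) auto
  define B where "B k = {y. bump k y > 0}" for k
  have oB: "open (B k)" for k unfolding B_def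
    by (intro open_Collect_less continuous_intros continuous_on_bump)
  have "Y \<subseteq> (\<Union>k\<in>U. B k)"
  proof
    fix y assume y: "y \<in> Y"
    then have "fst y \<noteq> 0 \<or> snd y \<noteq> 0" using Y0 by (auto simp: prod_eq_iff)
    then obtain k where k: "k \<in> U" "cdot a k * snd y = cdot b k * fst y" using full by blast
    have w: "wedge k y = 0" using k(2) by (simp add: wedge_def mult.commute)
    then have "y \<in> chart k" using r_pos[OF k(1)] Y0[OF y] by (intro support_in_chart k(1)) (auto simp: less_imp_le)
    then have "bump k y > 0" using w r_pos[OF k(1)] by (simp add: bump_def chart_def)
    then show "y \<in> (\<Union>k\<in>U. B k)" using k(1) by (auto simp: B_def)
  qed
  with \<open>compact Y\<close> obtain N where N: "N \<subseteq> U" "finite N" and cov: "Y \<subseteq> (\<Union>k\<in>N. B k)"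
    using compactE_image[of Y U B] oB by blast
  have pos: "(\<Sum>k\<in>N. bump k y) > 0" if "i \<in> N" "y \<in> B i" for i y
    using that N by (intro sum_pos2[of N i]) (auto simp: B_def bump_nonneg)
  have Bd: "B i \<subseteq> chart i" if "i \<in> N" for i using bump_pos_imp_chart N that by (auto simp: B_def)
  define h where "h y = glue N (SOME i. i \<in> N \<and> y \<in> B i) y" for y
  have h_eq: "h y = glue N i y" if "i \<in> N" "y \<in> B i" for i y
  proof -
    let ?j = "SOME i. i \<in> N \<and> y \<in> B i"
    have j: "?j \<in> N \<and> y \<in> B ?j" using that by (intro someI[of "\<lambda>i. i \<in> N \<and> y \<in> B i" i]) auto
    show ?thesis unfolding h_def
      using j that pos[OF that] Bd N by (intro glue_independent) auto
  qed
  have "continuous_on (\<Union>i\<in>N. B i) h"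
  proof (rule continuous_on_open_UN)
    fix i assume i: "i \<in> N"
    have "continuous_on (B i) (glue N i)"
      using i N Bd pos by (intro continuous_on_glue) auto
    then show "continuous_on (B i) h"
      by (rule continuous_on_cong[THEN iffD1, rotated -1]) (auto simp: h_eq[OF i])
  qed (rule oB)
  then have hY: "continuous_on Y h" using cov by (rule continuous_on_subset)
  have hnz: "h y \<noteq> 0" if y: "y \<in> Y" for y
  proof -
    obtain i where i: "i \<in> N" "y \<in> B i" using cov y by blast
    then have "scal i y \<noteq> 0" using Bd N(1) by (intro scal_nz) auto
    then show ?thesis unfolding h_eq[OF i] glue_def by simp
  qed
  have hcirc: "h (c, 0) * c = h (1, 0)" if c: "cmod c = 1" for c
  proof -
    have c0: "c \<noteq> 0" using c by auto
    have "(1, 0) \<in> Y" by (auto simp: Y_def intro!: image_eqI[of _ _ 1])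
    then obtain i where i: "i \<in> N" "(1, 0) \<in> B i" using cov by blast
    note sc = scale_invariance[OF c0, where s = 1 and t = 0, unfolded mult_1_right mult_zero_right]
    have "(c, 0) \<in> B i" using i(2) sc(5)[of i] c by (simp add: B_def)
    then show ?thesis unfolding h_eq[OF i] h_eq[OF i(1) \<open>(c, 0) \<in> B i\<close>] glue_def sc c
      using c0 by simp
  qed
  have "continuous_on (cball 0 1) (\<lambda>\<zeta>. h (\<zeta>, complex_of_real (1 - cmod \<zeta>)))"
    by (rule continuous_on_compose2[OF hY]) (auto simp: Y_def intro!: continuous_intros)
  then obtain L where L: "continuous_on (cball 0 1) L"
    "\<And>\<zeta>. \<zeta> \<in> cball 0 1 \<Longrightarrow> h (\<zeta>, complex_of_real (1 - cmod \<zeta>)) = exp (L \<zeta>)"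
    using continuous_logarithm_on_cball[of 0 1 "\<lambda>\<zeta>. h (\<zeta>, complex_of_real (1 - cmod \<zeta>))"] hnz
    unfolding Y_def by blast
  let ?M = "\<lambda>\<theta>::real. L (exp (\<i> * of_real \<theta>)) + \<i> * of_real \<theta>"
  have "?M 0 = ?M (2 * pi)"
  proof (rule exp_constant_imp_constant[of UNIV ?M "h (1, 0)"])
    have "continuous_on UNIV (\<lambda>\<theta>::real. L (exp (\<i> * of_real \<theta>)))"
      by (rule continuous_on_compose2[OF L(1)]) (auto intro!: continuous_intros)
    then show "continuous_on UNIV ?M" by (intro continuous_intros)
    show "exp (?M \<theta>) = h (1, 0)" for \<theta>
      using hcirc[of "exp (\<i> * of_real \<theta>)"] L(2)[of "exp (\<i> * of_real \<theta>)"] by (simp add: exp_add)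
  qed auto
  moreover have "exp (\<i> * complex_of_real (2 * pi)) = 1" using exp_two_pi_i' by (simp add: mult_ac)
  ultimately show False by (simp add: pi_neq_zero)
qed

end

lemma pencil_misses:
  fixes \<Omega> E :: "(complex ^ 'n) set"
  assumes "open \<Omega>" "slices_simply_connected \<Omega>"
    and add: "\<And>z w. z \<in> E \<Longrightarrow> w \<in> E \<Longrightarrow> z + w \<in> E" and scale: "\<And>c z. z \<in> E \<Longrightarrow> c *s z \<in> E"
    and nz: "\<And>z. z \<in> \<Omega> \<Longrightarrow> z \<in> E \<Longrightarrow> cdot a z \<noteq> 0 \<or> cdot b z \<noteq> 0"
  shows "\<exists>\<alpha> \<beta>. \<forall>z\<in>\<Omega> \<inter> E. cdot (\<alpha> *s a + \<beta> *s b) z \<noteq> 0"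
proof (rule ccontr)
  assume contra: "\<not> ?thesis"
  interpret pencil \<Omega> E a b using assms by unfold_locales
  have full: "\<exists>z\<in>U. cdot a z * y2 = cdot b z * y1" for y1 y2
  proof -
    obtain z where "z \<in> \<Omega> \<inter> E" "cdot (y2 *s a + (- y1) *s b) z = 0" using contra by blast
    then show ?thesis unfolding U_def cdot_comb by (intro bexI[of _ z]) (auto simp: mult.commute)
  qed
  obtain z1 where z1: "z1 \<in> U" "cdot b z1 = 0" using full[of 0 1] by auto
  then have a1: "cdot a z1 \<noteq> 0" using U_nz[OF z1(1)] by simp
  obtain z2 where z2: "z2 \<in> U" "cdot a z2 = 0" using full[of 1 0] by auto
  then have b2: "cdot b z2 \<noteq> 0" using U_nz[OF z2(1)] by simp
  define e1 where "e1 = (1 / cdot a z1) *s z1"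
  define e2 where "e2 = (1 / cdot b z2) *s z2"
  let ?v = "\<lambda>k. cnj (cdot b k) *s e1 - cnj (cdot a k) *s e2"
  have "\<exists>d>0. \<forall>q. cmod q \<le> d \<longrightarrow> k + q *s ?v k \<in> \<Omega>" if k: "k \<in> U" for k
  proof -
    have "k \<in> \<Omega>" using k by (simp add: U_def)
    with assms(1) obtain e where e: "e > 0" "ball k e \<subseteq> \<Omega>" using open_contains_ball by blast
    have "k + q *s ?v k \<in> \<Omega>" if q: "cmod q \<le> e / (1 + norm (?v k))" for q
    proof -
      have p: "1 + norm (?v k) > 0" by (simp add: add_pos_nonneg)
      define v where "v = ?v k"
      have "norm (q *s v) \<le> e / (1 + norm v) * norm v"
        unfolding norm_scale using q v_def by (intro mult_right_mono) auto
      also have "\<dots> < e" using e(1) p unfolding v_def[symmetric] by (simp add: field_simps)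
      finally have "k + q *s v \<in> ball k e" by (simp add: dist_norm)
      then show ?thesis using e(2) unfolding v_def by blast
    qed
    moreover have "e / (1 + norm (?v k)) > 0"
      using e(1) norm_ge_zero[of "?v k"] by (intro divide_pos_pos) linarith+
    ultimately show ?thesis by blast
  qed
  then obtain r where r: "\<And>k. k \<in> U \<Longrightarrow> r k > 0 \<and> (\<forall>q. cmod q \<le> r k \<longrightarrow> k + q *s ?v k \<in> \<Omega>)"
    by metis
  interpret full_pencil \<Omega> E a b e1 e2 r
    using full r z1 z2 a1 b2 scale
    by unfold_locales (simp_all add: e1_def e2_def cdot_scale U_def)
  show False by (rule no_full_pencil)
qed

text \<open>Induction on the number of functionals: two of them are replaced by one member of the pencil that
they span on the common kernel of the others.\<close>

lemma ex_nonvanishing_functional: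
  fixes \<Omega> :: "(complex ^ 'n) set"
  assumes "open \<Omega>" "slices_simply_connected \<Omega>" "\<Omega> \<noteq> {}"
    and "\<forall>z\<in>\<Omega>. \<exists>a\<in>set as. cdot a z \<noteq> 0"
  shows "\<exists>a. \<forall>z\<in>\<Omega>. cdot a z \<noteq> 0"
  using assms(4)
proof (induction "length as" arbitrary: as rule: less_induct)
  case less
  consider "as = []" | a where "as = [a]" | a b bs where "as = a # b # bs"
  proof (cases as)
    case Nil then show ?thesis by (rule that(1))
  next
    case (Cons x xs)
    show ?thesis
    proof (cases xs)
      case Nil
      with Cons have "as = [x]" by simp
      then show ?thesis by (rule that(2))
    next
      case (Cons y ys)
      with \<open>as = x # xs\<close> have "as = x # y # ys" by simp
      then show ?thesis by (rule that(3))
    qed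
  qed
  then show ?case
  proof cases
    case 1
    with less.prems have "\<forall>z\<in>\<Omega>. False" by simp
    then have "\<Omega> = {}" by blast
    then show ?thesis using assms(3) by contradiction
  next
    case 2
    with less.prems have "\<forall>z\<in>\<Omega>. cdot a z \<noteq> 0" by simp
    then show ?thesis ..
  next
    case 3
    let ?E = "{z. \<forall>c\<in>set bs. cdot c z = 0}"
    have nz: "cdot a z \<noteq> 0 \<or> cdot b z \<noteq> 0" if z: "z \<in> \<Omega>" "z \<in> ?E" for z
    proof -
      have "\<exists>c\<in>set (a # b # bs). cdot c z \<noteq> 0" using less.prems z(1) unfolding 3 by blast
      with z(2) show ?thesis by auto
    qed
    have "\<exists>\<alpha> \<beta>. \<forall>z\<in>\<Omega> \<inter> ?E. cdot (\<alpha> *s a + \<beta> *s b) z \<noteq> 0"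
      using assms(1,2) by (rule pencil_misses) (simp_all add: cdot_add cdot_scale nz[simplified disj_imp])
    then obtain \<alpha> \<beta> where ab: "\<And>z. z \<in> \<Omega> \<Longrightarrow> z \<in> ?E \<Longrightarrow> cdot (\<alpha> *s a + \<beta> *s b) z \<noteq> 0" by blast
    have ne: "\<forall>z\<in>\<Omega>. \<exists>c\<in>set ((\<alpha> *s a + \<beta> *s b) # bs). cdot c z \<noteq> 0"
    proof
      fix z assume "z \<in> \<Omega>"
      from ab[OF this] show "\<exists>c\<in>set ((\<alpha> *s a + \<beta> *s b) # bs). cdot c z \<noteq> 0"
        by auto
    qed
    have "length ((\<alpha> *s a + \<beta> *s b) # bs) < length as" by (simp add: 3)
    from less.hyps[OF this ne] show ?thesis .
  qed
qed

text \<open>After a translation of \<open>p\<close> to the origin the coordinate functionals have no common zero on the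
domain.\<close>

theorem c_convex_imp_linearly_convex:
  fixes \<Omega> :: "(complex ^ 'n) set"
  assumes "open \<Omega>" "\<Omega> \<noteq> {}" "c_convex \<Omega>" and p: "p \<notin> \<Omega>"
  shows "\<exists>a. \<forall>z\<in>\<Omega>. cdot a (z - p) \<noteq> 0"
proof -
  let ?W = "(\<lambda>z. z - p) ` \<Omega>"
  have W: "open ?W" "?W \<noteq> {}" using assms open_translation_subtract by auto
  have "slice ?W (z - p) (w - p) = slice \<Omega> z w" for z w
  proof -
    have "w - p + \<tau> *s (z - p - (w - p)) \<in> ?W \<longleftrightarrow> w + \<tau> *s (z - w) \<in> \<Omega>" for \<tau>
    proof -
      have "w - p + \<tau> *s (z - p - (w - p)) = (w + \<tau> *s (z - w)) - p" by (simp add: vec_eq_iff)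
      moreover have "x - p \<in> ?W \<longleftrightarrow> x \<in> \<Omega>" for x by auto
      ultimately show ?thesis by (simp only:)
    qed
    then show ?thesis by (simp only: slice_def)
  qed
  note sl_eq = this
  have sl: "slices_simply_connected ?W" unfolding slices_simply_connected_def
  proof (intro ballI)
    fix z' w' assume "z' \<in> ?W" "w' \<in> ?W"
    then obtain z w where "z' = z - p" "w' = w - p" "z \<in> \<Omega>" "w \<in> \<Omega>" by (elim imageE)
    then show "simply_connected (slice ?W z' w')"
      using c_convex_imp_slices_simply_connected[OF assms(3)] sl_eq[of z w]
      unfolding slices_simply_connected_def by simp
  qed
  obtain ix where ix: "set ix = (UNIV :: 'n set)" using finite_list[OF finite] by blast
  have "\<exists>c\<in>set (map (\<lambda>i. axis i 1) ix). cdot c z \<noteq> 0" if "z \<in> ?W" for z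
  proof -
    have "z \<noteq> 0" using that p by auto
    then obtain i where "z $ i \<noteq> 0" by (auto simp: vec_eq_iff)
    then have "cdot (axis i 1) z \<noteq> 0" by (simp only: cdot_axis_left not_False_eq_True)
    moreover have "axis i 1 \<in> set (map (\<lambda>i. axis i (1::complex)) ix)" using ix by simp
    ultimately show ?thesis by (rule bexI)
  qed
  then have "\<forall>z\<in>?W. \<exists>c\<in>set (map (\<lambda>i. axis i 1) ix). cdot c z \<noteq> 0" by simp
  from ex_nonvanishing_functional[OF W(1) sl W(2) this] obtain a where a: "\<forall>z\<in>?W. cdot a z \<noteq> 0" ..
  have "cdot a (z - p) \<noteq> 0" if "z \<in> \<Omega>" for z
    using a imageI[OF that, of "\<lambda>z. z - p"] by (rule bspec)
  then have "\<forall>z\<in>\<Omega>. cdot a (z - p) \<noteq> 0" by (rule ballI)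
  then show ?thesis by (rule exI[of _ a])
qed

section \<open>Integrals of arbitrary non-negative functions\<close>

text \<open>The integral of a non-negative function is the supremum of the integrals of the simple functions
below it. So for an arbitrary function it is a lower integral, attained by a measurable minorant,
and the rules below follow from those for measurable functions. They are applied to the speed of a
curve in the Kobayashi metric.\<close>

lemma nn_integral_measurable_minorant:
  obtains g where "g \<in> borel_measurable M" "\<And>x. g x \<le> f x" "integral\<^sup>N M g = integral\<^sup>N M f"
proof -
  let ?A = "{g. simple_function M g \<and> g \<le> f}"
  have "(\<lambda>_. 0) \<in> ?A" by (simp add: le_fun_def)
  then have "?A \<noteq> {}" by blast
  from ennreal_SUP_countable_SUP[OF this, of "integral\<^sup>S M"] obtain F :: "nat \<Rightarrow> ennreal"
    where F: "range F \<subseteq> integral\<^sup>S M ` ?A" "(SUP g\<in>?A. integral\<^sup>S M g) = Sup (range F)"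
    by blast
  then have "\<forall>n. \<exists>s. simple_function M s \<and> s \<le> f \<and> F n = integral\<^sup>S M s" by blast
  then obtain s where s: "\<And>n. simple_function M (s n)" "\<And>n. s n \<le> f" "\<And>n. F n = integral\<^sup>S M (s n)"
    by metis
  define g where "g = (\<lambda>x. SUP n. s n x)"
  have gm: "g \<in> borel_measurable M"
    unfolding g_def using borel_measurable_simple_function[OF s(1)] by measurable
  have gle: "g x \<le> f x" for x unfolding g_def using s(2) by (auto intro!: SUP_least simp: le_fun_def)
  have "F n \<le> integral\<^sup>N M g" for n
    unfolding s(3) nn_integral_eq_simple_integral[OF s(1), symmetric]
    by (intro nn_integral_mono) (auto simp: g_def intro: SUP_upper)
  then have "integral\<^sup>N M f \<le> integral\<^sup>N M g"
    unfolding nn_integral_def[of M f] F(2) by (auto intro: SUP_least)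
  moreover have "integral\<^sup>N M g \<le> integral\<^sup>N M f" by (intro nn_integral_mono gle)
  ultimately show thesis using that gm gle by (metis antisym)
qed

lemma set_nn_integral_split:
  fixes F :: "real \<Rightarrow> ennreal"
  assumes "a \<le> b" "b \<le> c"
  shows "(\<integral>\<^sup>+t\<in>{a..c}. F t \<partial>lborel) = (\<integral>\<^sup>+t\<in>{a..b}. F t \<partial>lborel) + (\<integral>\<^sup>+t\<in>{b..c}. F t \<partial>lborel)"
proof (rule antisym)
  obtain g where g: "g \<in> borel_measurable lborel" "\<And>x. g x \<le> F x * indicator {a..c} x"
    "(\<integral>\<^sup>+t. g t \<partial>lborel) = (\<integral>\<^sup>+t\<in>{a..c}. F t \<partial>lborel)"
    using nn_integral_measurable_minorant[where M = lborel and f = "\<lambda>x. F x * indicator {a..c} x"] by blast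
  have "(\<integral>\<^sup>+t. g t \<partial>lborel) \<le> (\<integral>\<^sup>+t. g t * indicator {a..b} t + g t * indicator {b..c} t \<partial>lborel)"
  proof (rule nn_integral_mono)
    fix x show "g x \<le> g x * indicator {a..b} x + g x * indicator {b..c} x"
      using g(2)[of x] by (cases "x \<in> {a..c}") (auto simp: indicator_def)
  qed
  also have "\<dots> = (\<integral>\<^sup>+t. g t * indicator {a..b} t \<partial>lborel) + (\<integral>\<^sup>+t. g t * indicator {b..c} t \<partial>lborel)"
    using g(1) by (intro nn_integral_add) auto
  also have "\<dots> \<le> (\<integral>\<^sup>+t\<in>{a..b}. F t \<partial>lborel) + (\<integral>\<^sup>+t\<in>{b..c}. F t \<partial>lborel)"
  proof (intro add_mono nn_integral_mono)
    fix x
    show "g x * indicator {a..b} x \<le> F x * indicator {a..b} x"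
      using g(2)[of x] assms by (auto simp: indicator_def split: if_splits)
    show "g x * indicator {b..c} x \<le> F x * indicator {b..c} x"
      using g(2)[of x] assms by (auto simp: indicator_def split: if_splits)
  qed
  finally show "(\<integral>\<^sup>+t\<in>{a..c}. F t \<partial>lborel) \<le> (\<integral>\<^sup>+t\<in>{a..b}. F t \<partial>lborel) + (\<integral>\<^sup>+t\<in>{b..c}. F t \<partial>lborel)"
    using g(3) by simp
next
  obtain g where g: "g \<in> borel_measurable lborel" "\<And>x. g x \<le> F x * indicator {a..b} x"
    "(\<integral>\<^sup>+t. g t \<partial>lborel) = (\<integral>\<^sup>+t\<in>{a..b}. F t \<partial>lborel)"
    using nn_integral_measurable_minorant[where M = lborel and f = "\<lambda>x. F x * indicator {a..b} x"] by blast
  obtain h where h: "h \<in> borel_measurable lborel" "\<And>x. h x \<le> F x * indicator {b..c} x"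
    "(\<integral>\<^sup>+t. h t \<partial>lborel) = (\<integral>\<^sup>+t\<in>{b..c}. F t \<partial>lborel)"
    using nn_integral_measurable_minorant[where M = lborel and f = "\<lambda>x. F x * indicator {b..c} x"] by blast
  have "(\<integral>\<^sup>+t\<in>{a..b}. F t \<partial>lborel) + (\<integral>\<^sup>+t\<in>{b..c}. F t \<partial>lborel) = (\<integral>\<^sup>+t. g t + h t \<partial>lborel)"
    using g h by (simp add: nn_integral_add)
  also have "\<dots> \<le> (\<integral>\<^sup>+t\<in>{a..c}. F t \<partial>lborel)"
  proof (rule nn_integral_mono_AE)
    have "g x + h x \<le> F x * indicator {a..c} x" if "x \<noteq> b" for x
      using g(2)[of x] h(2)[of x] that assms
      by (cases "x < b") (auto simp: indicator_def split: if_splits)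
    then show "AE x in lborel. g x + h x \<le> F x * indicator {a..c} x"
      using AE_lborel_singleton[of b] by (auto elim: eventually_mono)
  qed
  finally show "(\<integral>\<^sup>+t\<in>{a..b}. F t \<partial>lborel) + (\<integral>\<^sup>+t\<in>{b..c}. F t \<partial>lborel) \<le> (\<integral>\<^sup>+t\<in>{a..c}. F t \<partial>lborel)" .
qed

text \<open>Passing to a minorant gives one inequality; the same inequality for the inverse substitution gives
the other.\<close>

lemma nn_integral_affine:
  fixes F :: "real \<Rightarrow> ennreal"
  assumes "c \<noteq> 0"
  shows "(\<integral>\<^sup>+x. F x \<partial>lborel) = ennreal \<bar>c\<bar> * (\<integral>\<^sup>+x. F (t + c * x) \<partial>lborel)"
proof (rule antisym)
  have le: "(\<integral>\<^sup>+x. F x \<partial>lborel) \<le> ennreal \<bar>c\<bar> * (\<integral>\<^sup>+x. F (t + c * x) \<partial>lborel)"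
    if c: "c \<noteq> 0" for F :: "real \<Rightarrow> ennreal" and c t
  proof -
    obtain g where g: "g \<in> borel_measurable lborel" "\<And>x. g x \<le> F x"
      "(\<integral>\<^sup>+t. g t \<partial>lborel) = (\<integral>\<^sup>+t. F t \<partial>lborel)"
      using nn_integral_measurable_minorant[where M = lborel and f = F] by blast
    have "(\<integral>\<^sup>+x. F x \<partial>lborel) = ennreal \<bar>c\<bar> * (\<integral>\<^sup>+x. g (t + c * x) \<partial>lborel)"
      using nn_integral_real_affine[of g c t] g c by simp
    also have "\<dots> \<le> ennreal \<bar>c\<bar> * (\<integral>\<^sup>+x. F (t + c * x) \<partial>lborel)"
      by (intro mult_left_mono nn_integral_mono g) simp
    finally show ?thesis .
  qed
  show "(\<integral>\<^sup>+x. F x \<partial>lborel) \<le> ennreal \<bar>c\<bar> * (\<integral>\<^sup>+x. F (t + c * x) \<partial>lborel)" by (rule le[OF assms])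
  have "(\<integral>\<^sup>+x. F (t + c * x) \<partial>lborel) \<le> ennreal \<bar>1 / c\<bar> * (\<integral>\<^sup>+x. F (t + c * (- t / c + 1 / c * x)) \<partial>lborel)"
    using assms by (intro le) simp
  also have "(\<lambda>x. F (t + c * (- t / c + 1 / c * x))) = F" using assms by (simp add: field_simps)
  finally have "ennreal \<bar>c\<bar> * (\<integral>\<^sup>+x. F (t + c * x) \<partial>lborel) \<le> ennreal \<bar>c\<bar> * (ennreal \<bar>1 / c\<bar> * (\<integral>\<^sup>+x. F x \<partial>lborel))"
    by (intro mult_left_mono) auto
  also have "\<dots> = (\<integral>\<^sup>+x. F x \<partial>lborel)"
    using assms by (simp add: mult.assoc[symmetric] ennreal_mult[symmetric])
  finally show "ennreal \<bar>c\<bar> * (\<integral>\<^sup>+x. F (t + c * x) \<partial>lborel) \<le> (\<integral>\<^sup>+x. F x \<partial>lborel)" .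
qed

section \<open>Piecewise continuously differentiable curves\<close>

definition c1_on :: "real \<Rightarrow> real \<Rightarrow> (real \<Rightarrow> 'a::real_normed_vector) \<Rightarrow> bool" where
  "c1_on a b \<alpha> \<longleftrightarrow> a < b \<and> (\<exists>D. continuous_on {a..b} D \<and>
     (\<forall>s\<in>{a..b}. (\<alpha> has_vector_derivative D s) (at s within {a..b})))"

text \<open>An inductive form of piecewise differentiability on an arbitrary interval: it makes concatenation,
restriction and reparametrisation inductions over the pieces, without an explicit partition.\<close>

inductive pc1_on :: "real \<Rightarrow> real \<Rightarrow> (real \<Rightarrow> 'a::real_normed_vector) \<Rightarrow> bool" where
  piece: "c1_on a b \<alpha> \<Longrightarrow> pc1_on a b \<alpha>"
| append: "pc1_on a b \<alpha> \<Longrightarrow> c1_on b c \<alpha> \<Longrightarrow> pc1_on a c \<alpha>"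

lemma pc1_on_less: "pc1_on a b \<alpha> \<Longrightarrow> a < b"
  by (induction rule: pc1_on.induct) (auto simp: c1_on_def)

lemma c1_on_subset:
  assumes "c1_on a b \<alpha>" "a \<le> c" "c < d" "d \<le> b" shows "c1_on c d \<alpha>"
proof -
  have sub: "{c..d} \<subseteq> {a..b}" using assms by auto
  obtain D where "continuous_on {a..b} D"
    "\<And>s. s \<in> {a..b} \<Longrightarrow> (\<alpha> has_vector_derivative D s) (at s within {a..b})"
    using assms(1) unfolding c1_on_def by blast
  note D = this
  have "(\<alpha> has_vector_derivative D s) (at s within {c..d})" if "s \<in> {c..d}" for s
    using D(2)[of s] that sub by (blast intro: has_vector_derivative_within_subset)
  then show ?thesis unfolding c1_on_def using assms(3) continuous_on_subset[OF D(1) sub] by blast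
qed

lemma pc1_on_trans:
  assumes "pc1_on b c \<alpha>" "pc1_on a b \<alpha>" shows "pc1_on a c \<alpha>"
  using assms by (induction rule: pc1_on.induct) (auto intro: pc1_on.append)

lemma pc1_on_initial:
  assumes "pc1_on a b \<alpha>" "a < s" "s \<le> b" shows "pc1_on a s \<alpha>"
  using assms
proof (induction rule: pc1_on.induct)
  case (piece a b \<alpha>)
  then show ?case by (intro pc1_on.piece c1_on_subset[of a b \<alpha> a s]) simp_all
next
  case (append a b \<alpha> c)
  show ?case
  proof (cases "s \<le> b")
    case True
    with append.prems show ?thesis by (intro append.IH)
  next
    case False
    then have "c1_on b s \<alpha>" using append.prems by (intro c1_on_subset[OF append.hyps(2)]) simp_all
    with append.hyps(1) show ?thesis by (rule pc1_on.append)
  qed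
qed

lemma pc1_on_final:
  assumes "pc1_on a b \<alpha>" "a \<le> s" "s < b" shows "pc1_on s b \<alpha>"
  using assms
proof (induction rule: pc1_on.induct)
  case (piece a b \<alpha>)
  then show ?case by (intro pc1_on.piece c1_on_subset[of a b \<alpha> s b]) simp_all
next
  case (append a b \<alpha> c)
  show ?case
  proof (cases "s < b")
    case True
    with append.prems have "pc1_on s b \<alpha>" by (intro append.IH)
    then show ?thesis using append.hyps(2) by (rule pc1_on.append)
  next
    case False
    then show ?thesis using append.prems by (intro pc1_on.piece c1_on_subset[OF append.hyps(2)]) simp_all
  qed
qed

lemma pc1_on_subset:
  "pc1_on a b \<alpha> \<Longrightarrow> a \<le> s \<Longrightarrow> s < t \<Longrightarrow> t \<le> b \<Longrightarrow> pc1_on s t \<alpha>"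
  by (rule pc1_on_final[OF pc1_on_initial[of a b \<alpha> t]]) auto

lemma c1_on_cong:
  assumes "c1_on a b \<alpha>" "\<And>s. s \<in> {a..b} \<Longrightarrow> \<alpha> s = \<beta> s" shows "c1_on a b \<beta>"
proof -
  obtain D where D: "a < b" "continuous_on {a..b} D"
    "\<And>s. s \<in> {a..b} \<Longrightarrow> (\<alpha> has_vector_derivative D s) (at s within {a..b})"
    using assms(1) unfolding c1_on_def by blast
  have "(\<beta> has_vector_derivative D s) (at s within {a..b})" if s: "s \<in> {a..b}" for s
    by (rule has_vector_derivative_transform[OF s _ D(3)[OF s]]) (simp add: assms(2))
  then show ?thesis unfolding c1_on_def using D by blast
qed

lemma pc1_on_cong:
  assumes "pc1_on a b \<alpha>" "\<And>s. s \<in> {a..b} \<Longrightarrow> \<alpha> s = \<beta> s" shows "pc1_on a b \<beta>"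
  using assms
proof (induction rule: pc1_on.induct)
  case (piece a b \<alpha>)
  have "c1_on a b \<beta>" using piece.hyps piece.prems by (rule c1_on_cong)
  then show ?case by (rule pc1_on.piece)
next
  case (append a b \<alpha> c)
  have ab: "a < b" using append.hyps(1) by (rule pc1_on_less)
  have bc: "b < c" using append.hyps(2) by (simp add: c1_on_def)
  have "pc1_on a b \<beta>" using append.prems bc by (intro append.IH) auto
  moreover have "c1_on b c \<beta>" using append.hyps(2) by (rule c1_on_cong) (use append.prems ab in auto)
  ultimately show ?case by (rule pc1_on.append)
qed

lemma c1_on_affine:
  assumes "c1_on a b \<alpha>" "c \<noteq> 0" and lo: "lo = min ((a - t) / c) ((b - t) / c)"
    and hi: "hi = max ((a - t) / c) ((b - t) / c)"
  shows "c1_on lo hi (\<lambda>s. \<alpha> (t + c * s))"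
proof -
  obtain D where D: "a < b" "continuous_on {a..b} D"
    "\<And>s. s \<in> {a..b} \<Longrightarrow> (\<alpha> has_vector_derivative D s) (at s within {a..b})"
    using assms(1) unfolding c1_on_def by blast
  have "(a - t) / c \<noteq> (b - t) / c" using D(1) assms(2) by simp
  then have l: "lo < hi" unfolding lo hi by linarith
  have m: "t + c * s \<in> {a..b}" if s: "s \<in> {lo..hi}" for s
  proof (cases "c > 0")
    case True
    then have "(a - t) / c \<le> (b - t) / c" using D(1) by (simp add: divide_right_mono)
    then have "(a - t) / c \<le> s" "s \<le> (b - t) / c" using s unfolding lo hi by auto
    then show ?thesis using True by (simp add: field_simps)
  next
    case False
    then have c: "c < 0" using assms(2) by simp
    then have "(b - t) / c \<le> (a - t) / c" using D(1) by (simp add: divide_right_mono_neg)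
    then have "(b - t) / c \<le> s" "s \<le> (a - t) / c" using s unfolding lo hi by auto
    then show ?thesis using c by (simp add: field_simps)
  qed
  have "((\<lambda>s. \<alpha> (t + c * s)) has_vector_derivative c *\<^sub>R D (t + c * s)) (at s within {lo..hi})"
    if s: "s \<in> {lo..hi}" for s
  proof -
    have "((\<lambda>s. t + c * s) has_vector_derivative c) (at s within {lo..hi})"
      by (auto intro!: derivative_eq_intros)
    moreover have "(\<alpha> has_vector_derivative D (t + c * s)) (at (t + c * s) within (\<lambda>s. t + c * s) ` {lo..hi})"
      using D(3)[OF m[OF s]] by (rule has_vector_derivative_within_subset) (use m in auto)
    ultimately show ?thesis
      using vector_diff_chain_within[of "\<lambda>s. t + c * s" c s "{lo..hi}" \<alpha> "D (t + c * s)"] by (simp add: o_def)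
  qed
  moreover have "continuous_on {lo..hi} (\<lambda>s. c *\<^sub>R D (t + c * s))"
    by (intro continuous_intros continuous_on_compose2[OF D(2)]) (use m in auto)
  ultimately show ?thesis unfolding c1_on_def using l by blast
qed

lemma pc1_on_affine_pos:
  assumes "pc1_on a b \<alpha>" "c > 0"
  shows "pc1_on ((a - t) / c) ((b - t) / c) (\<lambda>s. \<alpha> (t + c * s))"
  using assms(1)
proof (induction rule: pc1_on.induct)
  case (piece a b \<alpha>)
  then have "(a - t) / c < (b - t) / c" using assms(2) by (auto simp: c1_on_def divide_strict_right_mono)
  then show ?case using assms(2) by (intro pc1_on.piece c1_on_affine[OF piece]) simp_all
next
  case (append a b \<alpha> d)
  then have "(b - t) / c < (d - t) / c" using assms(2) by (auto simp: c1_on_def divide_strict_right_mono)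
  then have "c1_on ((b - t) / c) ((d - t) / c) (\<lambda>s. \<alpha> (t + c * s))"
    using assms(2) by (intro c1_on_affine[OF append.hyps(2)]) simp_all
  with append.IH show ?case by (rule pc1_on.append)
qed

lemma pc1_on_affine_neg:
  assumes "pc1_on a b \<alpha>" "c < 0"
  shows "pc1_on ((b - t) / c) ((a - t) / c) (\<lambda>s. \<alpha> (t + c * s))"
  using assms(1)
proof (induction rule: pc1_on.induct)
  case (piece a b \<alpha>)
  then have "(b - t) / c < (a - t) / c" using assms(2) by (auto simp: c1_on_def divide_strict_right_mono_neg)
  then show ?case using assms(2) by (intro pc1_on.piece c1_on_affine[OF piece]) simp_all
next
  case (append a b \<alpha> d)
  then have "(d - t) / c < (b - t) / c" using assms(2) by (auto simp: c1_on_def divide_strict_right_mono_neg)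
  then have "c1_on ((d - t) / c) ((b - t) / c) (\<lambda>s. \<alpha> (t + c * s))"
    using assms(2) by (intro c1_on_affine[OF append.hyps(2)]) simp_all
  then have "pc1_on ((d - t) / c) ((b - t) / c) (\<lambda>s. \<alpha> (t + c * s))" by (rule pc1_on.piece)
  with append.IH show ?case by (rule pc1_on_trans)
qed

lemma pc1_on_imp_continuous_on:
  assumes "pc1_on a b \<alpha>" shows "continuous_on {a..b} \<alpha>"
  using assms
proof (induction rule: pc1_on.induct)
  case (piece a b \<alpha>)
  then show ?case unfolding c1_on_def continuous_on_eq_continuous_within
    by (auto intro: has_vector_derivative_continuous)
next
  case (append a b \<alpha> c)
  have "continuous_on {b..c} \<alpha>" using append.hyps(2) unfolding c1_on_def continuous_on_eq_continuous_within
    by (auto intro: has_vector_derivative_continuous)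
  then have "continuous_on ({a..b} \<union> {b..c}) \<alpha>"
    using append.IH by (intro continuous_on_closed_Un) auto
  moreover have "{a..b} \<union> {b..c} = {a..c}"
    using pc1_on_less[OF append.hyps(1)] append.hyps(2) by (auto simp: c1_on_def)
  ultimately show ?case by simp
qed

lemma c1_on_differentiable:
  assumes "c1_on a b \<alpha>" "a < s" "s < b"
  shows "\<exists>D. (\<alpha> has_vector_derivative D) (at s)"
proof -
  have "s \<in> {a..b}" using assms by simp
  then obtain D where "(\<alpha> has_vector_derivative D) (at s within {a..b})"
    using assms(1) unfolding c1_on_def by blast
  moreover have "at s within {a..b} = at s" using assms by (intro at_within_Icc_at) auto
  ultimately show ?thesis by auto
qed

lemma pc1_on_differentiable:
  assumes "pc1_on a b \<alpha>"
  shows "\<exists>B. finite B \<and> (\<forall>s\<in>{a..b} - B. \<exists>D. (\<alpha> has_vector_derivative D) (at s))"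
  using assms
proof (induction rule: pc1_on.induct)
  case (piece a b \<alpha>)
  show ?case by (intro exI[of _ "{a, b}"]) (auto intro: c1_on_differentiable[OF piece])
next
  case (append a b \<alpha> c)
  then obtain B where B: "finite B" "\<And>s. s \<in> {a..b} - B \<Longrightarrow> \<exists>D. (\<alpha> has_vector_derivative D) (at s)" by blast
  have "\<exists>D. (\<alpha> has_vector_derivative D) (at s)" if "s \<in> {a..c} - (B \<union> {b, c})" for s
    using that B(2)[of s] c1_on_differentiable[OF append.hyps(2), of s] by (cases "s < b") auto
  with B(1) show ?case by (intro exI[of _ "B \<union> {b, c}"]) auto
qed

lemma piecewise_C1_curve_iff: "piecewise_C1_curve \<alpha> \<longleftrightarrow> pc1_on 0 1 \<alpha>"
proof
  assume "piecewise_C1_curve \<alpha>"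
  then obtain m :: nat and t where t: "t 0 = (0::real)" "t m = 1" "\<And>i. i < m \<Longrightarrow> c1_on (t i) (t (Suc i)) \<alpha>"
    unfolding piecewise_C1_curve_def c1_on_def by blast
  have "m \<noteq> 0" using t(1,2) by (metis zero_neq_one)
  moreover have "i \<le> m \<Longrightarrow> i \<noteq> 0 \<longrightarrow> pc1_on (t 0) (t i) \<alpha>" for i
  proof (induction i)
    case (Suc i)
    then have c: "c1_on (t i) (t (Suc i)) \<alpha>" using t(3) by simp
    show ?case
    proof (cases "i = 0")
      case True then show ?thesis using c by (auto intro: pc1_on.piece)
    next
      case False then show ?thesis using c Suc by (auto intro: pc1_on.append)
    qed
  qed simp
  ultimately show "pc1_on 0 1 \<alpha>" using t by force
next
  have "pc1_on a b \<alpha> \<Longrightarrow> \<exists>m t. t 0 = a \<and> t m = b \<and> (\<forall>i<m. c1_on (t i) (t (Suc i)) \<alpha>)" for a b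
  proof (induction rule: pc1_on.induct)
    case (piece a b \<alpha>)
    then show ?case by (intro exI[of _ "Suc 0"] exI[of _ "\<lambda>i. if i = 0 then a else b"]) auto
  next
    case (append a b \<alpha> c)
    then obtain m t where t: "t 0 = a" "t m = b" "\<forall>i<m. c1_on (t i) (t (Suc i)) \<alpha>" by blast
    have "c1_on ((t(Suc m := c)) i) ((t(Suc m := c)) (Suc i)) \<alpha>" if i: "i < Suc m" for i
      using t append.hyps(2) i by (cases "i = m") auto
    then show ?case using t(1) by (intro exI[of _ "Suc m"] exI[of _ "t(Suc m := c)"]) auto
  qed
  moreover assume "pc1_on 0 1 \<alpha>"
  ultimately show "piecewise_C1_curve \<alpha>" unfolding piecewise_C1_curve_def c1_on_def by blast
qed

section \<open>Bounds for the Kobayashi metric\<close>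

text \<open>A map into the punctured disc of radius \<open>R\<close> without zeros is the exponential of a map into the
half plane \<open>Re < ln R\<close>; a Moebius transformation takes this half plane to the unit disc, where the
Schwarz lemma applies.\<close>

lemma punctured_disc_Schwarz:
  assumes g: "g holomorphic_on ball 0 1" and nz: "\<And>\<zeta>. cmod \<zeta> < 1 \<Longrightarrow> g \<zeta> \<noteq> 0"
    and R: "\<And>\<zeta>. cmod \<zeta> < 1 \<Longrightarrow> cmod (g \<zeta>) < R"
  shows "cmod (deriv g 0) \<le> 2 * cmod (g 0) * ln (R / cmod (g 0))"
proof -
  have Rpos: "R > 0" using R[of 0] norm_ge_zero[of "g 0"] by (simp del: norm_ge_zero)
  have con: "contractible (ball 0 1 :: complex set)" by (simp add: convex_imp_contractible)
  have gnz: "\<And>\<zeta>. \<zeta> \<in> ball 0 1 \<Longrightarrow> g \<zeta> \<noteq> 0" using nz by simp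
  obtain h where h: "h holomorphic_on ball 0 1" "\<And>\<zeta>. \<zeta> \<in> ball 0 1 \<Longrightarrow> g \<zeta> = exp (h \<zeta>)"
    using contractible_imp_holomorphic_log[OF g con gnz] by metis
  define k where "k = (\<lambda>\<zeta>. h \<zeta> - complex_of_real (ln R))"
  have k: "k holomorphic_on ball 0 1" unfolding k_def by (intro holomorphic_intros h)
  have Rek: "Re (k \<zeta>) = ln (cmod (g \<zeta>) / R)" if "cmod \<zeta> < 1" for \<zeta>
  proof -
    have "cmod (g \<zeta>) = exp (Re (h \<zeta>))" using h(2)[of \<zeta>] that by simp
    then show ?thesis unfolding k_def using Rpos by (simp add: ln_div)
  qed
  have neg: "Re (k \<zeta>) < 0" if "cmod \<zeta> < 1" for \<zeta>
    using Rek[OF that] R[OF that] nz[OF that] Rpos by simp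
  define k0 where "k0 = k 0"
  have k0: "Re k0 < 0" unfolding k0_def by (rule neg) simp
  define \<phi> where "\<phi> = (\<lambda>\<zeta>. (k \<zeta> - k0) / (k \<zeta> + cnj k0))"
  have den: "k \<zeta> + cnj k0 \<noteq> 0" if "cmod \<zeta> < 1" for \<zeta>
  proof
    assume "k \<zeta> + cnj k0 = 0"
    then have "Re (k \<zeta>) + Re k0 = 0" by (metis complex_cnj(1) plus_complex.simps(1) zero_complex.simps(1) complex.sel(1) cnj.simps(1))
    then show False using neg[OF that] k0 by linarith
  qed
  have \<phi>h: "\<phi> holomorphic_on ball 0 1" unfolding \<phi>_def using den by (intro holomorphic_intros k) auto
  have \<phi>0: "\<phi> 0 = 0" by (simp add: \<phi>_def k0_def)
  have \<phi>1: "cmod (\<phi> \<zeta>) < 1" if "cmod \<zeta> < 1" for \<zeta>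
  proof -
    have "Re (k \<zeta>) * Re k0 > 0" using neg[OF that] k0 by (simp add: mult_neg_neg)
    moreover have "(cmod (k \<zeta> + cnj k0))\<^sup>2 = (cmod (k \<zeta> - k0))\<^sup>2 + 4 * (Re (k \<zeta>) * Re k0)"
      by (simp only: cmod_power2) (simp add: power2_eq_square algebra_simps)
    ultimately have "(cmod (k \<zeta> - k0))\<^sup>2 < (cmod (k \<zeta> + cnj k0))\<^sup>2" by linarith
    then have "cmod (k \<zeta> - k0) < cmod (k \<zeta> + cnj k0)" by (rule power2_less_imp_less) simp
    then show ?thesis using den[OF that] by (simp add: \<phi>_def norm_divide)
  qed
  have d: "cmod (deriv \<phi> 0) \<le> 1" using Schwarz_Lemma(2)[OF \<phi>h \<phi>0 \<phi>1, of 0] by simp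
  have fd: "(h has_field_derivative deriv h 0) (at 0)"
    using h(1) by (intro holomorphic_derivI[of h "ball 0 1"]) auto
  have "(\<phi> has_field_derivative (deriv h 0 * (k 0 + cnj k0) - (k 0 - k0) * deriv h 0) / ((k 0 + cnj k0) * (k 0 + cnj k0))) (at 0)"
    unfolding \<phi>_def using den[of 0]
    by (intro DERIV_divide) (auto simp: k_def intro!: derivative_eq_intros fd)
  then have "deriv \<phi> 0 = (deriv h 0 * (k 0 + cnj k0) - (k 0 - k0) * deriv h 0) / ((k 0 + cnj k0) * (k 0 + cnj k0))"
    by (rule DERIV_imp_deriv)
  also have "\<dots> = deriv h 0 / (k 0 + cnj k0)" using den[of 0] unfolding k0_def by simp
  also have "k 0 + cnj k0 = complex_of_real (2 * Re k0)" unfolding k0_def by (rule complex_add_cnj)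
  finally have "cmod (deriv \<phi> 0) = cmod (deriv h 0) / (2 * \<bar>Re k0\<bar>)" by (simp add: norm_divide)
  with d k0 have hb: "cmod (deriv h 0) \<le> 2 * (- Re k0)" by (simp add: field_simps)
  have "((\<lambda>\<zeta>. exp (h \<zeta>)) has_field_derivative exp (h 0) * deriv h 0) (at 0)"
    by (auto intro!: derivative_eq_intros fd)
  then have "(g has_field_derivative exp (h 0) * deriv h 0) (at 0)"
    by (rule has_field_derivative_transform_within_open[of _ _ _ "ball 0 1"]) (auto simp: h(2))
  then have "deriv g 0 = g 0 * deriv h 0" using DERIV_imp_deriv h(2)[of 0] by simp
  then have "cmod (deriv g 0) \<le> cmod (g 0) * (2 * (- Re k0))"
    using mult_left_mono[OF hb, of "cmod (g 0)"] by (simp only: norm_mult norm_ge_zero)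
  also have "- Re k0 = ln (R / cmod (g 0))"
    using Rek[of 0] nz[of 0] Rpos unfolding k0_def by (simp add: ln_div)
  finally show ?thesis by (simp add: mult_ac)
qed

text \<open>The competitors in the definition of the Kobayashi metric.\<close>

definition kobayashi_disc ::
    "(complex ^ 'n) set \<Rightarrow> complex ^ 'n \<Rightarrow> complex ^ 'n \<Rightarrow> complex \<Rightarrow> (complex \<Rightarrow> complex ^ 'n) \<Rightarrow> bool" where
  "kobayashi_disc G z X c f \<longleftrightarrow> (\<forall>i. (\<lambda>\<zeta>. f \<zeta> $ i) holomorphic_on ball 0 1) \<and> f ` ball 0 1 \<subseteq> G \<and>
     f 0 = z \<and> c *s (\<chi> i. deriv (\<lambda>\<zeta>. f \<zeta> $ i) 0) = X"

lemma kobayashi_metric_alt: "kobayashi_metric G z X = Inf {cmod c | c. \<exists>f. kobayashi_disc G z X c f}"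
  by (simp add: kobayashi_metric_def kobayashi_disc_def)

lemma kobayashi_metric_le: "kobayashi_disc G z X c f \<Longrightarrow> kobayashi_metric G z X \<le> cmod c"
  unfolding kobayashi_metric_alt by (intro cInf_lower bdd_belowI[of _ 0]) auto

lemma linear_kobayashi_disc:
  assumes "ball z r \<subseteq> G" "r > 0"
  shows "\<exists>c f. kobayashi_disc G z X c f \<and> cmod c = norm X / r"
proof (cases "X = 0")
  case True
  have "kobayashi_disc G z X 0 (\<lambda>_. z)"
    using assms True by (auto simp: kobayashi_disc_def subset_iff)
  then show ?thesis using True by (intro exI[of _ 0] exI[of _ "\<lambda>_. z"]) simp
next
  case False
  define v where "v = complex_of_real (r / norm X) *s X"
  have nv: "norm v = r" using False assms(2) by (simp add: v_def norm_scale norm_divide)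
  have "z + \<zeta> *s v \<in> G" if "cmod \<zeta> < 1" for \<zeta>
  proof -
    have "norm (\<zeta> *s v) < r" using that nv assms(2) by (simp add: norm_scale)
    then have "z + \<zeta> *s v \<in> ball z r" by (simp add: dist_norm)
    then show ?thesis using assms(1) by blast
  qed
  moreover have "deriv (\<lambda>\<zeta>. (z + \<zeta> *s v) $ i) 0 = v $ i" for i
    by (rule DERIV_imp_deriv) (auto intro!: derivative_eq_intros)
  moreover have "complex_of_real (norm X / r) *s v = X"
  proof -
    have "norm X / r * (r / norm X) = 1" using False assms(2) by simp
    then show ?thesis unfolding v_def vector_smult_assoc of_real_mult[symmetric] by simp
  qed
  ultimately have "kobayashi_disc G z X (complex_of_real (norm X / r)) (\<lambda>\<zeta>. z + \<zeta> *s v)"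
    unfolding kobayashi_disc_def by (auto intro!: holomorphic_intros simp: vec_lambda_eta)
  then show ?thesis using assms(2) by (intro exI[of _ "complex_of_real (norm X / r)"] exI) (auto simp: norm_divide)
qed

lemma kobayashi_metric_ge:
  assumes "open G" "z \<in> G" and B: "\<And>c f. kobayashi_disc G z X c f \<Longrightarrow> B \<le> cmod c"
  shows "B \<le> kobayashi_metric G z X"
  unfolding kobayashi_metric_alt
proof (rule cInf_greatest)
  obtain r where "r > 0" "ball z r \<subseteq> G" using assms open_contains_ball by blast
  then show "{cmod c |c. \<exists>f. kobayashi_disc G z X c f} \<noteq> {}"
    using linear_kobayashi_disc[of z r G X] by blast
qed (use B in auto)

lemma kobayashi_metric_nonneg: "open G \<Longrightarrow> z \<in> G \<Longrightarrow> 0 \<le> kobayashi_metric G z X"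
  by (rule kobayashi_metric_ge) auto

lemma kobayashi_metric_le_ball:
  "ball z r \<subseteq> G \<Longrightarrow> r > 0 \<Longrightarrow> kobayashi_metric G z X \<le> norm X / r"
  using linear_kobayashi_disc[of z r G X] kobayashi_metric_le by metis

lemma scaleR_eq_scale: "c *\<^sub>R (X :: complex ^ 'n) = complex_of_real c *s X"
  unfolding vec_eq_iff vector_scaleR_component vector_smult_component
  by (rule allI, rule scaleR_conv_of_real)

lemma kobayashi_metric_scaleR:
  assumes "open G" "z \<in> G" "c \<noteq> 0"
  shows "kobayashi_metric G z (c *\<^sub>R X) = \<bar>c\<bar> * kobayashi_metric G z X"
proof -
  have le: "kobayashi_metric G z (c *\<^sub>R X) \<le> \<bar>c\<bar> * kobayashi_metric G z X" if c: "c \<noteq> 0" for c X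
  proof -
    have "kobayashi_metric G z (c *\<^sub>R X) / \<bar>c\<bar> \<le> kobayashi_metric G z X"
    proof (rule kobayashi_metric_ge[OF assms(1,2)])
      fix d f assume "kobayashi_disc G z X d f"
      then have "kobayashi_disc G z (c *\<^sub>R X) (of_real c * d) f"
        unfolding kobayashi_disc_def scaleR_eq_scale by (auto simp: vector_smult_assoc[symmetric])
      from kobayashi_metric_le[OF this] show "kobayashi_metric G z (c *\<^sub>R X) / \<bar>c\<bar> \<le> cmod d"
        using c by (simp add: norm_mult field_simps)
    qed
    then show ?thesis using c by (simp add: field_simps)
  qed
  have "kobayashi_metric G z ((1 / c) *\<^sub>R (c *\<^sub>R X)) \<le> \<bar>1 / c\<bar> * kobayashi_metric G z (c *\<^sub>R X)"
    using assms(3) by (intro le) simp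
  then have "\<bar>c\<bar> * kobayashi_metric G z X \<le> kobayashi_metric G z (c *\<^sub>R X)"
    using assms(3) by (simp add: field_simps)
  with le[OF assms(3)] show ?thesis by (metis antisym)
qed

text \<open>The affine function \<open>cdot a - b\<close> maps \<open>G\<close> to a punctured disc, so its composition with a competing
disc is subject to the Schwarz lemma for punctured discs.\<close>

lemma kobayashi_metric_ge_functional:
  assumes "open G" "z \<in> G" and f: "\<And>w. w \<in> G \<Longrightarrow> cdot a w \<noteq> b" "\<And>w. w \<in> G \<Longrightarrow> cmod (cdot a w - b) < R"
  shows "cmod (cdot a X) \<le> kobayashi_metric G z X * (2 * cmod (cdot a z - b) * ln (R / cmod (cdot a z - b)))"
proof -
  let ?m = "2 * cmod (cdot a z - b) * ln (R / cmod (cdot a z - b))"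
  have "cmod (cdot a z - b) > 0" using f(1)[OF assms(2)] by simp
  moreover from this have "ln (R / cmod (cdot a z - b)) > 0" using f(2)[OF assms(2)]
    by (intro ln_gt_zero) (simp add: less_divide_eq)
  ultimately have m: "?m > 0" by simp
  have "cmod (cdot a X) / ?m \<le> kobayashi_metric G z X"
  proof (rule kobayashi_metric_ge[OF assms(1,2)])
    fix c F assume F: "kobayashi_disc G z X c F"
    let ?g = "\<lambda>\<zeta>. cdot a (F \<zeta>) - b"
    have hol: "(\<lambda>\<zeta>. F \<zeta> $ i) holomorphic_on ball 0 1" for i using F by (simp add: kobayashi_disc_def)
    have FG: "F \<zeta> \<in> G" if "cmod \<zeta> < 1" for \<zeta> using F that by (auto simp: kobayashi_disc_def)
    have F0: "F 0 = z" using F by (simp add: kobayashi_disc_def)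
    have X: "X = c *s (\<chi> i. deriv (\<lambda>\<zeta>. F \<zeta> $ i) 0)" using F by (simp add: kobayashi_disc_def)
    have "((\<lambda>\<zeta>. F \<zeta> $ i) has_field_derivative deriv (\<lambda>\<zeta>. F \<zeta> $ i) 0) (at 0)" for i
      using hol by (intro holomorphic_derivI[of _ "ball 0 1"]) auto
    then have "(?g has_field_derivative (\<Sum>i\<in>UNIV. a $ i * deriv (\<lambda>\<zeta>. F \<zeta> $ i) 0)) (at 0)"
      unfolding cdot_def by (auto intro!: derivative_eq_intros sum.cong)
    then have "deriv ?g 0 = (\<Sum>i\<in>UNIV. a $ i * deriv (\<lambda>\<zeta>. F \<zeta> $ i) 0)" by (rule DERIV_imp_deriv)
    then have "cdot a X = c * deriv ?g 0" unfolding X cdot_scale by (simp add: cdot_def)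
    moreover have "cmod (deriv ?g 0) \<le> 2 * cmod (?g 0) * ln (R / cmod (?g 0))"
    proof (rule punctured_disc_Schwarz)
      show "?g holomorphic_on ball 0 1" unfolding cdot_def by (intro holomorphic_intros hol)
    qed (use f FG in auto)
    ultimately have "cmod (cdot a X) \<le> cmod c * ?m" unfolding F0 by (simp add: norm_mult mult_left_mono)
    then show "cmod (cdot a X) / ?m \<le> cmod c" using m by (simp add: divide_le_eq)
  qed
  then show ?thesis using m by (simp add: divide_le_eq)
qed

text \<open>The competing disc combines a linear motion in the direction \<open>v\<close> with an infinitesimally optimal
map to the punctured disc of radius \<open>\<epsilon>\<close> in the direction \<open>e\<close>. As the two components run at the
same time, the metric is bounded by the maximum, not by the sum, of what each of them needs. The
vertical velocity \<open>- 2 H l T\<close> is the one of Poincare length \<open>H\<close> at the point \<open>T\<close>.\<close>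

lemma kobayashi_metric_cusp_le:
  fixes v e :: "complex ^ 'n"
  assumes G: "\<And>c u. cmod c < \<epsilon> \<Longrightarrow> 0 < cmod u \<Longrightarrow> cmod u < \<epsilon> \<Longrightarrow> p + c *s v + u *s e \<in> G"
    and "\<epsilon> > 0" "l > 0" "H > 0" "\<bar>s\<bar> \<le> H * \<epsilon>"
    and T: "T = \<epsilon> * exp (- l)"
  shows "kobayashi_metric G (p + of_real T *s e) (of_real s *s v + of_real (- 2 * H * l * T) *s e) \<le> H"
proof -
  define k where "k = (\<lambda>\<zeta>::complex. - of_real l * ((1 + \<zeta>) / (1 - \<zeta>)))"
  define f where "f = (\<lambda>\<zeta>. p + (of_real (s / H) * \<zeta>) *s v + (of_real \<epsilon> * exp (k \<zeta>)) *s e)"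
  have nz: "1 - \<zeta> \<noteq> 0" if "cmod \<zeta> < 1" for \<zeta> :: complex using that by auto
  have hol: "(\<lambda>\<zeta>. f \<zeta> $ i) holomorphic_on ball 0 1" for i
    unfolding f_def k_def using nz by (auto intro!: holomorphic_intros)
  have inG: "f \<zeta> \<in> G" if z: "cmod \<zeta> < 1" for \<zeta>
    unfolding f_def
  proof (rule G)
    have "\<bar>s / H\<bar> \<le> \<epsilon>" using assms by (simp add: abs_divide field_simps)
    then have "\<bar>s / H\<bar> * cmod \<zeta> \<le> \<epsilon> * cmod \<zeta>" by (rule mult_right_mono) simp
    also have "\<dots> < \<epsilon>" using z assms(2) by simp
    finally show "cmod (of_real (s / H) * \<zeta>) < \<epsilon>" unfolding norm_mult norm_of_real .
    have "Re ((1 + \<zeta>) / (1 - \<zeta>)) = (1 - (cmod \<zeta>)\<^sup>2) / (cmod (1 - \<zeta>))\<^sup>2"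
      by (simp only: Re_divide cmod_power2) (simp add: power2_eq_square algebra_simps)
    also have "\<dots> > 0"
    proof -
      have "(cmod \<zeta>)\<^sup>2 < 1" using z by (simp add: power_less_one_iff abs_square_less_1)
      then show ?thesis using nz[OF z] by simp
    qed
    finally have "Re ((1 + \<zeta>) / (1 - \<zeta>)) > 0" .
    then have "Re (of_real l * ((1 + \<zeta>) / (1 - \<zeta>))) > 0"
    proof -
      have "Re (of_real l * w) = l * Re w" for w by simp
      then show ?thesis using assms(3) \<open>Re ((1 + \<zeta>) / (1 - \<zeta>)) > 0\<close> by (simp only: mult_pos_pos)
    qed
    then have "Re (k \<zeta>) < 0" by (simp only: k_def mult_minus_left uminus_complex.simps neg_less_0_iff_less)
    then show "cmod (of_real \<epsilon> * exp (k \<zeta>)) < \<epsilon>" using assms(2) by (simp add: norm_mult)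
    show "0 < cmod (of_real \<epsilon> * exp (k \<zeta>))" using assms(2) by simp
  qed
  have f0: "f 0 = p + of_real T *s e"
    by (simp add: f_def k_def T exp_of_real[symmetric])
  have "(k has_field_derivative - of_real (2 * l)) (at 0)"
    unfolding k_def by (auto intro!: derivative_eq_intros)
  then have "((\<lambda>\<zeta>. f \<zeta> $ i) has_field_derivative of_real (s / H) * v $ i + of_real \<epsilon> * (exp (k 0) * - of_real (2 * l)) * e $ i) (at 0)" for i
    unfolding f_def using assms(4) by (auto intro!: derivative_eq_intros)
  moreover have "of_real \<epsilon> * exp (k 0) = complex_of_real T" by (simp add: k_def T exp_of_real[symmetric])
  ultimately have "((\<lambda>\<zeta>. f \<zeta> $ i) has_field_derivative of_real (s / H) * v $ i + of_real T * - of_real (2 * l) * e $ i) (at 0)" for i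
    by (metis mult.assoc)
  then have "deriv (\<lambda>\<zeta>. f \<zeta> $ i) 0 = of_real (s / H) * v $ i + of_real T * - of_real (2 * l) * e $ i" for i
    by (rule DERIV_imp_deriv)
  then have "of_real H *s (\<chi> i. deriv (\<lambda>\<zeta>. f \<zeta> $ i) 0) = of_real s *s v + of_real (- 2 * H * l * T) *s e"
    using assms(4) by (simp add: vec_eq_iff field_simps)
  then have "kobayashi_disc G (p + of_real T *s e) (of_real s *s v + of_real (- 2 * H * l * T) *s e) (of_real H) f"
    unfolding kobayashi_disc_def using hol inG f0 by auto
  from kobayashi_metric_le[OF this] show ?thesis using assms(4) by simp
qed

section \<open>Lengths of curves and the Kobayashi distance\<close>

definition kob_speed :: "(complex ^ 'n) set \<Rightarrow> (real \<Rightarrow> complex ^ 'n) \<Rightarrow> real \<Rightarrow> ennreal" where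
  "kob_speed G \<alpha> t = ennreal (kobayashi_metric G (\<alpha> t) (vector_derivative \<alpha> (at t)))"

definition kob_length :: "(complex ^ 'n) set \<Rightarrow> real \<Rightarrow> real \<Rightarrow> (real \<Rightarrow> complex ^ 'n) \<Rightarrow> ennreal" where
  "kob_length G a b \<alpha> = (\<integral>\<^sup>+t\<in>{a..b}. kob_speed G \<alpha> t \<partial>lborel)"

text \<open>The extended distance keeps the value infinity, which occurs exactly when no competing curve has
finite length.\<close>

definition kob_edist :: "(complex ^ 'n) set \<Rightarrow> complex ^ 'n \<Rightarrow> complex ^ 'n \<Rightarrow> ennreal" where
  "kob_edist G p q =
     (INF \<alpha> \<in> {\<alpha>. pc1_on 0 1 \<alpha> \<and> \<alpha> ` {0..1} \<subseteq> G \<and> \<alpha> 0 = p \<and> \<alpha> 1 = q}. kob_length G 0 1 \<alpha>)"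

lemma kobayashi_dist_alt: "kobayashi_dist G p q = enn2real (kob_edist G p q)"
  by (simp add: kobayashi_dist_def kob_edist_def kob_length_def kob_speed_def piecewise_C1_curve_iff)

lemma kob_length_split:
  "a \<le> b \<Longrightarrow> b \<le> c \<Longrightarrow> kob_length G a c \<alpha> = kob_length G a b \<alpha> + kob_length G b c \<alpha>"
  unfolding kob_length_def by (rule set_nn_integral_split)

lemma kob_length_cong:
  assumes "\<And>t. t \<in> {a<..<b} \<Longrightarrow> kob_speed G \<alpha> t = kob_speed G \<beta> t"
  shows "kob_length G a b \<alpha> = kob_length G a b \<beta>"
  unfolding kob_length_def
proof (rule nn_integral_cong_AE)
  show "AE t in lborel. kob_speed G \<alpha> t * indicator {a..b} t = kob_speed G \<beta> t * indicator {a..b} t"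
    using AE_lborel_singleton[of a] AE_lborel_singleton[of b]
  proof eventually_elim
    case (elim t)
    then show ?case using assms[of t] by (cases "t \<in> {a..b}") auto
  qed
qed

lemma kob_speed_cong:
  assumes "open S" "t \<in> S" "\<And>s. s \<in> S \<Longrightarrow> \<alpha> s = \<beta> s"
  shows "kob_speed G \<alpha> t = kob_speed G \<beta> t"
proof -
  have "(\<alpha> has_vector_derivative D) (at t) \<longleftrightarrow> (\<beta> has_vector_derivative D) (at t)" for D
    using has_vector_derivative_transform_within_open[OF _ assms(1,2), where f = \<alpha> and g = \<beta>]
      has_vector_derivative_transform_within_open[OF _ assms(1,2), where f = \<beta> and g = \<alpha>] assms(3)
    by metis
  then have "vector_derivative \<alpha> (at t) = vector_derivative \<beta> (at t)"
    by (simp add: vector_derivative_def)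
  then show ?thesis using assms by (simp add: kob_speed_def)
qed

lemma kob_length_le:
  assumes "a \<le> b" "0 \<le> H"
    and "\<And>s. s \<in> {a<..<b} \<Longrightarrow> kobayashi_metric G (\<alpha> s) (vector_derivative \<alpha> (at s)) \<le> H"
  shows "kob_length G a b \<alpha> \<le> ennreal (H * (b - a))"
proof -
  have "kob_length G a b \<alpha> \<le> (\<integral>\<^sup>+t. ennreal H * indicator {a..b} t \<partial>lborel)"
    unfolding kob_length_def
  proof (rule nn_integral_mono_AE)
    show "AE t in lborel. kob_speed G \<alpha> t * indicator {a..b} t \<le> ennreal H * indicator {a..b} t"
      using AE_lborel_singleton[of a] AE_lborel_singleton[of b]
    proof eventually_elim
      case (elim t)
      then show ?case using assms(3)[of t]
        by (cases "t \<in> {a..b}") (auto simp: kob_speed_def intro: ennreal_leI)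
    qed
  qed
  also have "\<dots> = ennreal (H * (b - a))" using assms by (simp add: nn_integral_cmult ennreal_mult)
  finally show ?thesis .
qed

lemma nn_integral_cmult_any:
  assumes "0 < c"
  shows "ennreal c * (\<integral>\<^sup>+x. F x \<partial>M) = (\<integral>\<^sup>+x. ennreal c * F x \<partial>M)"
proof (rule antisym)
  have le: "ennreal c * (\<integral>\<^sup>+x. F x \<partial>M) \<le> (\<integral>\<^sup>+x. ennreal c * F x \<partial>M)" for c F
  proof -
    obtain g where g: "g \<in> borel_measurable M" "\<And>x. g x \<le> F x" "integral\<^sup>N M g = integral\<^sup>N M F"
      using nn_integral_measurable_minorant[where M = M and f = F] by blast
    have "ennreal c * (\<integral>\<^sup>+x. F x \<partial>M) = (\<integral>\<^sup>+x. ennreal c * g x \<partial>M)" using g by (simp add: nn_integral_cmult)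
    also have "\<dots> \<le> (\<integral>\<^sup>+x. ennreal c * F x \<partial>M)" by (intro nn_integral_mono mult_left_mono g) simp
    finally show ?thesis .
  qed
  show "ennreal c * (\<integral>\<^sup>+x. F x \<partial>M) \<le> (\<integral>\<^sup>+x. ennreal c * F x \<partial>M)" by (rule le)
  have cc: "ennreal c * ennreal (1 / c) = 1" "ennreal (1 / c) * ennreal c = 1"
    using assms by (simp_all add: ennreal_mult[symmetric])
  have "ennreal c * (ennreal (1 / c) * (\<integral>\<^sup>+x. ennreal c * F x \<partial>M)) \<le> ennreal c * (\<integral>\<^sup>+x. ennreal (1 / c) * (ennreal c * F x) \<partial>M)"
    by (intro mult_left_mono le) simp
  then show "(\<integral>\<^sup>+x. ennreal c * F x \<partial>M) \<le> ennreal c * (\<integral>\<^sup>+x. F x \<partial>M)"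
    by (simp add: mult.assoc[symmetric] cc)
qed

text \<open>The chain rule gives the speed of the new curve except at the finitely many parameters where the
curve is not differentiable, and these do not contribute to the integral.\<close>

lemma kob_length_affine:
  assumes G: "open G" and \<alpha>: "pc1_on a b \<alpha>" "\<alpha> ` {a..b} \<subseteq> G" and c: "c \<noteq> 0"
    and lohi: "\<And>s. s \<in> {lo..hi} \<longleftrightarrow> t + c * s \<in> {a..b}"
  shows "kob_length G lo hi (\<lambda>s. \<alpha> (t + c * s)) = kob_length G a b \<alpha>"
proof -
  obtain B where B: "finite B" "\<And>s. s \<in> {a..b} - B \<Longrightarrow> \<exists>D. (\<alpha> has_vector_derivative D) (at s)"
    using pc1_on_differentiable[OF \<alpha>(1)] by blast
  let ?B = "(\<lambda>x. (x - t) / c) ` B"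
  have nul: "AE s in lborel. s \<notin> ?B"
    by (intro AE_not_in finite_imp_null_set_lborel) (use B in auto)
  have "kob_length G a b \<alpha> = ennreal \<bar>c\<bar> * (\<integral>\<^sup>+s. kob_speed G \<alpha> (t + c * s) * indicator {a..b} (t + c * s) \<partial>lborel)"
    unfolding kob_length_def by (rule nn_integral_affine[OF c])
  also have "\<dots> = (\<integral>\<^sup>+s. ennreal \<bar>c\<bar> * (kob_speed G \<alpha> (t + c * s) * indicator {a..b} (t + c * s)) \<partial>lborel)"
    using c by (intro nn_integral_cmult_any) simp
  also have "\<dots> = kob_length G lo hi (\<lambda>s. \<alpha> (t + c * s))"
    unfolding kob_length_def
  proof (rule nn_integral_cong_AE, use nul in eventually_elim)
    case (elim s)
    show ?case
    proof (cases "s \<in> {lo..hi}")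
      case True
      then have s: "t + c * s \<in> {a..b}" using lohi by blast
      have "t + c * s \<notin> B"
      proof
        assume "t + c * s \<in> B"
        then have "((t + c * s) - t) / c \<in> ?B" by (rule imageI)
        then show False using elim c by simp
      qed
      then obtain D where D: "(\<alpha> has_vector_derivative D) (at (t + c * s))" using B s by blast
      have "((\<lambda>s. t + c * s) has_vector_derivative c) (at s)" by (auto intro!: derivative_eq_intros)
      then have "((\<lambda>s. \<alpha> (t + c * s)) has_vector_derivative c *\<^sub>R D) (at s)"
        using vector_diff_chain_at[of "\<lambda>s. t + c * s" c s \<alpha> D] D by (simp add: o_def)
      then have "vector_derivative (\<lambda>s. \<alpha> (t + c * s)) (at s) = c *\<^sub>R D" "vector_derivative \<alpha> (at (t + c * s)) = D"
        using D by (auto intro: vector_derivative_at)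
      moreover have "\<alpha> (t + c * s) \<in> G" using \<alpha>(2) s by blast
      ultimately have "kob_speed G (\<lambda>s. \<alpha> (t + c * s)) s = ennreal \<bar>c\<bar> * kob_speed G \<alpha> (t + c * s)"
        using c G by (simp add: kob_speed_def kobayashi_metric_scaleR ennreal_mult kobayashi_metric_nonneg)
      then show ?thesis using True s by simp
    next
      case False
      then have "t + c * s \<notin> {a..b}" using lohi by blast
      with False show ?thesis by simp
    qed
  qed
  finally show ?thesis by simp
qed

lemma kob_edist_le_length:
  assumes G: "open G" and \<alpha>: "pc1_on a b \<alpha>" "\<alpha> ` {a..b} \<subseteq> G"
  shows "kob_edist G (\<alpha> a) (\<alpha> b) \<le> kob_length G a b \<alpha>"
proof -
  have ab: "a < b" using pc1_on_less \<alpha>(1) by blast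
  let ?\<beta> = "\<lambda>s. \<alpha> (a + (b - a) * s)"
  have iff: "s \<in> {0..1} \<longleftrightarrow> a + (b - a) * s \<in> {a..b}" for s
  proof -
    have ba: "0 < b - a" using ab by simp
    have "0 \<le> s \<longleftrightarrow> (b - a) * 0 \<le> (b - a) * s" "s \<le> 1 \<longleftrightarrow> (b - a) * s \<le> (b - a) * 1"
      by (simp_all only: mult_le_cancel_left_pos[OF ba])
    then show ?thesis by auto
  qed
  have "pc1_on 0 1 ?\<beta>" using pc1_on_affine_pos[OF \<alpha>(1), of "b - a" a] ab by simp
  moreover have "?\<beta> ` {0..1} \<subseteq> G" using \<alpha>(2) iff by blast
  ultimately have "kob_edist G (\<alpha> a) (\<alpha> b) \<le> kob_length G 0 1 ?\<beta>"
    unfolding kob_edist_def by (intro INF_lower) auto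
  also have "\<dots> = kob_length G a b \<alpha>" using G \<alpha> ab iff by (intro kob_length_affine) auto
  finally show ?thesis .
qed

lemma kob_edist_approx:
  assumes "kob_edist G p q < top" "(e::real) > 0"
  obtains \<alpha> where "pc1_on 0 1 \<alpha>" "\<alpha> ` {0..1} \<subseteq> G" "\<alpha> 0 = p" "\<alpha> 1 = q"
    "kob_length G 0 1 \<alpha> < kob_edist G p q + ennreal e"
proof -
  have "kob_edist G p q < kob_edist G p q + ennreal e"
    using assms by (cases "kob_edist G p q") (auto simp: ennreal_less_iff simp flip: ennreal_plus)
  then show ?thesis using that unfolding kob_edist_def INF_less_iff by blast
qed

lemma kob_edist_triangle:
  assumes G: "open G"
  shows "kob_edist G p r \<le> kob_edist G p q + kob_edist G q r"
proof (rule ennreal_le_epsilon)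
  fix e :: real assume fin: "kob_edist G p q + kob_edist G q r < top" and e: "0 < e"
  have fin': "kob_edist G p q < top" "kob_edist G q r < top" and e2: "e / 2 > 0" using fin e by auto
  obtain \<alpha> where \<alpha>: "pc1_on 0 1 \<alpha>" "\<alpha> ` {0..1} \<subseteq> G" "\<alpha> 0 = p" "\<alpha> 1 = q"
    "kob_length G 0 1 \<alpha> < kob_edist G p q + ennreal (e / 2)"
    by (rule kob_edist_approx[OF fin'(1) e2])
  obtain \<beta> where \<beta>: "pc1_on 0 1 \<beta>" "\<beta> ` {0..1} \<subseteq> G" "\<beta> 0 = q" "\<beta> 1 = r"
    "kob_length G 0 1 \<beta> < kob_edist G q r + ennreal (e / 2)"
    by (rule kob_edist_approx[OF fin'(2) e2])
  let ?\<gamma> = "\<lambda>s. if s \<le> 1 then \<alpha> s else \<beta> (- 1 + 1 * s)"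
  have \<beta>1: "pc1_on 1 2 (\<lambda>s. \<beta> (- 1 + 1 * s))" using pc1_on_affine_pos[OF \<beta>(1), of 1 "- 1"] by simp
  have "pc1_on 0 1 ?\<gamma>" by (rule pc1_on_cong[OF \<alpha>(1)]) auto
  moreover have "pc1_on 1 2 ?\<gamma>" by (rule pc1_on_cong[OF \<beta>1]) (use \<alpha> \<beta> in auto)
  ultimately have \<gamma>: "pc1_on 0 2 ?\<gamma>" using pc1_on_trans by blast
  have \<gamma>G: "?\<gamma> ` {0..2} \<subseteq> G" using \<alpha>(2) \<beta>(2) by (auto simp: image_subset_iff)
  have "kob_edist G (?\<gamma> 0) (?\<gamma> 2) \<le> kob_length G 0 2 ?\<gamma>" by (rule kob_edist_le_length[OF G \<gamma> \<gamma>G])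
  also have "\<dots> = kob_length G 0 1 ?\<gamma> + kob_length G 1 2 ?\<gamma>" by (rule kob_length_split) auto
  also have "kob_length G 0 1 ?\<gamma> = kob_length G 0 1 \<alpha>"
    by (intro kob_length_cong kob_speed_cong[of "{0<..<1}"]) auto
  also have "kob_length G 1 2 ?\<gamma> = kob_length G 1 2 (\<lambda>s. \<beta> (- 1 + 1 * s))"
    by (intro kob_length_cong kob_speed_cong[of "{1<..<2}"]) auto
  also have "\<dots> = kob_length G 0 1 \<beta>" by (rule kob_length_affine[OF G \<beta>(1,2)]) auto
  finally have "kob_edist G p r \<le> kob_length G 0 1 \<alpha> + kob_length G 0 1 \<beta>" using \<alpha> \<beta> by simp
  also have "\<dots> \<le> (kob_edist G p q + ennreal (e / 2)) + (kob_edist G q r + ennreal (e / 2))"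
    using \<alpha>(5) \<beta>(5) by (intro add_mono) auto
  also have "\<dots> = kob_edist G p q + kob_edist G q r + (ennreal (e / 2) + ennreal (e / 2))"
    by (simp only: add_ac)
  also have "ennreal (e / 2) + ennreal (e / 2) = ennreal e" using e by (simp flip: ennreal_plus)
  finally show "kob_edist G p r \<le> kob_edist G p q + kob_edist G q r + ennreal e" .
qed

lemma kob_edist_sym:
  assumes G: "open G" shows "kob_edist G p q = kob_edist G q p"
proof -
  have le: "kob_edist G p q \<le> kob_edist G q p" for p q
    unfolding kob_edist_def[of G q p]
  proof (rule INF_greatest)
    fix \<alpha> assume "\<alpha> \<in> {\<alpha>. pc1_on 0 1 \<alpha> \<and> \<alpha> ` {0..1} \<subseteq> G \<and> \<alpha> 0 = q \<and> \<alpha> 1 = p}"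
    then have \<alpha>: "pc1_on 0 1 \<alpha>" "\<alpha> ` {0..1} \<subseteq> G" "\<alpha> 0 = q" "\<alpha> 1 = p" by auto
    let ?\<beta> = "\<lambda>s. \<alpha> (1 + - 1 * s)"
    have \<beta>: "pc1_on 0 1 ?\<beta>" using pc1_on_affine_neg[OF \<alpha>(1), of "- 1" 1] by simp
    have "?\<beta> ` {0..1} \<subseteq> G" using \<alpha>(2) by (auto simp: image_subset_iff)
    from kob_edist_le_length[OF G \<beta> this] have "kob_edist G p q \<le> kob_length G 0 1 ?\<beta>" using \<alpha> by simp
    also have "\<dots> = kob_length G 0 1 \<alpha>" by (rule kob_length_affine[OF G \<alpha>(1,2)]) auto
    finally show "kob_edist G p q \<le> kob_length G 0 1 \<alpha>" .
  qed
  show ?thesis by (intro antisym le)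
qed

text \<open>All points of the segment have distance at least \<open>r / 2\<close> from the complement of \<open>G\<close>, so that
linear discs of this radius compete.\<close>

lemma kob_edist_segment:
  assumes G: "open G" and ball: "ball z r \<subseteq> G" "r > 0" and w: "norm (w - z) \<le> r / 2"
  shows "kob_edist G z w \<le> ennreal (2 * norm (w - z) / r)"
proof -
  let ?\<alpha> = "\<lambda>s. z + s *\<^sub>R (w - z)"
  have d: "(?\<alpha> has_vector_derivative (w - z)) (at s within S)" for s S
    by (auto intro!: derivative_eq_intros)
  have p: "pc1_on 0 1 ?\<alpha>" unfolding c1_on_def
    by (intro pc1_on.piece) (auto simp: c1_on_def intro!: exI[of _ "\<lambda>_. w - z"] d)
  have dist: "dist z (?\<alpha> s) \<le> r / 2" if "s \<in> {0..1}" for s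
  proof -
    have "\<bar>s\<bar> * norm (w - z) \<le> 1 * norm (w - z)" using that by (intro mult_right_mono) auto
    then show ?thesis using w by (simp add: dist_norm)
  qed
  have aG: "?\<alpha> ` {0..1} \<subseteq> G"
  proof
    fix x assume "x \<in> ?\<alpha> ` {0..1}"
    then have "dist z x \<le> r / 2" using dist by blast
    then show "x \<in> G" using ball by (auto simp: subset_iff)
  qed
  have "kob_edist G (?\<alpha> 0) (?\<alpha> 1) \<le> kob_length G 0 1 ?\<alpha>" by (rule kob_edist_le_length[OF G p aG])
  also have "\<dots> \<le> ennreal (norm (w - z) / (r / 2) * (1 - 0))"
  proof (rule kob_length_le)
    fix s :: real assume s: "s \<in> {0<..<1}"
    have "ball (?\<alpha> s) (r / 2) \<subseteq> ball z r"
    proof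
      fix x assume "x \<in> ball (?\<alpha> s) (r / 2)"
      then show "x \<in> ball z r" using dist[of s] s dist_triangle[of z x "?\<alpha> s"] by auto
    qed
    then have "ball (?\<alpha> s) (r / 2) \<subseteq> G" using ball by blast
    then show "kobayashi_metric G (?\<alpha> s) (vector_derivative ?\<alpha> (at s)) \<le> norm (w - z) / (r / 2)"
      unfolding vector_derivative_at[OF d] using ball(2) by (intro kobayashi_metric_le_ball) auto
  qed (use ball in auto)
  finally show ?thesis by (simp add: mult.commute)
qed

text \<open>Finiteness of the distance is an equivalence relation whose classes are open.\<close>

lemma kob_edist_finite:
  assumes G: "open G" "connected G" and "p \<in> G" "q \<in> G"
  shows "kob_edist G p q < top"
proof (rule connected_equivalence_relation[OF G(2) assms(3,4), where R = "\<lambda>p q. kob_edist G p q < top"])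
  show "kob_edist G y x < top" if "kob_edist G x y < top" for x y
    using that kob_edist_sym[OF G(1)] by metis
  show "kob_edist G x z < top" if "kob_edist G x y < top" "kob_edist G y z < top" for x y z
    using kob_edist_triangle[OF G(1), of x z y] that by (metis ennreal_add_less_top le_less_trans)
  fix a assume a: "a \<in> G"
  then obtain r where r: "r > 0" "ball a r \<subseteq> G" using G open_contains_ball by blast
  have "kob_edist G a x < top" if "x \<in> ball a (r / 2)" for x
  proof -
    have "kob_edist G a x \<le> ennreal (2 * norm (x - a) / r)"
      using that r by (intro kob_edist_segment G) (auto simp: dist_norm norm_minus_commute)
    then show ?thesis by (simp add: le_less_trans)
  qed
  moreover have "openin (top_of_set G) (ball a (r / 2))"
    using r by (intro open_subset) (auto simp: subset_iff)
  moreover have "a \<in> ball a (r / 2)" using r by simp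
  ultimately show "\<exists>T. openin (top_of_set G) T \<and> a \<in> T \<and> (\<forall>x\<in>T. kob_edist G a x < top)" by blast
qed

section \<open>Lower bounds from omitted hyperplanes\<close>

lemma increment_le_nn_integral:
  fixes w v :: "real \<Rightarrow> real"
  assumes "a < b" and v: "continuous_on {a..b} v"
    and w: "\<And>s. s \<in> {a..b} \<Longrightarrow> (w has_real_derivative v s) (at s within {a..b})"
    and F: "\<And>s. s \<in> {a<..<b} \<Longrightarrow> ennreal (v s) \<le> F s"
  shows "ennreal (w b - w a) \<le> (\<integral>\<^sup>+s\<in>{a..b}. F s \<partial>lborel)"
proof -
  have 1: "(v has_integral (w b - w a)) {a..b}"
    using assms(1) w by (intro fundamental_theorem_of_calculus)
      (auto simp: has_real_derivative_iff_has_vector_derivative)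
  have "(\<lambda>s. max 0 (v s)) integrable_on {a..b}"
    by (intro integrable_continuous_interval continuous_intros v)
  then obtain I where I: "((\<lambda>s. max 0 (v s)) has_integral I) {a..b}" by blast
  have "w b - w a \<le> I" by (rule has_integral_le[OF 1 I]) auto
  then have "ennreal (w b - w a) \<le> ennreal I" by (rule ennreal_leI)
  also have "\<dots> = (\<integral>\<^sup>+s. ennreal (max 0 (v s)) * indicator {a..b} s \<partial>lborel)"
    by (rule nn_integral_has_integral_lebesgue'[symmetric, OF _ I]) auto
  also have "\<dots> \<le> (\<integral>\<^sup>+s\<in>{a..b}. F s \<partial>lborel)"
  proof (rule nn_integral_mono_AE)
    show "AE s in lborel. ennreal (max 0 (v s)) * indicator {a..b} s \<le> F s * indicator {a..b} s"
      using AE_lborel_singleton[of a] AE_lborel_singleton[of b]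
    proof eventually_elim
      case (elim s)
      then show ?case using F[of s]
        by (cases "s \<in> {a..b}") (auto simp: max_def ennreal_neg split: if_splits)
    qed
  qed
  finally show ?thesis .
qed

lemma ennreal_add_le: "ennreal (x + y) \<le> ennreal x + ennreal y"
proof -
  have "ennreal (x + y) \<le> ennreal (max 0 x + max 0 y)" by (intro ennreal_leI) auto
  also have "\<dots> = ennreal x + ennreal y" by (simp add: max_def ennreal_neg)
  finally show ?thesis .
qed

lemma bounded_linear_cdot: "bounded_linear (cdot a)"
  unfolding linear_conv_bounded_linear[symmetric]
  by (rule linearI) (simp_all add: cdot_add scaleR_eq_scale cdot_scale scaleR_conv_of_real)

text \<open>The function \<open>ln (ln (R / r)) / 2\<close> of the radius \<open>r\<close> is arc length along the radii of the
punctured disc of radius \<open>R\<close> in the Poincare metric with density \<open>1 / (2 r ln (R / r))\<close>.\<close>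

definition cusp_height :: "real \<Rightarrow> complex ^ 'n \<Rightarrow> complex \<Rightarrow> complex ^ 'n \<Rightarrow> real" where
  "cusp_height R a b z = ln (ln (R / cmod (cdot a z - b))) / 2"

locale omitting_functional =
  fixes G :: "(complex ^ 'n) set" and a :: "complex ^ 'n" and b :: complex and R :: real
  assumes open_G: "open G"
    and omits: "\<And>w. w \<in> G \<Longrightarrow> cdot a w \<noteq> b"
    and bounded: "\<And>w. w \<in> G \<Longrightarrow> cmod (cdot a w - b) < R"
begin

text \<open>The derivative of the height along the curve is at most the Poincare length of the velocity of the
image curve in the punctured disc, which the Schwarz lemma bounds by the Kobayashi metric.\<close>

lemma length_ge_height_piece:
  assumes "c1_on s t \<alpha>" "\<alpha> ` {s..t} \<subseteq> G"
  shows "ennreal (cusp_height R a b (\<alpha> t) - cusp_height R a b (\<alpha> s)) \<le> kob_length G s t \<alpha>"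
proof -
  obtain D where st: "s < t" and D: "continuous_on {s..t} D"
    "\<And>x. x \<in> {s..t} \<Longrightarrow> (\<alpha> has_vector_derivative D x) (at x within {s..t})"
    using assms(1) unfolding c1_on_def by blast
  define g where "g = (\<lambda>x. cdot a (\<alpha> x) - b)"
  define g' where "g' = (\<lambda>x. cdot a (D x))"
  \<comment> \<open>The squared modulus \<open>N\<close> is differentiable wherever \<open>g\<close> is; \<open>L\<close> is \<open>ln (R / \<bar>g\<bar>)\<close> in terms of it.\<close>
  define N where "N = (\<lambda>x. (Re (g x))\<^sup>2 + (Im (g x))\<^sup>2)"
  define L where "L = (\<lambda>x. ln R - ln (N x) / 2)"
  define v where "v = (\<lambda>x. - (Re (g x) * Re (g' x) + Im (g x) * Im (g' x)) / (2 * N x * L x))"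
  have G: "\<alpha> x \<in> G" if "x \<in> {s..t}" for x using assms(2) that by blast
  have Rpos: "R > 0" using bounded[OF G, of s] st norm_ge_zero[of "cdot a (\<alpha> s) - b"] by (simp del: norm_ge_zero)
  have gnz: "g x \<noteq> 0" and gR: "cmod (g x) < R" if "x \<in> {s..t}" for x
    using omits[OF G[OF that]] bounded[OF G[OF that]] by (auto simp: g_def)
  have N: "N x = (cmod (g x))\<^sup>2" for x by (simp add: N_def cmod_power2)
  have Npos: "N x > 0" if "x \<in> {s..t}" for x using gnz[OF that] by (simp add: N)
  have Leq: "L x = ln (R / cmod (g x))" if "x \<in> {s..t}" for x
    using gnz[OF that] Rpos by (simp add: L_def N ln_div ln_realpow)
  have Lpos: "L x > 0" if "x \<in> {s..t}" for x
    unfolding Leq[OF that] using gnz[OF that] gR[OF that] by (intro ln_gt_zero) (simp add: less_divide_eq)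
  have hgt: "cusp_height R a b (\<alpha> x) = ln (L x) / 2" if "x \<in> {s..t}" for x
    unfolding cusp_height_def Leq[OF that] g_def ..
  have contg: "continuous_on {s..t} g" unfolding g_def
    by (intro continuous_intros pc1_on_imp_continuous_on[OF pc1_on.piece[OF assms(1)]])
  have contg': "continuous_on {s..t} g'" unfolding g'_def by (intro continuous_intros D)
  have contN: "continuous_on {s..t} N" unfolding N_def by (intro continuous_intros contg)
  have contL: "continuous_on {s..t} L" unfolding L_def
    using Npos by (intro continuous_intros contN) (auto simp: less_imp_neq[THEN not_sym])
  have "continuous_on {s..t} v" unfolding v_def
    using Npos Lpos by (intro continuous_intros contg contg' contN contL) (force simp: less_le)
  moreover have "((\<lambda>x. ln (L x) / 2) has_real_derivative v x) (at x within {s..t})" if x: "x \<in> {s..t}" for x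
  proof -
    have gd: "(g has_vector_derivative g' x) (at x within {s..t})"
      unfolding g_def g'_def using bounded_linear.has_vector_derivative[OF bounded_linear_cdot D(2)[OF x]]
      by (auto intro!: derivative_eq_intros)
    have re: "((\<lambda>x. Re (g x)) has_real_derivative Re (g' x)) (at x within {s..t})"
      unfolding has_real_derivative_iff_has_vector_derivative
      by (rule bounded_linear.has_vector_derivative[OF bounded_linear_Re gd])
    have im: "((\<lambda>x. Im (g x)) has_real_derivative Im (g' x)) (at x within {s..t})"
      unfolding has_real_derivative_iff_has_vector_derivative
      by (rule bounded_linear.has_vector_derivative[OF bounded_linear_Im gd])
    have Nd: "(N has_real_derivative 2 * (Re (g x) * Re (g' x) + Im (g x) * Im (g' x))) (at x within {s..t})"
      unfolding N_def using DERIV_add[OF DERIV_power[OF re, of 2] DERIV_power[OF im, of 2]]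
      by (simp add: algebra_simps)
    have Ld: "(L has_real_derivative - (Re (g x) * Re (g' x) + Im (g x) * Im (g' x)) / N x) (at x within {s..t})"
      unfolding L_def using Npos[OF x] by (auto intro!: derivative_eq_intros Nd simp: field_simps)
    show ?thesis
      unfolding v_def using Lpos[OF x] Npos[OF x] by (auto intro!: derivative_eq_intros Ld simp: field_simps)
  qed
  moreover have "ennreal (v x) \<le> kob_speed G \<alpha> x" if x: "x \<in> {s<..<t}" for x
  proof -
    have x': "x \<in> {s..t}" using x by auto
    have "at x within {s..t} = at x" using x by (intro at_within_Icc_at) auto
    then have vd: "vector_derivative \<alpha> (at x) = D x" using D(2)[OF x'] by (auto intro: vector_derivative_at)
    have "\<bar>Re (g x) * Re (g' x) + Im (g x) * Im (g' x)\<bar> \<le> cmod (g x) * cmod (g' x)"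
      using Cauchy_Schwarz_ineq2[of "g x" "g' x"] by (simp add: inner_complex_def)
    also have "\<dots> \<le> cmod (g x) * (kobayashi_metric G (\<alpha> x) (D x) * (2 * cmod (g x) * L x))"
      unfolding Leq[OF x'] g_def g'_def using omits bounded
      by (intro mult_left_mono kobayashi_metric_ge_functional open_G G x') auto
    also have "\<dots> = kobayashi_metric G (\<alpha> x) (D x) * (2 * N x * L x)"
      by (simp add: N power2_eq_square)
    finally have "v x \<le> kobayashi_metric G (\<alpha> x) (D x)"
      unfolding v_def using Npos[OF x'] Lpos[OF x'] by (simp add: divide_le_eq)
    then show ?thesis unfolding kob_speed_def vd by (rule ennreal_leI)
  qed
  ultimately have "ennreal (ln (L t) / 2 - ln (L s) / 2) \<le> kob_length G s t \<alpha>"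
    unfolding kob_length_def by (rule increment_le_nn_integral[OF st])
  moreover have "s \<in> {s..t}" "t \<in> {s..t}" using st by auto
  ultimately show ?thesis by (simp only: hgt)
qed

lemma length_ge_height:
  assumes "pc1_on s t \<alpha>" "\<alpha> ` {s..t} \<subseteq> G"
  shows "ennreal (cusp_height R a b (\<alpha> t) - cusp_height R a b (\<alpha> s)) \<le> kob_length G s t \<alpha>"
  using assms
proof (induction rule: pc1_on.induct)
  case (piece s t \<alpha>) then show ?case by (rule length_ge_height_piece)
next
  case (append s t \<alpha> u)
  have st: "s < t" and tu: "t < u" using append.hyps pc1_on_less by (auto simp: c1_on_def)
  have sub: "\<alpha> ` {s..t} \<subseteq> G" "\<alpha> ` {t..u} \<subseteq> G" using append.prems st tu by (auto simp: image_subset_iff)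
  let ?h = "\<lambda>x. cusp_height R a b (\<alpha> x)"
  have "ennreal (?h u - ?h s) = ennreal ((?h t - ?h s) + (?h u - ?h t))" by simp
  also have "\<dots> \<le> ennreal (?h t - ?h s) + ennreal (?h u - ?h t)"
    by (rule ennreal_add_le)
  also have "\<dots> \<le> kob_length G s t \<alpha> + kob_length G t u \<alpha>"
    by (intro add_mono append.IH sub length_ge_height_piece append.hyps)
  also have "\<dots> = kob_length G s u \<alpha>" using st tu by (intro kob_length_split[symmetric]) auto
  finally show ?case .
qed

lemma edist_ge_height: "ennreal (cusp_height R a b q - cusp_height R a b p) \<le> kob_edist G p q"
  unfolding kob_edist_def by (rule INF_greatest) (use length_ge_height in auto)

end

section \<open>Closed balls and geodesics\<close>

locale kobayashi_domain =
  fixes G :: "(complex ^ 'n) set"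
  assumes open_G: "open G" and connected_G: "connected G"
begin

abbreviation "d \<equiv> kobayashi_dist G"

lemma ennreal_dist: "p \<in> G \<Longrightarrow> q \<in> G \<Longrightarrow> ennreal (d p q) = kob_edist G p q"
  unfolding kobayashi_dist_alt using kob_edist_finite[OF open_G connected_G] by simp

lemma dist_nonneg: "0 \<le> d p q" by (simp add: kobayashi_dist_alt)

lemma dist_sym: "d p q = d q p"
  unfolding kobayashi_dist_alt using kob_edist_sym[OF open_G] by metis

lemma dist_tri: "p \<in> G \<Longrightarrow> q \<in> G \<Longrightarrow> r \<in> G \<Longrightarrow> d p r \<le> d p q + d q r"
  using kob_edist_triangle[OF open_G, of p r q]
  by (simp add: ennreal_dist[symmetric] dist_nonneg flip: ennreal_plus)

lemma dist_segment:
  assumes "ball z r \<subseteq> G" "r > 0" "norm (w - z) \<le> r / 2" shows "d z w \<le> 2 * norm (w - z) / r"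
  using kob_edist_segment[OF open_G assms] assms(2) unfolding kobayashi_dist_alt
  by (simp add: enn2real_leI)

lemma dist_refl: "z \<in> G \<Longrightarrow> d z z = 0"
proof -
  assume "z \<in> G"
  then obtain r where "r > 0" "ball z r \<subseteq> G" using open_G open_contains_ball by blast
  then show ?thesis using dist_segment[of z r z] dist_nonneg[of z z] by simp
qed

lemma dist_le_length:
  assumes "pc1_on s t \<alpha>" "\<alpha> ` {s..t} \<subseteq> G" shows "ennreal (d (\<alpha> s) (\<alpha> t)) \<le> kob_length G s t \<alpha>"
proof -
  have "\<alpha> s \<in> G" "\<alpha> t \<in> G" using pc1_on_less[OF assms(1)] assms(2) by (auto simp: image_subset_iff)
  then show ?thesis using kob_edist_le_length[OF open_G assms] by (simp add: ennreal_dist)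
qed

lemma dist_le_of_speed:
  assumes "pc1_on s t \<alpha>" "\<alpha> ` {s..t} \<subseteq> G" "0 \<le> H"
    "\<And>x. x \<in> {s<..<t} \<Longrightarrow> kobayashi_metric G (\<alpha> x) (vector_derivative \<alpha> (at x)) \<le> H"
  shows "d (\<alpha> s) (\<alpha> t) \<le> H * (t - s)"
proof -
  have st: "s < t" using pc1_on_less assms(1) by blast
  have "ennreal (d (\<alpha> s) (\<alpha> t)) \<le> ennreal (H * (t - s))"
    using dist_le_length[OF assms(1,2)] kob_length_le[of s t H G \<alpha>] st assms(3,4) by (meson less_imp_le order_trans)
  then show ?thesis using assms(3) st by (subst (asm) ennreal_le_iff) auto
qed

lemma continuous_on_dist: "continuous_on (G \<times> G) (\<lambda>p. d (fst p) (snd p))"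
  unfolding continuous_on_iff
proof (intro ballI allI impI)
  fix p and e :: real assume p: "p \<in> G \<times> G" and e: "e > 0"
  obtain z w where pzw: "p = (z, w)" "z \<in> G" "w \<in> G" using p by auto
  obtain r1 where r1: "r1 > 0" "ball z r1 \<subseteq> G" using open_G pzw open_contains_ball by blast
  obtain r2 where r2: "r2 > 0" "ball w r2 \<subseteq> G" using open_G pzw open_contains_ball by blast
  define r where "r = min r1 r2"
  have r: "r > 0" "ball z r \<subseteq> G" "ball w r \<subseteq> G" using r1 r2 by (auto simp: r_def subset_iff)
  define \<delta> where "\<delta> = min (r / 2) (e * r / 8)"
  have \<delta>: "\<delta> > 0" "\<delta> \<le> r / 2" "\<delta> \<le> e * r / 8" using r e by (auto simp: \<delta>_def)
  have small: "d x x' \<le> e / 4" if "ball x r \<subseteq> G" "dist x' x < \<delta>" for x x'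
  proof -
    have "norm (x' - x) \<le> r / 2" using that \<delta> by (simp add: dist_norm)
    then have "d x x' \<le> 2 * norm (x' - x) / r" using that r by (intro dist_segment) auto
    also have "\<dots> \<le> 2 * (e * r / 8) / r" using that \<delta> r by (intro divide_right_mono) (auto simp: dist_norm)
    also have "\<dots> = e / 4" using r by simp
    finally show ?thesis .
  qed
  show "\<exists>\<delta>>0. \<forall>p'\<in>G \<times> G. dist p' p < \<delta> \<longrightarrow> dist (d (fst p') (snd p')) (d (fst p) (snd p)) < e"
  proof (intro exI[of _ \<delta>] conjI ballI impI \<delta>)
    fix p' assume p': "p' \<in> G \<times> G" "dist p' p < \<delta>"
    obtain z' w' where zw': "p' = (z', w')" "z' \<in> G" "w' \<in> G" using p' by auto
    have "dist z' z < \<delta>" "dist w' w < \<delta>"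
      using p'(2) dist_fst_le[of p' p] dist_snd_le[of p' p] by (auto simp: zw' pzw)
    then have s: "d z z' \<le> e / 4" "d w w' \<le> e / 4" using small r by auto
    have "d z' w' \<le> d z' z + (d z w + d w w')" "d z w \<le> d z z' + (d z' w' + d w' w)"
      using dist_tri pzw zw' by (meson add_left_mono order_trans)+
    then show "dist (d (fst p') (snd p')) (d (fst p) (snd p)) < e"
      using s e dist_sym[of z' z] dist_sym[of w' w] by (simp add: dist_real_def zw' pzw abs_less_iff)
  qed
qed

end

lemma functional_bounded_on:
  assumes "bounded \<Omega>" shows "\<exists>R>0. \<forall>z\<in>\<Omega>. cmod (cdot a z - b) < R"
proof -
  have "bounded ((\<lambda>z. cdot a z) ` \<Omega>)"
    by (rule bounded_linear_image[OF assms bounded_linear_cdot])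
  then obtain B where B: "\<And>z. z \<in> \<Omega> \<Longrightarrow> cmod (cdot a z) \<le> B" unfolding bounded_iff by auto
  have "cmod (cdot a z - b) < \<bar>B\<bar> + cmod b + 1" if "z \<in> \<Omega>" for z
    using B[OF that] norm_triangle_ineq4[of "cdot a z" b] by linarith
  then show ?thesis by (intro exI[of _ "\<bar>B\<bar> + cmod b + 1"]) (simp add: add_nonneg_pos)
qed

context omitting_functional
begin

text \<open>A point of the omitted hyperplane is infinitely far away.\<close>

lemma height_tendsto_infinity:
  assumes "(f \<longlongrightarrow> p) F" "cdot a p = b" "\<forall>\<^sub>F x in F. f x \<in> G" "R > 0"
  shows "filterlim (\<lambda>x. cusp_height R a b (f x)) at_top F"
proof -
  have "((\<lambda>x. cdot a (f x) - b) \<longlongrightarrow> cdot a p - b) F"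
    by (intro tendsto_diff tendsto_const bounded_linear.tendsto[OF bounded_linear_cdot] assms)
  then have "((\<lambda>x. cmod (cdot a (f x) - b)) \<longlongrightarrow> 0) F"
    using assms(2) tendsto_norm by fastforce
  moreover have "\<forall>\<^sub>F x in F. cmod (cdot a (f x) - b) > 0"
    using assms(3) by eventually_elim (use omits in auto)
  ultimately have "filterlim (\<lambda>x. cmod (cdot a (f x) - b)) (at_right 0) F"
    by (simp add: filterlim_at_right_to_0 filterlim_at)
  then have "filterlim (\<lambda>x. inverse (cmod (cdot a (f x) - b))) at_top F"
    by (rule filterlim_compose[OF filterlim_inverse_at_top_right])
  then have "filterlim (\<lambda>x. R * inverse (cmod (cdot a (f x) - b))) at_top F"
    using assms(4) by (rule filterlim_tendsto_pos_mult_at_top[OF tendsto_const, rotated])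
  then have "filterlim (\<lambda>x. ln (ln (R * inverse (cmod (cdot a (f x) - b))))) at_top F"
    by (intro filterlim_compose[OF ln_at_top])
  then have "filterlim (\<lambda>x. (1 / 2) * ln (ln (R * inverse (cmod (cdot a (f x) - b))))) at_top F"
    by (intro filterlim_tendsto_pos_mult_at_top[OF tendsto_const]) auto
  moreover have "cusp_height R a b z = (1 / 2) * ln (ln (R * inverse (cmod (cdot a z - b))))" for z
    unfolding cusp_height_def by (simp only: divide_inverse mult.commute[of _ "inverse 2"] mult_1)
  ultimately show ?thesis by (simp only:)
qed

lemma isCont_cusp_height: assumes "z \<in> G" shows "isCont (cusp_height R a b) z"
proof -
  have 0: "0 < cmod (cdot a z - b)" using omits[OF assms] by simp
  with bounded[OF assms] have 1: "1 < R / cmod (cdot a z - b)" by (simp add: less_divide_eq)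
  then have "0 < R / cmod (cdot a z - b)" "0 < ln (R / cmod (cdot a z - b))"
    by (linarith, rule ln_gt_zero)
  with 0 show ?thesis unfolding cusp_height_def
    by (intro continuous_intros) (simp_all only: less_irrefl norm_eq_zero not_False_eq_True, auto)
qed

end

text \<open>The condition \<open>omitted\<close> is linear convexity; for a bounded domain it makes the Kobayashi distance
complete.\<close>

locale complete_kobayashi_domain = kobayashi_domain G for G :: "(complex ^ 'n) set" +
  assumes bounded_G: "bounded G"
    and omitted: "\<And>p. p \<notin> G \<Longrightarrow> \<exists>a. \<forall>z\<in>G. cdot a (z - p) \<noteq> 0"
begin

lemma dist_ge_height:
  assumes "omitting_functional G a b R" "p \<in> G" "q \<in> G"
  shows "\<bar>cusp_height R a b q - cusp_height R a b p\<bar> \<le> d p q"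
proof -
  have 1: "cusp_height R a b q - cusp_height R a b p \<le> d p q" if "p \<in> G" "q \<in> G" for p q
    using omitting_functional.edist_ge_height[OF assms(1), of q p] that
    by (simp add: ennreal_dist[symmetric] dist_nonneg)
  show ?thesis using 1[OF assms(2,3)] 1[OF assms(3,2)] dist_sym[of p q] by linarith
qed

text \<open>A limit of points of the ball cannot lie outside \<open>G\<close>, since the height with respect to a
hyperplane through it that avoids \<open>G\<close> would be unbounded on the ball.\<close>

lemma compact_dist_ball:
  assumes x: "x \<in> G" shows "compact {z \<in> G. d x z \<le> D}"
  unfolding compact_eq_bounded_closed
proof
  show "bounded {z \<in> G. d x z \<le> D}" by (rule bounded_subset[OF bounded_G]) auto
  show "closed {z \<in> G. d x z \<le> D}" unfolding closed_sequential_limits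
  proof (intro allI impI, elim conjE)
    fix f p assume f: "\<forall>n. f n \<in> {z \<in> G. d x z \<le> D}" and lim: "f \<longlonglongrightarrow> p"
    have pG: "p \<in> G"
    proof (rule ccontr)
      assume "p \<notin> G"
      then obtain a where a: "\<And>z. z \<in> G \<Longrightarrow> cdot a (z - p) \<noteq> 0" using omitted by blast
      obtain R where R: "R > 0" "\<And>z. z \<in> G \<Longrightarrow> cmod (cdot a z - cdot a p) < R"
        using functional_bounded_on[OF bounded_G, of a "cdot a p"] by blast
      have om: "omitting_functional G a (cdot a p) R"
        by unfold_locales (use open_G a R in \<open>auto simp: cdot_diff\<close>)
      have "filterlim (\<lambda>n. cusp_height R a (cdot a p) (f n)) at_top sequentially"
        by (rule omitting_functional.height_tendsto_infinity[OF om lim]) (use f R in auto)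
      then have "\<forall>\<^sub>F n in sequentially. cusp_height R a (cdot a p) (f n) > D + cusp_height R a (cdot a p) x"
        by (simp add: filterlim_at_top_dense)
      then obtain n where "cusp_height R a (cdot a p) (f n) > D + cusp_height R a (cdot a p) x"
        using eventually_happens'[OF sequentially_bot] by blast
      moreover have "f n \<in> G" "d x (f n) \<le> D" using f by auto
      ultimately show False using dist_ge_height[OF om x \<open>f n \<in> G\<close>] by linarith
    qed
    have "(\<lambda>n. d (fst (x, f n)) (snd (x, f n))) \<longlonglongrightarrow> d (fst (x, p)) (snd (x, p))"
      by (rule continuous_on_tendsto_compose[OF continuous_on_dist])
         (use f x pG lim in \<open>auto intro!: tendsto_intros\<close>)
    then have "d x p \<le> D" using f by (intro LIMSEQ_le_const2[of "\<lambda>n. d x (f n)"]) auto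
    then show "p \<in> {z \<in> G. d x z \<le> D}" using pG by simp
  qed
qed

text \<open>On a curve of length less than \<open>d x y + e\<close> stop, for each \<open>s\<close>, at the first point at distance \<open>s\<close>
from \<open>x\<close>. These points occur in increasing order along the curve. Since the curve exceeds the
distance of its end points by less than \<open>e\<close>, so does each of its arcs. The map is not continuous
in general.\<close>

lemma almost_geodesic:
  assumes x: "x \<in> G" and y: "y \<in> G" and D: "D = d x y" "D > 0" and e: "e > 0"
  shows "\<exists>\<phi>. \<phi> 0 = x \<and> \<phi> D = y \<and> (\<forall>s. \<phi> s \<in> G \<and> d x (\<phi> s) \<le> D) \<and>
     (\<forall>s\<in>{0..D}. \<forall>t\<in>{0..D}. \<bar>d (\<phi> s) (\<phi> t) - \<bar>s - t\<bar>\<bar> \<le> e)"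
proof -
  obtain \<alpha> where \<alpha>: "pc1_on 0 1 \<alpha>" "\<alpha> ` {0..1} \<subseteq> G" "\<alpha> 0 = x" "\<alpha> 1 = y"
    "kob_length G 0 1 \<alpha> < kob_edist G x y + ennreal e"
    by (rule kob_edist_approx[OF kob_edist_finite[OF open_G connected_G x y] e])
  have aG: "\<alpha> u \<in> G" if "u \<in> {0..1}" for u using \<alpha>(2) that by blast
  define r where "r = (\<lambda>u. d x (\<alpha> u))"
  have r01: "r 0 = 0" "r 1 = D" using \<alpha> D dist_refl[OF x] by (auto simp: r_def)
  have "continuous_on {0..1} (\<lambda>u. d (fst (x, \<alpha> u)) (snd (x, \<alpha> u)))"
    by (rule continuous_on_compose2[OF continuous_on_dist])
       (use aG x in \<open>auto intro!: continuous_intros pc1_on_imp_continuous_on[OF \<alpha>(1)]\<close>)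
  then have rc: "continuous_on {0..1} r" by (simp add: r_def)
  \<comment> \<open>The first parameter at which the distance \<open>D\<close> is reached need not be the end of the curve, but
  the limit has to end at \<open>y\<close>.\<close>
  define \<tau> where "\<tau> = (\<lambda>s. if s = D then 1 else Inf {u \<in> {0..1}. r u = s})"
  have first: "Inf {u \<in> {0..1}. r u = s} \<in> {u \<in> {0..1}. r u = s}" if s: "s \<in> {0..D}" for s
  proof (rule closed_contains_Inf)
    show "{u \<in> {0..1}. r u = s} \<noteq> {}"
      using IVT'[of r 0 s 1] s r01 rc by auto
    show "bdd_below {u \<in> {0..1}. r u = s}" by (rule bdd_belowI[of _ 0]) auto
    show "closed {u \<in> {0..1}. r u = s}"
      using continuous_closed_preimage_constant[OF rc, of s] by simp
  qed
  have \<tau>: "\<tau> s \<in> {0..1}" "r (\<tau> s) = s" if "s \<in> {0..D}" for s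
    using first[OF that] r01 by (auto simp: \<tau>_def)
  have \<tau>0: "\<tau> 0 = 0"
  proof -
    have "Inf {u \<in> {0..1}. r u = 0} \<le> 0" by (rule cInf_lower) (auto simp: r01 intro!: bdd_belowI[of _ 0])
    then show ?thesis using first[of 0] D by (auto simp: \<tau>_def)
  qed
  have mono: "\<tau> s \<le> \<tau> t" if st: "s \<in> {0..D}" "t \<in> {0..D}" "s \<le> t" for s t
  proof (cases "t = D")
    case True then show ?thesis using \<tau>(1)[OF st(1)] by (simp add: \<tau>_def)
  next
    case False
    then have sD: "s \<noteq> D" using st by auto
    have "continuous_on {0..\<tau> t} r" using \<tau>(1)[OF st(2)] by (intro continuous_on_subset[OF rc]) auto
    then obtain u where u: "0 \<le> u" "u \<le> \<tau> t" "r u = s"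
      using IVT'[of r 0 s "\<tau> t"] r01 \<tau>[OF st(2)] st by auto
    then have "Inf {u \<in> {0..1}. r u = s} \<le> u" using \<tau>(1)[OF st(2)]
      by (intro cInf_lower bdd_belowI[of _ 0]) auto
    then show ?thesis using sD u by (simp add: \<tau>_def)
  qed
  have len: "ennreal (d (\<alpha> u) (\<alpha> v)) \<le> kob_length G u v \<alpha>" if "0 \<le> u" "u \<le> v" "v \<le> 1" for u v
  proof (cases "u = v")
    case True then show ?thesis using dist_refl aG that by simp
  next
    case False
    then show ?thesis using that \<alpha>(2)
      by (intro dist_le_length pc1_on_subset[OF \<alpha>(1)]) (auto simp: image_subset_iff)
  qed
  have main: "\<bar>d (\<alpha> (\<tau> s)) (\<alpha> (\<tau> t)) - (t - s)\<bar> \<le> e" if st: "s \<in> {0..D}" "t \<in> {0..D}" "s \<le> t" for s t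
  proof -
    let ?u = "\<tau> s" and ?v = "\<tau> t"
    have uv: "0 \<le> ?u" "?u \<le> ?v" "?v \<le> 1" using \<tau>(1) mono st by auto
    have G: "\<alpha> ?u \<in> G" "\<alpha> ?v \<in> G" using aG uv by auto
    have rs: "d x (\<alpha> ?u) = s" "d x (\<alpha> ?v) = t" using \<tau>(2) st by (auto simp: r_def)
    have "ennreal (d x (\<alpha> ?u)) + (ennreal (d (\<alpha> ?u) (\<alpha> ?v)) + ennreal (d (\<alpha> ?v) y))
        \<le> kob_length G 0 ?u \<alpha> + (kob_length G ?u ?v \<alpha> + kob_length G ?v 1 \<alpha>)"
      using len[of 0 ?u] len[of ?u ?v] len[of ?v 1] uv \<alpha>(3,4) by (intro add_mono) auto
    also have "\<dots> = kob_length G 0 1 \<alpha>"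
      using kob_length_split[of 0 ?u 1 G \<alpha>] kob_length_split[of ?u ?v 1 G \<alpha>] uv by simp
    also have "\<dots> \<le> ennreal (D + e)"
      using \<alpha>(5) ennreal_dist[OF x y] D e by (simp add: less_imp_le)
    finally have "ennreal (d x (\<alpha> ?u) + (d (\<alpha> ?u) (\<alpha> ?v) + d (\<alpha> ?v) y)) \<le> ennreal (D + e)"
      by (simp add: dist_nonneg)
    then have "d x (\<alpha> ?u) + (d (\<alpha> ?u) (\<alpha> ?v) + d (\<alpha> ?v) y) \<le> D + e"
      using D e by (subst (asm) ennreal_le_iff) auto
    moreover have "D \<le> d x (\<alpha> ?v) + d (\<alpha> ?v) y" using dist_tri[OF x G(2) y] D by simp
    moreover have "d x (\<alpha> ?v) \<le> d x (\<alpha> ?u) + d (\<alpha> ?u) (\<alpha> ?v)" by (rule dist_tri[OF x G])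
    ultimately show ?thesis using rs by simp
  qed
  define \<phi> where "\<phi> = (\<lambda>s. if s \<in> {0..D} then \<alpha> (\<tau> s) else x)"
  have "\<bar>d (\<phi> s) (\<phi> t) - \<bar>s - t\<bar>\<bar> \<le> e" if st: "s \<in> {0..D}" "t \<in> {0..D}" for s t
  proof (cases "s \<le> t")
    case True then show ?thesis using main[OF st True] st by (simp add: \<phi>_def)
  next
    case False
    then show ?thesis using main[OF st(2,1)] st dist_sym[of "\<alpha> (\<tau> s)"] by (simp add: \<phi>_def)
  qed
  moreover have "\<phi> 0 = x" "\<phi> D = y" using D \<tau>0 \<alpha>(3,4) by (auto simp: \<phi>_def \<tau>_def)
  moreover have "\<phi> s \<in> G \<and> d x (\<phi> s) \<le> D" for s
    using \<tau>[of s] aG[of "\<tau> s"] x D dist_refl[OF x] by (auto simp: \<phi>_def r_def)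
  ultimately show ?thesis by blast
qed

text \<open>A limit of almost geodesics is a geodesic. The maps with error at most \<open>1 / (n + 1)\<close> form a
decreasing sequence of non-empty closed sets in the product of copies of a closed ball, indexed by
all real parameters, and this product is compact by the theorem of Tychonoff.\<close>

lemma ex_geodesic:
  assumes x: "x \<in> G" and y: "y \<in> G" and pos: "d x y > 0"
  shows "\<exists>\<phi>. geodesic G d 0 (d x y) \<phi> \<and> \<phi> 0 = x \<and> \<phi> (d x y) = y"
proof -
  define D where "D = d x y"
  define K where "K = {z \<in> G. d x z \<le> D}"
  have K: "compact K" unfolding K_def by (rule compact_dist_ball[OF x])
  define Q where "Q = (\<lambda>(n::nat) l. {p \<in> K \<times> K. \<bar>d (fst p) (snd p) - l\<bar> \<le> 1 / (real n + 1)})"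
  have Q: "closed (Q n l)" for n l
  proof -
    have "continuous_on (K \<times> K) (\<lambda>p. \<bar>d (fst p) (snd p) - l\<bar>)"
      by (intro continuous_intros continuous_on_subset[OF continuous_on_dist]) (auto simp: K_def)
    moreover have "closed (K \<times> K)" using K by (intro closed_Times compact_imp_closed)
    ultimately have "closed ((K \<times> K) \<inter> (\<lambda>p. \<bar>d (fst p) (snd p) - l\<bar>) -` {..1 / (real n + 1)})"
      by (intro continuous_closed_preimage) auto
    also have "(K \<times> K) \<inter> (\<lambda>p. \<bar>d (fst p) (snd p) - l\<bar>) -` {..1 / (real n + 1)} = Q n l"
      by (auto simp: Q_def)
    finally show ?thesis .
  qed
  define C where "C = (\<lambda>n. {\<phi>. \<phi> 0 = x \<and> \<phi> D = y} \<inter>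
      (\<Inter>s\<in>{0..D}. \<Inter>t\<in>{0..D}. {\<phi> :: real \<Rightarrow> complex ^ 'n. (\<phi> s, \<phi> t) \<in> Q n \<bar>s - t\<bar>}))"
  have coord: "continuous_on UNIV (\<lambda>\<phi> :: real \<Rightarrow> complex ^ 'n. \<phi> s)" for s
    by (rule continuous_on_product_coordinates)
  have Ccl: "closed (C n)" for n
  proof -
    have "closed {\<phi> :: real \<Rightarrow> complex ^ 'n. \<phi> s = z}" for s z
      by (intro closed_Collect_eq coord continuous_intros)
    moreover have "closed {\<phi> :: real \<Rightarrow> complex ^ 'n. (\<phi> s, \<phi> t) \<in> Q n l}" for s t l
      using closed_vimage[OF Q continuous_on_Pair[OF coord[of s] coord[of t]]]
      by (simp add: vimage_def)
    ultimately show ?thesis unfolding C_def Collect_conj_eq by (intro closed_Int closed_INT ballI)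
  qed
  have "compactin (product_topology (\<lambda>_. euclidean) UNIV) (PiE UNIV (\<lambda>_::real. K))"
    using K by (simp add: compactin_PiE compactin_euclidean_iff)
  then have cpt: "compact (PiE UNIV (\<lambda>_::real. K))"
    by (simp add: euclidean_product_topology)
  have ne: "PiE UNIV (\<lambda>_. K) \<inter> (\<Inter>n\<in>I. C n) \<noteq> {}" if I: "finite I" for I
  proof -
    define m where "m = Max (insert 0 I)"
    have m: "n \<le> m" if "n \<in> I" for n using I that by (simp add: m_def)
    obtain \<phi> where \<phi>: "\<phi> 0 = x" "\<phi> D = y" "\<And>s. \<phi> s \<in> K"
      "\<And>s t. s \<in> {0..D} \<Longrightarrow> t \<in> {0..D} \<Longrightarrow> \<bar>d (\<phi> s) (\<phi> t) - \<bar>s - t\<bar>\<bar> \<le> 1 / (real m + 1)"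
      using almost_geodesic[OF x y D_def, of "1 / (real m + 1)"] pos unfolding D_def[symmetric] K_def by fastforce
    have "\<phi> \<in> C n" if n: "n \<in> I" for n
    proof -
      have "1 / (real m + 1) \<le> 1 / (real n + 1)" using m[OF n] by (simp add: frac_le)
      then have "\<bar>d (\<phi> s) (\<phi> t) - \<bar>s - t\<bar>\<bar> \<le> 1 / (real n + 1)" if "s \<in> {0..D}" "t \<in> {0..D}" for s t
        using \<phi>(4)[OF that] by linarith
      then show ?thesis using \<phi>(1-3) unfolding C_def Q_def by auto
    qed
    then have "\<phi> \<in> PiE UNIV (\<lambda>_. K) \<inter> (\<Inter>n\<in>I. C n)" using \<phi>(3) by auto
    then show ?thesis by blast
  qed
  have "PiE UNIV (\<lambda>_. K) \<inter> (\<Inter>n\<in>UNIV. C n) \<noteq> {}"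
    by (rule compact_imp_fip_image[OF cpt Ccl ne])
  then obtain \<phi> where \<phi>: "\<And>n. \<phi> \<in> C n" by blast
  have 0: "\<phi> 0 = x" "\<phi> D = y" using \<phi>[of 0] by (auto simp: C_def)
  have in_Q: "(\<phi> s, \<phi> t) \<in> Q n \<bar>s - t\<bar>" if "s \<in> {0..D}" "t \<in> {0..D}" for s t n
    using \<phi>[of n] that by (auto simp: C_def)
  have "d (\<phi> s) (\<phi> t) = \<bar>s - t\<bar>" if st: "s \<in> {0..D}" "t \<in> {0..D}" for s t
  proof -
    have "\<bar>d (\<phi> s) (\<phi> t) - \<bar>s - t\<bar>\<bar> \<le> 1 / (real n + 1)" for n using in_Q[OF st, of n] by (simp add: Q_def)
    moreover have "(\<lambda>n. 1 / (real n + 1)) \<longlonglongrightarrow> 0"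
      using LIMSEQ_inverse_real_of_nat by (simp add: inverse_eq_divide add.commute)
    ultimately have "\<bar>d (\<phi> s) (\<phi> t) - \<bar>s - t\<bar>\<bar> \<le> 0"
      by (intro LIMSEQ_le_const[of "\<lambda>n. 1 / (real n + 1)"]) auto
    then show ?thesis by simp
  qed
  moreover have "\<phi> ` {0..D} \<subseteq> G" using in_Q by (force simp: Q_def K_def)
  ultimately have "geodesic G d 0 D \<phi>" using pos unfolding geodesic_def D_def by auto
  then show ?thesis using 0 unfolding D_def by blast
qed

end

section \<open>Almost midpoints and thin triangles\<close>

context complete_kobayashi_domain
begin

lemma ex_geodesic_segment:
  assumes "x \<in> G" "y \<in> G" "d x y > 0"
  shows "\<exists>\<phi>. geodesic G d 0 (d x y) \<phi> \<and> \<phi> 0 = x \<and> \<phi> (d x y) = y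
    \<and> geodesic_segment G d x y (\<phi> ` {0..d x y})"
  using ex_geodesic[OF assms] unfolding geodesic_segment_def by blast

text \<open>In a thin triangle with vertices \<open>x\<close>, \<open>y\<close>, \<open>z\<close> the midpoint of the side from \<open>x\<close> to \<open>y\<close> is close
to a point \<open>q\<close> on, say, the side from \<open>z\<close> to \<open>x\<close>. Then \<open>q\<close> is almost as far from \<open>x\<close> as the
midpoint, hence almost as far as \<open>z\<close>, and so \<open>q\<close> is close to \<open>z\<close>.\<close>

lemma midpoint_near_almost_midpoint:
  assumes thin: "\<And>A B C. geodesic_triangle G d A B C \<Longrightarrow> thin_triangle d M A B C"
    and G: "x \<in> G" "y \<in> G" "z \<in> G"
    and \<gamma>: "geodesic G d 0 (d x y) \<gamma>" "\<gamma> 0 = x" "\<gamma> (d x y) = y"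
    and H: "1 < H" "d x z \<le> H" "d z y \<le> H" "2 * H - 1 \<le> d x y"
  shows "d (\<gamma> (d x y / 2)) z \<le> 2 * M + 1"
proof -
  let ?L = "d x y" and ?m = "\<gamma> (d x y / 2)"
  have tri: "d x y \<le> d x z + d z y" by (rule dist_tri[OF G(1,3,2)])
  have pos: "d y z > 0" "d z x > 0" "?L > 0" using tri H dist_sym[of y z] dist_sym[of z x] by auto
  obtain \<beta> where \<beta>: "geodesic G d 0 (d y z) \<beta>" "\<beta> 0 = y" "\<beta> (d y z) = z"
    "geodesic_segment G d y z (\<beta> ` {0..d y z})"
    using ex_geodesic_segment[OF G(2,3) pos(1)] by blast
  obtain \<delta> where \<delta>: "geodesic G d 0 (d z x) \<delta>" "\<delta> 0 = z" "\<delta> (d z x) = x"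
    "geodesic_segment G d z x (\<delta> ` {0..d z x})"
    using ex_geodesic_segment[OF G(3,1) pos(2)] by blast
  have "geodesic_segment G d x y (\<gamma> ` {0..?L})"
    unfolding geodesic_segment_def using \<gamma> by blast
  then have "geodesic_triangle G d (\<gamma> ` {0..?L}) (\<beta> ` {0..d y z}) (\<delta> ` {0..d z x})"
    unfolding geodesic_triangle_def using \<beta>(4) \<delta>(4) by blast
  from thin[OF this] have t: "\<forall>p\<in>\<gamma> ` {0..?L}. \<exists>q\<in>\<beta> ` {0..d y z} \<union> \<delta> ` {0..d z x}. d p q \<le> M"
    unfolding thin_triangle_def by blast
  have half: "?L / 2 \<in> {0..?L}" using pos by auto
  have end0: "0 \<in> {0..?L}" "?L \<in> {0..?L}" using pos by auto
  have mG: "?m \<in> G" using \<gamma>(1) half unfolding geodesic_def by blast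
  have mx: "d x ?m = ?L / 2" and my: "d ?m y = ?L / 2"
  proof -
    have iso: "d (\<gamma> s) (\<gamma> t) = \<bar>s - t\<bar>" if "s \<in> {0..?L}" "t \<in> {0..?L}" for s t
      using \<gamma>(1) that unfolding geodesic_def by blast
    show "d x ?m = ?L / 2" using iso[OF end0(1) half] \<gamma>(2) pos by simp
    show "d ?m y = ?L / 2" using iso[OF half end0(2)] \<gamma>(3) pos by simp
  qed
  obtain q where q: "q \<in> \<beta> ` {0..d y z} \<union> \<delta> ` {0..d z x}" "d ?m q \<le> M"
    using t half by blast
  then consider s where "s \<in> {0..d y z}" "q = \<beta> s" | s where "s \<in> {0..d z x}" "q = \<delta> s" by blast
  then show ?thesis
  proof cases
    case 1
    have e: "0 \<in> {0..d y z}" "d y z \<in> {0..d y z}" using pos by auto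
    have iso: "d (\<beta> s) (\<beta> t) = \<bar>s - t\<bar>" if "s \<in> {0..d y z}" "t \<in> {0..d y z}" for s t
      using \<beta>(1) that unfolding geodesic_def by blast
    have qG: "q \<in> G" using \<beta>(1) 1 unfolding geodesic_def by blast
    have "d y q = s" "d q z = d y z - s" using iso[OF e(1) 1(1)] iso[OF 1(1) e(2)] 1 \<beta>(2,3) by auto
    moreover have "d ?m y \<le> d ?m q + d q y" "d ?m z \<le> d ?m q + d q z"
      by (intro dist_tri mG qG G)+
    ultimately show ?thesis using my q(2) H dist_sym[of q y] dist_sym[of y z] by linarith
  next
    case 2
    have e: "0 \<in> {0..d z x}" "d z x \<in> {0..d z x}" using pos by auto
    have iso: "d (\<delta> s) (\<delta> t) = \<bar>s - t\<bar>" if "s \<in> {0..d z x}" "t \<in> {0..d z x}" for s t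
      using \<delta>(1) that unfolding geodesic_def by blast
    have qG: "q \<in> G" using \<delta>(1) 2 unfolding geodesic_def by blast
    have "d z q = s" "d q x = d z x - s" using iso[OF e(1) 2(1)] iso[OF 2(1) e(2)] 2 \<delta>(2,3) by auto
    moreover have "d x ?m \<le> d x q + d q ?m" "d ?m z \<le> d ?m q + d q z"
      by (intro dist_tri mG qG G)+
    ultimately show ?thesis using mx q(2) H dist_sym[of q x] dist_sym[of q z] dist_sym[of q ?m] dist_sym[of x z]
      by linarith
  qed
qed

lemma almost_midpoints_close:
  assumes "\<And>A B C. geodesic_triangle G d A B C \<Longrightarrow> thin_triangle d M A B C"
    and "x \<in> G" "y \<in> G" "z \<in> G" "w \<in> G" "1 < H" "2 * H - 1 \<le> d x y"
    and "d x z \<le> H" "d z y \<le> H" "d x w \<le> H" "d w y \<le> H"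
  shows "d z w \<le> 4 * M + 2"
proof -
  have "d x y > 0" using assms by linarith
  then obtain \<gamma> where \<gamma>: "geodesic G d 0 (d x y) \<gamma>" "\<gamma> 0 = x" "\<gamma> (d x y) = y"
    using ex_geodesic assms by blast
  let ?m = "\<gamma> (d x y / 2)"
  have "?m \<in> G" using \<gamma>(1) \<open>d x y > 0\<close> unfolding geodesic_def by (auto simp: image_subset_iff)
  then have "d z w \<le> d z ?m + d ?m w" using assms by (intro dist_tri) auto
  moreover have "d ?m z \<le> 2 * M + 1"
    by (rule midpoint_near_almost_midpoint[OF assms(1-4) \<gamma> assms(6,8,9,7)])
  moreover have "d ?m w \<le> 2 * M + 1"
    by (rule midpoint_near_almost_midpoint[OF assms(1-3,5) \<gamma> assms(6,10,11,7)])
  ultimately show ?thesis using dist_sym[of z ?m] by linarith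
qed

end

section \<open>The cusp along a hyperplane\<close>

text \<open>The modulus at depth \<open>A\<close> in the punctured disc of radius \<open>\<epsilon>\<close>: the inverse function of \<open>ln (ln (\<epsilon> /
r)) / 2\<close>.\<close>

definition cusp_depth :: "real \<Rightarrow> real \<Rightarrow> real" where
  "cusp_depth \<epsilon> A = \<epsilon> * exp (- exp (2 * A))"

lemma cusp_depth_pos: "\<epsilon> > 0 \<Longrightarrow> 0 < cusp_depth \<epsilon> A"
  and cusp_depth_less: "\<epsilon> > 0 \<Longrightarrow> cusp_depth \<epsilon> A < \<epsilon>"
  by (simp_all add: cusp_depth_def)

text \<open>The curve descends from depth \<open>A\<close> to depth \<open>A + H\<close> at constant Poincare speed \<open>H\<close> while it moves
by \<open>k v\<close> horizontally at constant speed. The bound on \<open>k\<close> says that the horizontal motion is not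
faster than \<open>H\<close> either.\<close>

lemma (in kobayashi_domain) dist_cusp_le:
  fixes v e p :: "complex ^ 'n"
  assumes G: "\<And>x c u. x \<in> {0..1} \<Longrightarrow> cmod c < \<epsilon> \<Longrightarrow> 0 < cmod u \<Longrightarrow> cmod u < \<epsilon> \<Longrightarrow>
      p + of_real (k * x) *s v + c *s v + u *s e \<in> G"
    and "\<epsilon> > 0" "H > 0" "\<bar>k\<bar> \<le> H * \<epsilon>"
  shows "d (p + of_real (cusp_depth \<epsilon> A) *s e) (p + of_real k *s v + of_real (cusp_depth \<epsilon> (A + H)) *s e) \<le> H"
proof -
  define T where "T = (\<lambda>x. cusp_depth \<epsilon> (A + H * x))"
  define l where "l = (\<lambda>x. exp (2 * (A + H * x)))"
  have T: "T x = \<epsilon> * exp (- l x)" "0 < T x" "T x < \<epsilon>" for x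
    using assms(2) by (simp_all add: T_def l_def cusp_depth_def)
  define \<gamma> where "\<gamma> = (\<lambda>x. p + of_real (k * x) *s v + of_real (T x) *s e)"
  define D where "D = (\<lambda>x. of_real k *s v + of_real (- 2 * H * l x * T x) *s e)"
  have Td: "(T has_real_derivative - 2 * H * l x * T x) (at x within X)" for x X
    unfolding T_def cusp_depth_def l_def by (auto intro!: derivative_eq_intros)
  have \<gamma>d: "(\<gamma> has_vector_derivative D x) (at x within X)" for x X
  proof -
    have 1: "((\<lambda>x. T x *\<^sub>R e) has_vector_derivative (- 2 * H * l x * T x) *\<^sub>R e) (at x within X)"
      using has_vector_derivative_scaleR[OF Td has_vector_derivative_const[of e]] by simp
    have 2: "((\<lambda>x. (k * x) *\<^sub>R v) has_vector_derivative k *\<^sub>R v) (at x within X)"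
      by (auto intro!: derivative_eq_intros)
    have "((\<lambda>x. p + (k * x) *\<^sub>R v + T x *\<^sub>R e) has_vector_derivative 0 + k *\<^sub>R v + (- 2 * H * l x * T x) *\<^sub>R e) (at x within X)"
      by (intro has_vector_derivative_add has_vector_derivative_const 1 2)
    then show ?thesis unfolding \<gamma>_def D_def scaleR_eq_scale by simp
  qed
  have "continuous_on {0..1} D" unfolding D_def l_def T_def cusp_depth_def
    by (intro continuous_intros)
  then have p: "pc1_on 0 1 \<gamma>" using \<gamma>d by (intro pc1_on.piece) (auto simp: c1_on_def)
  have \<gamma>G: "\<gamma> ` {0..1} \<subseteq> G"
  proof
    fix y assume "y \<in> \<gamma> ` {0..1}"
    then obtain x where x: "x \<in> {0..1}" "y = \<gamma> x" by blast
    have "p + of_real (k * x) *s v + 0 *s v + of_real (T x) *s e \<in> G"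
      using T(2,3)[of x] assms(2) by (intro G x) auto
    then show "y \<in> G" unfolding x(2) \<gamma>_def by simp
  qed
  have "d (\<gamma> 0) (\<gamma> 1) \<le> H * (1 - 0)"
  proof (rule dist_le_of_speed[OF p \<gamma>G])
    fix x :: real assume x: "x \<in> {0<..<1}"
    show "kobayashi_metric G (\<gamma> x) (vector_derivative \<gamma> (at x)) \<le> H"
      unfolding vector_derivative_at[OF \<gamma>d] unfolding \<gamma>_def D_def
      by (rule kobayashi_metric_cusp_le[where \<epsilon> = \<epsilon>]) (use G x assms T in \<open>auto simp: l_def\<close>)
  qed (use assms in auto)
  then show ?thesis by (simp add: \<gamma>_def T_def)
qed

text \<open>Two points are joined inside the complex line through them: a hyperplane that misses them meets
this line in at most one point, and removing a point from a connected open set in the plane leaves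
it connected.\<close>

lemma connected_minus_hyperplane:
  fixes \<Omega> :: "(complex ^ 'n) set"
  assumes "open \<Omega>" "c_convex \<Omega>"
  shows "connected (\<Omega> - {z. cdot a z = b})"
  unfolding connected_iff_connected_component
proof (intro ballI)
  fix z w assume z: "z \<in> \<Omega> - {z. cdot a z = b}" and w: "w \<in> \<Omega> - {z. cdot a z = b}"
  let ?T = "slice \<Omega> z w" and ?m = "cdot a z - cdot a w"
  let ?t0 = "(b - cdot a w) / ?m"
  define T' where "T' = (if ?m = 0 then ?T else ?T - {?t0})"
  have "simply_connected ?T" using c_convex_imp_slices_simply_connected[OF assms(2)] z w
    unfolding slices_simply_connected_def by blast
  then have con: "connected ?T" by (rule simply_connected_imp_connected)
  then have con': "connected T'"
    using connected_open_delete[of ?T ?t0] open_slice[OF assms(1), of z w] by (auto simp: T'_def)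
  have val: "cdot a (w + \<tau> *s (z - w)) = cdot a w + \<tau> * ?m" for \<tau>
    by (simp only: cdot_add cdot_scale cdot_diff)
  have iff: "\<tau> \<in> T' \<longleftrightarrow> w + \<tau> *s (z - w) \<in> \<Omega> - {z. cdot a z = b}" for \<tau>
  proof -
    have "cdot a w + \<tau> * ?m = b \<longleftrightarrow> (?m \<noteq> 0 \<and> \<tau> = ?t0)"
      using w by (cases "?m = 0") (auto simp: field_simps)
    then show ?thesis unfolding Diff_iff mem_Collect_eq val T'_def slice_def by auto
  qed
  let ?I = "(\<lambda>\<tau>. w + \<tau> *s (z - w)) ` T'"
  have "connected ?I" by (intro connected_continuous_image continuous_intros con')
  moreover have "?I \<subseteq> \<Omega> - {z. cdot a z = b}" using iff by blast
  moreover have "z \<in> ?I" by (rule image_eqI[of _ _ 1]) (use iff[of 1] z in auto)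
  moreover have "w \<in> ?I" by (rule image_eqI[of _ _ 0]) (use iff[of 0] w in auto)
  ultimately show "connected_component (\<Omega> - {z. cdot a z = b}) z w"
    unfolding connected_component_def by blast
qed

lemma hyperplane_complement_complete:
  fixes \<Omega> :: "(complex ^ 'n) set"
  assumes "open \<Omega>" "\<Omega> \<noteq> {}" "bounded \<Omega>" "c_convex \<Omega>"
  shows "complete_kobayashi_domain (\<Omega> - {z. cdot a z = b})"
proof
  have "closed {z. cdot a z = b}" by (intro closed_Collect_eq continuous_intros)
  then show "open (\<Omega> - {z. cdot a z = b})" using assms(1) by (rule open_Diff[rotated])
  show "connected (\<Omega> - {z. cdot a z = b})" by (rule connected_minus_hyperplane[OF assms(1,4)])
  show "bounded (\<Omega> - {z. cdot a z = b})" by (rule bounded_subset[OF assms(3)]) auto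
  fix p assume "p \<notin> \<Omega> - {z. cdot a z = b}"
  then consider "p \<notin> \<Omega>" | "cdot a p = b" by blast
  then show "\<exists>a'. \<forall>z\<in>\<Omega> - {z. cdot a z = b}. cdot a' (z - p) \<noteq> 0"
  proof cases
    case 1
    then obtain a' where "\<forall>z\<in>\<Omega>. cdot a' (z - p) \<noteq> 0" using c_convex_imp_linearly_convex[OF assms(1,2,4)] by blast
    then show ?thesis by blast
  next
    case 2
    then show ?thesis by (intro exI[of _ a]) (auto simp: cdot_diff)
  qed
qed

lemma ex_direction_in_hyperplane:
  fixes a :: "complex ^ 'n"
  assumes "CARD('n) \<ge> 2" shows "\<exists>v. v \<noteq> 0 \<and> cdot a v = 0"
proof -
  obtain i j :: 'n where ij: "i \<noteq> j"
    using assms card_le_Suc0_iff_eq[of "UNIV :: 'n set"] by fastforce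
  show ?thesis
  proof (cases "a $ i = 0")
    case True
    then show ?thesis by (intro exI[of _ "axis i 1"]) (simp add: cdot_axis_right axis_eq_0_iff)
  next
    case False
    let ?v = "axis j 1 - (a $ j / a $ i) *s axis i (1 :: complex)"
    have "?v $ j = 1" using ij by (simp add: axis_def)
    then have "?v \<noteq> 0" by (metis zero_index zero_neq_one)
    moreover have "cdot a ?v = 0" using False unfolding cdot_diff cdot_scale cdot_axis_right by simp
    ultimately show ?thesis by blast
  qed
qed

lemma ex_normal_to_hyperplane:
  fixes a :: "complex ^ 'n"
  assumes "a \<noteq> 0" shows "\<exists>e. cdot a e = 1"
proof -
  obtain i where "a $ i \<noteq> 0" using assms by (auto simp: vec_eq_iff)
  then have "cdot a ((1 / a $ i) *s axis i 1) = 1" unfolding cdot_scale cdot_axis_right by simp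
  then show ?thesis by blast
qed

lemma ray_exit_point:
  fixes p v :: "complex ^ 'n"
  assumes "open \<Omega>" "bounded \<Omega>" "p \<in> \<Omega>" "v \<noteq> 0"
  shows "\<exists>s>0. p + of_real s *s v \<notin> \<Omega> \<and> (\<forall>t. 0 \<le> t \<and> t < s \<longrightarrow> p + of_real t *s v \<in> \<Omega>)"
proof -
  let ?f = "\<lambda>s::real. p + of_real s *s v"
  let ?X = "{s. 0 \<le> s \<and> ?f s \<notin> \<Omega>}"
  have cont: "continuous_on UNIV ?f" by (intro continuous_intros)
  have "closed ({0..} \<inter> ?f -` (- \<Omega>))"
    using assms(1) by (intro closed_Int closed_vimage[OF _ cont]) auto
  moreover have "{0..} \<inter> ?f -` (- \<Omega>) = ?X" by auto
  ultimately have cl: "closed ?X" by simp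
  obtain B where B: "\<And>x. x \<in> \<Omega> \<Longrightarrow> norm x \<le> B" using assms(2) bounded_iff by blast
  define s where "s = (B + norm p + 1) / norm v"
  have nv: "norm v > 0" using assms(4) by simp
  have B0: "B \<ge> 0" using B[OF assms(3)] norm_ge_zero order_trans by blast
  have s0: "s \<ge> 0" using B0 nv by (simp add: s_def)
  have "norm (of_real s *s v) = B + norm p + 1"
  proof -
    have "norm (of_real s *s v) = s * norm v" using s0 by (simp only: norm_scale norm_of_real abs_of_nonneg)
    then show ?thesis using nv by (simp add: s_def)
  qed
  moreover have "norm (of_real s *s v) \<le> norm (?f s) + norm p"
    using norm_triangle_ineq4[of "?f s" p] by simp
  ultimately have "norm (?f s) > B" by linarith
  then have "?f s \<notin> \<Omega>" using B by force
  then have ne: "?X \<noteq> {}" using s0 by blast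
  have bd: "bdd_below ?X" by (rule bdd_belowI[of _ 0]) auto
  have in_X: "Inf ?X \<in> ?X" by (rule closed_contains_Inf[OF ne bd cl])
  have "Inf ?X \<noteq> 0"
  proof
    assume "Inf ?X = 0"
    then have "?f 0 \<notin> \<Omega>" using in_X by simp
    then show False using assms(3) by simp
  qed
  moreover have "?f t \<in> \<Omega>" if "0 \<le> t" "t < Inf ?X" for t
    using cInf_lower[OF _ bd, of t] that by force
  ultimately show ?thesis using in_X by (intro exI[of _ "Inf ?X"]) auto
qed

lemma ex_deep_cusp_depth:
  assumes "\<epsilon> > 0" "t0 > 0"
  shows "\<exists>A. cusp_depth \<epsilon> A < t0 \<and> Y \<le> exp (2 * A)"
proof -
  define y where "y = max (max 1 Y) (ln (\<epsilon> / t0) + 1)"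
  have y: "y \<ge> 1" "Y \<le> y" "ln (\<epsilon> / t0) < y" by (auto simp: y_def)
  have e: "exp (2 * (ln y / 2)) = y" using y by simp
  have "\<epsilon> / t0 < exp y" using y(3) assms by (metis exp_ln exp_less_cancel_iff divide_pos_pos)
  then have "cusp_depth \<epsilon> (ln y / 2) < t0"
    unfolding cusp_depth_def e using assms by (simp add: exp_minus field_simps)
  then show ?thesis using y e by (intro exI[of _ "ln y / 2"]) simp
qed

lemma cusp_depth_antimono: "\<epsilon> > 0 \<Longrightarrow> A \<le> B \<Longrightarrow> cusp_depth \<epsilon> B \<le> cusp_depth \<epsilon> A"
  by (simp add: cusp_depth_def)

text \<open>Comparison of the depths with respect to the punctured discs of radii \<open>\<epsilon> \<le> R\<close>: the larger disc
adds \<open>ln (R / \<epsilon>)\<close> to \<open>exp (2 * A)\<close> under the outer logarithm, which is negligible far down in the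
cusp.\<close>

lemma half_ln_ln_cusp_depth:
  assumes "0 < \<epsilon>" "\<epsilon> \<le> R"
  shows "A \<le> ln (ln (R / cusp_depth \<epsilon> A)) / 2"
    and "ln (R / \<epsilon>) \<le> exp (2 * A) \<Longrightarrow> ln (ln (R / cusp_depth \<epsilon> A)) / 2 \<le> A + 1"
proof -
  have "ln (R / cusp_depth \<epsilon> A) = ln (R / \<epsilon> * exp (exp (2 * A)))"
    by (simp add: cusp_depth_def exp_minus field_simps)
  also have "\<dots> = ln (R / \<epsilon>) + exp (2 * A)" using assms by (subst ln_mult) auto
  finally have eq: "ln (R / cusp_depth \<epsilon> A) = ln (R / \<epsilon>) + exp (2 * A)" .
  have l: "ln (R / \<epsilon>) \<ge> 0" using assms by simp
  have "exp (2 * A) \<le> ln (R / cusp_depth \<epsilon> A)" unfolding eq using l by simp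
  then have "ln (exp (2 * A)) \<le> ln (ln (R / cusp_depth \<epsilon> A))" by (subst ln_le_cancel_iff) (auto intro: less_le_trans[OF exp_gt_zero])
  then show "A \<le> ln (ln (R / cusp_depth \<epsilon> A)) / 2" by simp
  assume "ln (R / \<epsilon>) \<le> exp (2 * A)"
  then have "ln (R / cusp_depth \<epsilon> A) \<le> 2 * exp (2 * A)" unfolding eq by simp
  also have "\<dots> \<le> exp 2 * exp (2 * A)" using exp_ge_add_one_self[of 2] by (intro mult_right_mono) auto
  also have "\<dots> = exp (2 * (A + 1))" by (simp add: exp_add[symmetric] algebra_simps)
  finally have "ln (R / cusp_depth \<epsilon> A) \<le> exp (2 * (A + 1))" .
  moreover have "ln (R / cusp_depth \<epsilon> A) > 0" unfolding eq using l by (simp add: add_nonneg_pos)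
  ultimately have "ln (ln (R / cusp_depth \<epsilon> A)) \<le> ln (exp (2 * (A + 1)))" by (subst ln_le_cancel_iff) auto
  then show "ln (ln (R / cusp_depth \<epsilon> A)) / 2 \<le> A + 1" by simp
qed

text \<open>Follow the ray from \<open>p\<close> in the direction \<open>v\<close> to the point \<open>q1\<close> where it leaves \<open>\<Omega>\<close>. The height
with respect to a hyperplane through \<open>q1\<close> avoiding \<open>\<Omega>\<close> tends to infinity along the ray and is
continuous on \<open>\<Omega>\<close>, so the separation obtained on the ray persists for small displacements by
multiples of \<open>e\<close>. The segment is kept inside \<open>\<Omega>\<close>, as the cusp along it has to be.\<close>

lemma horizontal_separation:
  fixes \<Omega> :: "(complex ^ 'n) set"
  assumes "open \<Omega>" "bounded \<Omega>" "c_convex \<Omega>" "p \<in> \<Omega>" "v \<noteq> 0"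
    and G: "complete_kobayashi_domain G" "G \<subseteq> \<Omega>"
  shows "\<exists>s>0. \<exists>t0>0. (\<forall>t. 0 \<le> t \<and> t \<le> s \<longrightarrow> p + of_real t *s v \<in> \<Omega>) \<and>
     (\<forall>t. 0 < t \<and> t < t0 \<and> p + of_real t *s e \<in> G \<and> p + of_real s *s v + of_real t *s e \<in> G \<longrightarrow>
        W < kobayashi_dist G (p + of_real s *s v + of_real t *s e) (p + of_real t *s e))"
proof -
  interpret complete_kobayashi_domain G by (rule G(1))
  obtain s1 where s1: "s1 > 0" "p + of_real s1 *s v \<notin> \<Omega>"
    "\<And>t. 0 \<le> t \<Longrightarrow> t < s1 \<Longrightarrow> p + of_real t *s v \<in> \<Omega>"
    using ray_exit_point[OF assms(1,2,4,5)] by blast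
  define q1 where "q1 = p + of_real s1 *s v"
  obtain a where a: "\<And>z. z \<in> \<Omega> \<Longrightarrow> cdot a (z - q1) \<noteq> 0"
    using c_convex_imp_linearly_convex[OF assms(1) _ assms(3) s1(2)] assms(4) unfolding q1_def by blast
  obtain R where R: "R > 0" "\<And>z. z \<in> \<Omega> \<Longrightarrow> cmod (cdot a z - cdot a q1) < R"
    using functional_bounded_on[OF assms(2)] by blast
  interpret om: omitting_functional \<Omega> a "cdot a q1" R
    by unfold_locales (use assms(1) a R in \<open>auto simp: cdot_diff\<close>)
  have omG: "omitting_functional G a (cdot a q1) R"
    by unfold_locales (use open_G om.omits om.bounded G(2) in auto)
  let ?h = "cusp_height R a (cdot a q1)"
  have "((\<lambda>s. p + of_real s *s v) \<longlongrightarrow> p + of_real s1 *s v) (at_left s1)"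
  proof -
    have "continuous_on UNIV (\<lambda>s::real. p + of_real s *s v)" by (intro continuous_intros)
    then have "((\<lambda>s. p + of_real s *s v) \<longlongrightarrow> p + of_real s1 *s v) (at s1)"
      by (simp add: continuous_on_def)
    then show ?thesis by (rule tendsto_mono[OF at_le, rotated]) simp
  qed
  moreover have ev: "\<forall>\<^sub>F s in at_left s1. 0 < s \<and> s < s1"
    using s1(1) eventually_at_left_real[of 0 s1] by (auto elim: eventually_mono)
  moreover have "\<forall>\<^sub>F s in at_left s1. p + of_real s *s v \<in> \<Omega>"
    using ev by (rule eventually_mono) (use s1(3) in auto)
  ultimately have "filterlim (\<lambda>s. ?h (p + of_real s *s v)) at_top (at_left s1)"
    by (intro om.height_tendsto_infinity[OF _ _ _ R(1)]) (auto simp: q1_def)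
  then have "\<forall>\<^sub>F s in at_left s1. ?h (p + of_real s *s v) > ?h p + W"
    by (simp add: filterlim_at_top_dense)
  with ev have "\<forall>\<^sub>F s in at_left s1. (0 < s \<and> s < s1) \<and> ?h (p + of_real s *s v) > ?h p + W"
    by (rule eventually_conj)
  then obtain s where s: "0 < s" "s < s1" "?h (p + of_real s *s v) > ?h p + W"
    using eventually_happens'[OF trivial_limit_at_left_real] by blast
  define q where "q = p + of_real s *s v"
  have q: "q \<in> \<Omega>" using s1(3) s unfolding q_def by simp
  have lim: "((\<lambda>t::real. ?h (z + of_real t *s e)) \<longlongrightarrow> ?h z) (at_right 0)" if z: "z \<in> \<Omega>" for z
  proof -
    have "continuous_on UNIV (\<lambda>t::real. z + of_real t *s e)" by (intro continuous_intros)
    then have "isCont (\<lambda>t::real. z + of_real t *s e) 0" by (simp add: continuous_on_eq_continuous_at)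
    moreover have "isCont ?h (z + of_real 0 *s e)" using om.isCont_cusp_height[OF z] by simp
    ultimately have "isCont (\<lambda>t::real. ?h (z + of_real t *s e)) 0" by (rule isCont_o2)
    then have "((\<lambda>t::real. ?h (z + of_real t *s e)) \<longlongrightarrow> ?h z) (at 0)" by (simp add: isCont_def)
    then show ?thesis by (rule tendsto_mono[OF at_le, rotated]) simp
  qed
  have "((\<lambda>t::real. ?h (q + of_real t *s e) - ?h (p + of_real t *s e)) \<longlongrightarrow> ?h q - ?h p) (at_right 0)"
    by (intro tendsto_diff lim q assms(4))
  moreover have "W < ?h q - ?h p" using s(3) unfolding q_def by simp
  ultimately have "\<forall>\<^sub>F t in at_right (0::real). W < ?h (q + of_real t *s e) - ?h (p + of_real t *s e)"
    by (rule order_tendstoD)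
  then obtain t0 where t0: "t0 > 0" "\<And>t. 0 < t \<Longrightarrow> t < t0 \<Longrightarrow> W < ?h (q + of_real t *s e) - ?h (p + of_real t *s e)"
    unfolding eventually_at_right_field by blast
  have "W < d (q + of_real t *s e) (p + of_real t *s e)"
    if t: "0 < t" "t < t0" "p + of_real t *s e \<in> G" "q + of_real t *s e \<in> G" for t
    using t0(2)[OF t(1,2)] dist_ge_height[OF omG t(4,3)] by linarith
  then show ?thesis using s t0(1) s1(3) unfolding q_def
    by (intro exI[of _ s] exI[of _ t0] conjI allI impI) auto
qed

section \<open>Failure of Gromov hyperbolicity\<close>

theorem theorem1p3:
  fixes \<Omega> S :: "(complex ^ 'n) set"
  assumes "CARD('n) \<ge> 2"
    and "open \<Omega>" and "connected \<Omega>" and "\<Omega> \<noteq> {}"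
    and "bounded \<Omega>"
    and "c_convex \<Omega>"
    and "complex_affine_hyperplane S"
    and "\<Omega> \<inter> S \<noteq> {}"
  shows "\<not> gromov_hyperbolic (\<Omega> - S) (kobayashi_dist (\<Omega> - S))"
proof
  assume "gromov_hyperbolic (\<Omega> - S) (kobayashi_dist (\<Omega> - S))"
  then obtain M where thin: "\<And>A B C. geodesic_triangle (\<Omega> - S) (kobayashi_dist (\<Omega> - S)) A B C \<Longrightarrow>
      thin_triangle (kobayashi_dist (\<Omega> - S)) M A B C"
    unfolding gromov_hyperbolic_def by blast
  obtain a b where a: "a \<noteq> 0" and S: "S = {z. cdot a z = b}"
    using assms(7) unfolding complex_affine_hyperplane_def cdot_def by blast
  define G where "G = \<Omega> - S"
  have comp: "complete_kobayashi_domain G"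
    unfolding G_def S by (rule hyperplane_complement_complete[OF assms(2,4,5,6)])
  interpret complete_kobayashi_domain G by (rule comp)
  obtain p where p: "p \<in> \<Omega>" "cdot a p = b" using assms(8) S by blast
  obtain v where v: "v \<noteq> 0" "cdot a v = 0" using ex_direction_in_hyperplane[OF assms(1)] by blast
  obtain e where e: "cdot a e = 1" using ex_normal_to_hyperplane[OF a] by blast
  obtain s t0 where s: "s > 0" and t0: "t0 > 0"
    and seg: "\<And>t. 0 \<le> t \<Longrightarrow> t \<le> s \<Longrightarrow> p + of_real t *s v \<in> \<Omega>"
    and sep: "\<And>t. 0 < t \<Longrightarrow> t < t0 \<Longrightarrow> p + of_real t *s e \<in> G \<Longrightarrow> p + of_real s *s v + of_real t *s e \<in> G \<Longrightarrow>
        4 * M + 2 < d (p + of_real s *s v + of_real t *s e) (p + of_real t *s e)"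
    using horizontal_separation[OF assms(2,5,6) p(1) v(1) comp, of e "4 * M + 2"] unfolding G_def by blast
  define q where "q = p + of_real s *s v"
  have "compact ((\<lambda>t. p + of_real t *s v) ` {0..s})"
    by (intro compact_continuous_image continuous_intros) auto
  moreover have "(\<lambda>t. p + of_real t *s v) ` {0..s} \<subseteq> \<Omega>" using seg by auto
  ultimately obtain \<delta> where \<delta>: "\<delta> > 0" "(\<Union>x\<in>(\<lambda>t. p + of_real t *s v) ` {0..s}. ball x \<delta>) \<subseteq> \<Omega>"
    using compact_subset_open_imp_ball_epsilon_subset[OF _ assms(2)] by metis
  \<comment> \<open>With this radius a displacement by \<open>c v + u e\<close>, where \<open>\<bar>c\<bar>\<close> and \<open>\<bar>u\<bar>\<close> are less than \<open>\<epsilon>\<close>, has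
  norm less than \<open>\<delta>\<close>.\<close>
  define \<epsilon> where "\<epsilon> = \<delta> / (1 + norm v + norm e)"
  have den: "1 + norm v + norm e > 0" by (simp add: add_pos_nonneg)
  have \<epsilon>: "\<epsilon> > 0" using \<delta>(1) den by (simp add: \<epsilon>_def)
  have tube: "p + of_real t *s v + c *s v + u *s e \<in> G"
    if t: "0 \<le> t" "t \<le> s" and c: "cmod c < \<epsilon>" and u: "0 < cmod u" "cmod u < \<epsilon>" for t c u
  proof -
    have "norm (c *s v + u *s e) \<le> cmod c * norm v + cmod u * norm e"
      using norm_triangle_ineq[of "c *s v" "u *s e"] by (simp only: norm_scale)
    also have "\<dots> \<le> \<epsilon> * norm v + \<epsilon> * norm e"
      using c u by (intro add_mono mult_right_mono) auto
    also have "\<dots> < \<epsilon> * (1 + norm v + norm e)" using \<epsilon> by (simp add: algebra_simps)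
    also have "\<dots> = \<delta>" using den by (simp add: \<epsilon>_def)
    finally have "dist (p + of_real t *s v) (p + of_real t *s v + c *s v + u *s e) < \<delta>"
      by (simp add: dist_norm algebra_simps norm_minus_commute)
    then have "p + of_real t *s v + c *s v + u *s e \<in> \<Omega>" using \<delta>(2) t by force
    moreover have "cdot a (p + of_real t *s v + c *s v + u *s e) \<noteq> b"
      using u p v e by (auto simp: cdot_add cdot_scale)
    ultimately show ?thesis by (simp add: G_def S)
  qed
  \<comment> \<open>The descent must be long enough for the horizontal motion from \<open>p\<close> to \<open>q\<close>, and longer than the
  error \<open>1\<close> in the lower bound for the distance of \<open>x\<close> and \<open>y\<close>.\<close>
  define H where "H = max 2 (s / \<epsilon>)"
  have H: "H \<ge> 2" "s \<le> H * \<epsilon>"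
  proof -
    show "H \<ge> 2" by (simp add: H_def)
    have "s / \<epsilon> \<le> H" by (simp add: H_def)
    then show "s \<le> H * \<epsilon>" using \<epsilon> by (simp add: divide_le_eq)
  qed
  obtain R0 where R0: "R0 > 0" "\<And>z. z \<in> G \<Longrightarrow> cmod (cdot a z - b) < R0" using functional_bounded_on[OF bounded_G] by blast
  define R where "R = max R0 \<epsilon>"
  have om: "omitting_functional G a b R"
    by unfold_locales (use open_G R0 in \<open>auto simp: G_def S R_def less_max_iff_disj\<close>)
  obtain A where A: "cusp_depth \<epsilon> A < t0" "ln (R / \<epsilon>) \<le> exp (2 * A)"
    using ex_deep_cusp_depth[OF \<epsilon> t0] by blast
  let ?T = "\<lambda>B. complex_of_real (cusp_depth \<epsilon> B)"
  have TG: "p + ?T B *s e \<in> G" "q + ?T B *s e \<in> G" for B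
    using tube[of 0 0 "?T B"] tube[of s 0 "?T B"] s \<epsilon> cusp_depth_pos[OF \<epsilon>] cusp_depth_less[OF \<epsilon>]
    by (simp_all add: q_def less_imp_le)
  have vert: "d (p + ?T B *s e) (p + ?T (B + H) *s e) \<le> H" for B
  proof -
    have "d (p + ?T B *s e) (p + of_real 0 *s v + ?T (B + H) *s e) \<le> H"
      by (rule dist_cusp_le[OF _ \<epsilon>]) (use tube[of 0] s H \<epsilon> in auto)
    then show ?thesis by simp
  qed
  have outward: "d (p + ?T B *s e) (q + ?T (B + H) *s e) \<le> H" for B
    unfolding q_def
  proof (rule dist_cusp_le[OF _ \<epsilon>])
    fix x :: real and c u assume "x \<in> {0..1}" "cmod c < \<epsilon>" "0 < cmod u" "cmod u < \<epsilon>"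
    then show "p + of_real (s * x) *s v + c *s v + u *s e \<in> G"
      using s by (intro tube) (auto simp: mult_left_le)
  qed (use H s in auto)
  have inward: "d (q + ?T B *s e) (p + ?T (B + H) *s e) \<le> H" for B
  proof -
    have "d (q + ?T B *s e) (q + of_real (- s) *s v + ?T (B + H) *s e) \<le> H"
    proof (rule dist_cusp_le[OF _ \<epsilon>])
      fix x :: real and c u assume x: "x \<in> {0..1}" and cu: "cmod c < \<epsilon>" "0 < cmod u" "cmod u < \<epsilon>"
      have "p + of_real (s - s * x) *s v + c *s v + u *s e \<in> G"
        using s x by (intro tube cu) (auto simp: mult_left_le)
      moreover have "p + of_real (s - s * x) *s v = q + of_real (- s * x) *s v"
        unfolding q_def by (simp add: vec_eq_iff algebra_simps)
      ultimately show "q + of_real (- s * x) *s v + c *s v + u *s e \<in> G" by (simp only:)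
    qed (use H s in auto)
    moreover have "q + of_real (- s) *s v = p" unfolding q_def by (simp add: vec_eq_iff)
    ultimately show ?thesis by simp
  qed
  have height: "cusp_height R a b (p + ?T B *s e) = ln (ln (R / cusp_depth \<epsilon> B)) / 2" for B
    using cusp_depth_pos[OF \<epsilon>, of B] p(2) e by (simp add: cusp_height_def cdot_add cdot_scale)
  have "2 * H - 1 \<le> d (p + ?T A *s e) (p + ?T (A + H + H) *s e)"
    using dist_ge_height[OF om TG(1)[of A] TG(1)[of "A + H + H"]] unfolding height
    using half_ln_ln_cusp_depth(1)[OF \<epsilon>, of R "A + H + H"] half_ln_ln_cusp_depth(2)[OF \<epsilon> _ A(2)]
    by (simp add: R_def)
  then have "d (q + ?T (A + H) *s e) (p + ?T (A + H) *s e) \<le> 4 * M + 2"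
    using thin[folded G_def] TG H outward[of A] inward[of "A + H"] vert[of A] vert[of "A + H"]
    by (intro almost_midpoints_close[where x = "p + ?T A *s e" and y = "p + ?T (A + H + H) *s e" and H = H]) auto
  moreover have "cusp_depth \<epsilon> (A + H) < t0" using cusp_depth_antimono[OF \<epsilon>, of A "A + H"] A(1) H by simp
  then have "4 * M + 2 < d (q + ?T (A + H) *s e) (p + ?T (A + H) *s e)"
    using sep[of "cusp_depth \<epsilon> (A + H)"] TG cusp_depth_pos[OF \<epsilon>] unfolding q_def by blast
  ultimately show False by simp
qed

end
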